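(* Let $R$ be an algebra over a commutative ring $\mathbb K$, let $\mathcal B$ be a right $\times_R$-Hopf algebra over $R$, and let $S\subseteq T$ be a $\mathcal B$-Galois extension. Then the quotient $T_S:=S\widehat\otimes_ST\cong T/[S,T]$, where $[S,T]$ is the $\mathbb K$-submodule generated by $\{st-ts\mid s\in S,\ t\in T\}$, is a stable anti Yetter-Drinfel'd module of $\mathcal B$, with right $\mathcal B$-coaction induced by the coaction of $T$ along the canonical epimorphism $p_T:T\to T_S$, and left $\mathcal B$-action $b\triangleright p_T(t)=p_T(b^{\{+\}}\,t\,b^{\{-\}})$.
   Context: All algebras are associative and unital; implicit summation is used in index notations. An $R$-coring is a coalgebra in the monoidal category of $R$-bimodules. Right bialgebroid over $R$: data $\mathcal B=(B,\xi,\zeta,\Delta,\epsilon)$ with $B$ a $\mathbb K$-algebra, $\xi:R\to B$ and $\zeta:R^{op}\to B$ algebra maps with commuting ranges; $B$ is an $R$-bimodule by $r_1\cdot b\cdot r_2=b\,\zeta(r_1)\xi(r_2)$; $\Delta:B\to B\otimes_RB$, $b\mapsto b^{(1)}\otimes_Rb^{(2)}$, and $\epsilon:B\to R$ make this bimodule an $R$-coring; and (i) $\xi(r)b^{(1)}\otimes_Rb^{(2)}=b^{(1)}\otimes_R\zeta(r)b^{(2)}$; (ii) $\Delta(1_B)=1_B\otimes_R1_B$, $\Delta(bb')=b^{(1)}b'^{(1)}\otimes_Rb^{(2)}b'^{(2)}$; (iii) $\epsilon(1_B)=1_R$, $\epsilon(bb')=\epsilon(\xi(\epsilon(b))b')$.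 It is a right $\times_R$-Hopf algebra if $\vartheta:\mathcal B\otimes_{R^{op}}\mathcal B\to\mathcal B\otimes_R\mathcal B$, $b\otimes_{R^{op}}b'\mapsto bb'^{(1)}\otimes_Rb'^{(2)}$ is bijective; here in the domain $b\zeta(r)\otimes_{R^{op}}b'=b\otimes_{R^{op}}\zeta(r)b'$, and in the codomain $b\xi(r)\otimes_Rb'=b\otimes_Rb'\zeta(r)$. Write $b_-\otimes_{R^{op}}b_+:=\vartheta^{-1}(1_B\otimes_Rb)$. A right $\mathcal B$-comodule is a right $R$-module $X$ with a right $R$-linear, coassociative, counital coaction $X\to X\otimes_R\mathcal B$, $x\mapsto x^{[0]}\otimes_Rx^{[1]}$; it is an $R$-bimodule with left action $r\cdot x:=x^{[0]}\cdot\epsilon(\xi(r)x^{[1]})$. A right $\mathcal B$-comodule algebra is a $\mathbb K$-algebra and right $\mathcal B$-comodule $T$ whose multiplication is $R$-balanced and such that $1_T^{[0]}\otimes_R1_T^{[1]}=1_T\otimes_R1_B$ and $(tt')^{[0]}\otimes_R(tt')^{[1]}=t^{[0]}t'^{[0]}\otimes_Rt^{[1]}t'^{[1]}$. Its coinvariant subalgebra is $S=\{s\in T\mid s^{[0]}\otimes_Rs^{[1]}=s\otimes_R1_B\}$. It is a $\mathcal B$-Galois extension of $S$ if $\mathrm{can}:T\otimes_ST\to T\otimes_R\mathcal B$, $t'\otimes_St\mapsto t't^{[0]}\otimes_Rt^{[1]}$ is bijective. Write $b^{\{-\}}\otimes_Sb^{\{+\}}:=\mathrm{can}^{-1}(1_T\otimes_Rb)$;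 this is an element of the center $(T\otimes_ST)^S=\{z\in T\otimes_S T\mid sz=zs\ \forall s\in S\}$. An anti Yetter-Drinfel'd module of $\mathcal B$ is a right $\mathcal B$-comodule and left $\mathcal B$-module $X$ (action $\triangleright$) such that $x\cdot r=\zeta(r)\triangleright x$, $r\cdot x=\xi(r)\triangleright x$ (left sides: the $R$-actions underlying the comodule $X$), and $(b\triangleright x)^{[0]}\otimes_R(b\triangleright x)^{[1]}={b^{(1)}}_+\triangleright x^{[0]}\otimes_Rb^{(2)}x^{[1]}{b^{(1)}}_-$ for all $b\in B$, $x\in X$, $r\in R$. It is stable if moreover $x^{[1]}\triangleright x^{[0]}=x$ for all $x\in X$. *)

theory Defs
  imports "HOL-Algebra.Module" "HOL-Algebra.RingHom" "HOL-Algebra.Free_Abelian_Groups"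
begin

section \<open>Algebras and modules over a commutative ring\<close>

text \<open>
  The library locale \<open>algebra\<close> asks for a commutative algebra, hence the following
  non-commutative variant. The zero algebra is not excluded.
\<close>

locale assoc_algebra = module K A + ring A
  for K :: "('k, 'p) ring_scheme" and A :: "('k, 'a, 'q) module_scheme" +
  assumes smult_mult_left:
    "\<lbrakk>k \<in> carrier K; x \<in> carrier A; y \<in> carrier A\<rbrakk> \<Longrightarrow>
      k \<odot>\<^bsub>A\<^esub> (x \<otimes>\<^bsub>A\<^esub> y) = (k \<odot>\<^bsub>A\<^esub> x) \<otimes>\<^bsub>A\<^esub> y"
  and smult_mult_right:
    "\<lbrakk>k \<in> carrier K; x \<in> carrier A; y \<in> carrier A\<rbrakk> \<Longrightarrow>
      k \<odot>\<^bsub>A\<^esub> (x \<otimes>\<^bsub>A\<^esub> y) = x \<otimes>\<^bsub>A\<^esub> (k \<odot>\<^bsub>A\<^esub> y)"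

definition opposite :: "('a, 'q) ring_scheme \<Rightarrow> ('a, 'q) ring_scheme" where
  "opposite A = A\<lparr>monoid.mult := \<lambda>x y. y \<otimes>\<^bsub>A\<^esub> x\<rparr>"

definition algebra_hom ::
  "('k, 'p) ring_scheme \<Rightarrow> ('k, 'a, 'q) module_scheme \<Rightarrow> ('k, 'b, 's) module_scheme \<Rightarrow> ('a \<Rightarrow> 'b) set"
  where "algebra_hom K A B =
    {f \<in> ring_hom A B. \<forall>k\<in>carrier K. \<forall>x\<in>carrier A. f (k \<odot>\<^bsub>A\<^esub> x) = k \<odot>\<^bsub>B\<^esub> f x}"

text \<open>
  In the last axiom of each of the next two locales the \<open>K\<close>-module structure of \<open>M\<close> is required
  to be the one induced by that of \<open>A\<close>.
\<close>

locale right_mod = assoc_algebra K A + M: module K M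
  for K :: "('k, 'p) ring_scheme" and A :: "('k, 'a, 'q) module_scheme"
    and M :: "('k, 'm, 's) module_scheme" and ra :: "'m \<Rightarrow> 'a \<Rightarrow> 'm" +
  assumes ra_closed: "\<lbrakk>x \<in> carrier M; a \<in> carrier A\<rbrakk> \<Longrightarrow> ra x a \<in> carrier M"
    and ra_add_left: "\<lbrakk>x \<in> carrier M; y \<in> carrier M; a \<in> carrier A\<rbrakk> \<Longrightarrow>
      ra (x \<oplus>\<^bsub>M\<^esub> y) a = ra x a \<oplus>\<^bsub>M\<^esub> ra y a"
    and ra_add_right: "\<lbrakk>x \<in> carrier M; a \<in> carrier A; b \<in> carrier A\<rbrakk> \<Longrightarrow>
      ra x (a \<oplus>\<^bsub>A\<^esub> b) = ra x a \<oplus>\<^bsub>M\<^esub> ra x b"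
    and ra_assoc: "\<lbrakk>x \<in> carrier M; a \<in> carrier A; b \<in> carrier A\<rbrakk> \<Longrightarrow>
      ra x (a \<otimes>\<^bsub>A\<^esub> b) = ra (ra x a) b"
    and ra_one: "x \<in> carrier M \<Longrightarrow> ra x \<one>\<^bsub>A\<^esub> = x"
    and ra_smult: "\<lbrakk>k \<in> carrier K; x \<in> carrier M; a \<in> carrier A\<rbrakk> \<Longrightarrow>
      ra x (k \<odot>\<^bsub>A\<^esub> a) = k \<odot>\<^bsub>M\<^esub> ra x a"

locale left_mod = assoc_algebra K A + M: module K M
  for K :: "('k, 'p) ring_scheme" and A :: "('k, 'a, 'q) module_scheme"
    and M :: "('k, 'm, 's) module_scheme" and la :: "'a \<Rightarrow> 'm \<Rightarrow> 'm" +
  assumes la_closed: "\<lbrakk>a \<in> carrier A; x \<in> carrier M\<rbrakk> \<Longrightarrow> la a x \<in> carrier M"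
    and la_add_right: "\<lbrakk>a \<in> carrier A; x \<in> carrier M; y \<in> carrier M\<rbrakk> \<Longrightarrow>
      la a (x \<oplus>\<^bsub>M\<^esub> y) = la a x \<oplus>\<^bsub>M\<^esub> la a y"
    and la_add_left: "\<lbrakk>a \<in> carrier A; b \<in> carrier A; x \<in> carrier M\<rbrakk> \<Longrightarrow>
      la (a \<oplus>\<^bsub>A\<^esub> b) x = la a x \<oplus>\<^bsub>M\<^esub> la b x"
    and la_assoc: "\<lbrakk>a \<in> carrier A; b \<in> carrier A; x \<in> carrier M\<rbrakk> \<Longrightarrow>
      la (a \<otimes>\<^bsub>A\<^esub> b) x = la a (la b x)"
    and la_one: "x \<in> carrier M \<Longrightarrow> la \<one>\<^bsub>A\<^esub> x = x"
    and la_smult: "\<lbrakk>k \<in> carrier K; a \<in> carrier A; x \<in> carrier M\<rbrakk> \<Longrightarrow>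
      la (k \<odot>\<^bsub>A\<^esub> a) x = k \<odot>\<^bsub>M\<^esub> la a x"

locale bimod = left_mod K A M la + right_mod K A M ra
  for K :: "('k, 'p) ring_scheme" and A :: "('k, 'a, 'q) module_scheme"
    and M :: "('k, 'm, 's) module_scheme" and la :: "'a \<Rightarrow> 'm \<Rightarrow> 'm" and ra :: "'m \<Rightarrow> 'a \<Rightarrow> 'm" +
  assumes la_ra_commute: "\<lbrakk>a \<in> carrier A; x \<in> carrier M; b \<in> carrier A\<rbrakk> \<Longrightarrow>
      ra (la a x) b = la a (ra x b)"

definition lsum :: "('a, 'q) ring_scheme \<Rightarrow> 'a list \<Rightarrow> 'a" where
  "lsum M xs = foldr (ring.add M) xs \<zero>\<^bsub>M\<^esub>"

definition gen_submodule :: "('k, 'p) ring_scheme \<Rightarrow> ('k, 'm, 's) module_scheme \<Rightarrow> 'm set \<Rightarrow> 'm set"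
  where "gen_submodule K M G = \<Inter>{N. submodule N K M \<and> G \<subseteq> N}"

text \<open>
  Quotient module; the ring multiplication and unit that the record type carries along are
  irrelevant for a module and left unspecified.
\<close>

definition quot_module :: "('k, 'm, 's) module_scheme \<Rightarrow> 'm set \<Rightarrow> ('k, 'm set) module" where
  "quot_module M N =
    \<lparr>carrier = a_rcosets\<^bsub>M\<^esub> N, monoid.mult = undefined, one = undefined,
     ring.zero = N, ring.add = set_add M, smult = \<lambda>k X. \<Union>x\<in>X. N +>\<^bsub>M\<^esub> (k \<odot>\<^bsub>M\<^esub> x)\<rparr>"


section \<open>Tensor products\<close>

text \<open>
  \<open>M \<otimes>\<^sub>A N\<close>, for a right action \<open>ra\<close> of \<open>A\<close> on \<open>M\<close> and a left action \<open>la\<close> of \<open>A\<close> on \<open>N\<close>, as a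
  quotient of the free abelian group on \<open>M \<times> N\<close>. It is an abelian group in the
  multiplicative notation of the library. Only the carrier set of the ring of scalars enters, so that
  tensor products over an opposite ring need no separate treatment.
\<close>

definition tensor_rels ::
  "'a set \<Rightarrow> ('m, 'p) ring_scheme \<Rightarrow> ('m \<Rightarrow> 'a \<Rightarrow> 'm) \<Rightarrow> ('n, 'q) ring_scheme \<Rightarrow> ('a \<Rightarrow> 'n \<Rightarrow> 'n)
    \<Rightarrow> ('m \<times> 'n \<Rightarrow>\<^sub>0 int) set" where
  "tensor_rels A M ra N la =
     {frag_of (x \<oplus>\<^bsub>M\<^esub> x', y) - frag_of (x, y) - frag_of (x', y) | x x' y.
        x \<in> carrier M \<and> x' \<in> carrier M \<and> y \<in> carrier N}
   \<union> {frag_of (x, y \<oplus>\<^bsub>N\<^esub> y') - frag_of (x, y) - frag_of (x, y') | x y y'.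
        x \<in> carrier M \<and> y \<in> carrier N \<and> y' \<in> carrier N}
   \<union> {frag_of (ra x a, y) - frag_of (x, la a y) | x a y.
        x \<in> carrier M \<and> a \<in> A \<and> y \<in> carrier N}"

definition tensor_null ::
  "'a set \<Rightarrow> ('m, 'p) ring_scheme \<Rightarrow> ('m \<Rightarrow> 'a \<Rightarrow> 'm) \<Rightarrow> ('n, 'q) ring_scheme \<Rightarrow> ('a \<Rightarrow> 'n \<Rightarrow> 'n)
    \<Rightarrow> ('m \<times> 'n \<Rightarrow>\<^sub>0 int) set" where
  "tensor_null A M ra N la =
     generate (free_Abelian_group (carrier M \<times> carrier N)) (tensor_rels A M ra N la)"

definition tensor ::
  "'a set \<Rightarrow> ('m, 'p) ring_scheme \<Rightarrow> ('m \<Rightarrow> 'a \<Rightarrow> 'm) \<Rightarrow> ('n, 'q) ring_scheme \<Rightarrow> ('a \<Rightarrow> 'n \<Rightarrow> 'n)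
    \<Rightarrow> ('m \<times> 'n \<Rightarrow>\<^sub>0 int) set monoid" where
  "tensor A M ra N la =
     free_Abelian_group (carrier M \<times> carrier N) Mod tensor_null A M ra N la"

text \<open>The element \<open>\<Sum>\<^sub>i x\<^sub>i \<otimes> y\<^sub>i\<close> given by the list of pairs \<open>(x\<^sub>i, y\<^sub>i)\<close>.\<close>

definition tsum ::
  "'a set \<Rightarrow> ('m, 'p) ring_scheme \<Rightarrow> ('m \<Rightarrow> 'a \<Rightarrow> 'm) \<Rightarrow> ('n, 'q) ring_scheme \<Rightarrow> ('a \<Rightarrow> 'n \<Rightarrow> 'n)
    \<Rightarrow> ('m \<times> 'n) list \<Rightarrow> ('m \<times> 'n \<Rightarrow>\<^sub>0 int) set" where
  "tsum A M ra N la us =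
     tensor_null A M ra N la #>\<^bsub>free_Abelian_group (carrier M \<times> carrier N)\<^esub> sum_list (map frag_of us)"

text \<open>
  All ways of writing an element \<open>z\<close> of the tensor product as such a sum. An identity in
  index notation with implicit summation is rendered below by quantifying over all
  the representatives of the tensors that occur in it; since \<open>- (x \<otimes> y) = (- x) \<otimes> y\<close>, every element
  has a representative.
\<close>

definition treps ::
  "'a set \<Rightarrow> ('m, 'p) ring_scheme \<Rightarrow> ('m \<Rightarrow> 'a \<Rightarrow> 'm) \<Rightarrow> ('n, 'q) ring_scheme \<Rightarrow> ('a \<Rightarrow> 'n \<Rightarrow> 'n)
    \<Rightarrow> ('m \<times> 'n \<Rightarrow>\<^sub>0 int) set \<Rightarrow> ('m \<times> 'n) list set" where
  "treps A M ra N la z = {us \<in> lists (carrier M \<times> carrier N). tsum A M ra N la us = z}"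

text \<open>
  \<open>M \<otimes>\<^sub>A N \<otimes>\<^sub>A P\<close> without bracketing, for a right module \<open>M\<close>, a bimodule \<open>N\<close> (actions \<open>la\<close>, \<open>ra'\<close>) and
  a left module \<open>P\<close>.
\<close>

definition tensor3_rels ::
  "'a set \<Rightarrow> ('m, 'p) ring_scheme \<Rightarrow> ('m \<Rightarrow> 'a \<Rightarrow> 'm) \<Rightarrow> ('n, 'q) ring_scheme \<Rightarrow> ('a \<Rightarrow> 'n \<Rightarrow> 'n)
    \<Rightarrow> ('n \<Rightarrow> 'a \<Rightarrow> 'n) \<Rightarrow> ('o, 's) ring_scheme \<Rightarrow> ('a \<Rightarrow> 'o \<Rightarrow> 'o)
    \<Rightarrow> ('m \<times> 'n \<times> 'o \<Rightarrow>\<^sub>0 int) set" where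
  "tensor3_rels A M ra N la ra' P la' =
     {frag_of (x \<oplus>\<^bsub>M\<^esub> x', y, z) - frag_of (x, y, z) - frag_of (x', y, z) | x x' y z.
        x \<in> carrier M \<and> x' \<in> carrier M \<and> y \<in> carrier N \<and> z \<in> carrier P}
   \<union> {frag_of (x, y \<oplus>\<^bsub>N\<^esub> y', z) - frag_of (x, y, z) - frag_of (x, y', z) | x y y' z.
        x \<in> carrier M \<and> y \<in> carrier N \<and> y' \<in> carrier N \<and> z \<in> carrier P}
   \<union> {frag_of (x, y, z \<oplus>\<^bsub>P\<^esub> z') - frag_of (x, y, z) - frag_of (x, y, z') | x y z z'.
        x \<in> carrier M \<and> y \<in> carrier N \<and> z \<in> carrier P \<and> z' \<in> carrier P}
   \<union> {frag_of (ra x a, y, z) - frag_of (x, la a y, z) | x a y z.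
        x \<in> carrier M \<and> a \<in> A \<and> y \<in> carrier N \<and> z \<in> carrier P}
   \<union> {frag_of (x, ra' y a, z) - frag_of (x, y, la' a z) | x y a z.
        x \<in> carrier M \<and> y \<in> carrier N \<and> a \<in> A \<and> z \<in> carrier P}"

definition tsum3 ::
  "'a set \<Rightarrow> ('m, 'p) ring_scheme \<Rightarrow> ('m \<Rightarrow> 'a \<Rightarrow> 'm) \<Rightarrow> ('n, 'q) ring_scheme \<Rightarrow> ('a \<Rightarrow> 'n \<Rightarrow> 'n)
    \<Rightarrow> ('n \<Rightarrow> 'a \<Rightarrow> 'n) \<Rightarrow> ('o, 's) ring_scheme \<Rightarrow> ('a \<Rightarrow> 'o \<Rightarrow> 'o)
    \<Rightarrow> ('m \<times> 'n \<times> 'o) list \<Rightarrow> ('m \<times> 'n \<times> 'o \<Rightarrow>\<^sub>0 int) set" where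
  "tsum3 A M ra N la ra' P la' us =
     generate (free_Abelian_group (carrier M \<times> carrier N \<times> carrier P))
              (tensor3_rels A M ra N la ra' P la')
       #>\<^bsub>free_Abelian_group (carrier M \<times> carrier N \<times> carrier P)\<^esub> sum_list (map frag_of us)"

text \<open>
  The cyclic tensor product of two \<open>A\<close>-bimodules: the quotient of \<open>M \<otimes>\<^sub>A N\<close> by the
  relations \<open>a x \<otimes> y = x \<otimes> y a\<close>.
\<close>

definition cyc_null ::
  "'a set \<Rightarrow> ('m, 'p) ring_scheme \<Rightarrow> ('a \<Rightarrow> 'm \<Rightarrow> 'm) \<Rightarrow> ('m \<Rightarrow> 'a \<Rightarrow> 'm)
    \<Rightarrow> ('n, 'q) ring_scheme \<Rightarrow> ('a \<Rightarrow> 'n \<Rightarrow> 'n) \<Rightarrow> ('n \<Rightarrow> 'a \<Rightarrow> 'n) \<Rightarrow> ('m \<times> 'n \<Rightarrow>\<^sub>0 int) set set" where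
  "cyc_null A M la ra N la' ra' =
     generate (tensor A M ra N la')
       {tsum A M ra N la' [(la a x, y)] \<otimes>\<^bsub>tensor A M ra N la'\<^esub>
          inv\<^bsub>tensor A M ra N la'\<^esub> tsum A M ra N la' [(x, ra' y a)] | a x y.
        a \<in> A \<and> x \<in> carrier M \<and> y \<in> carrier N}"

definition cyc_tensor ::
  "'a set \<Rightarrow> ('m, 'p) ring_scheme \<Rightarrow> ('a \<Rightarrow> 'm \<Rightarrow> 'm) \<Rightarrow> ('m \<Rightarrow> 'a \<Rightarrow> 'm)
    \<Rightarrow> ('n, 'q) ring_scheme \<Rightarrow> ('a \<Rightarrow> 'n \<Rightarrow> 'n) \<Rightarrow> ('n \<Rightarrow> 'a \<Rightarrow> 'n) \<Rightarrow> ('m \<times> 'n \<Rightarrow>\<^sub>0 int) set set monoid" where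
  "cyc_tensor A M la ra N la' ra' = tensor A M ra N la' Mod cyc_null A M la ra N la' ra'"

definition cyc_pure ::
  "'a set \<Rightarrow> ('m, 'p) ring_scheme \<Rightarrow> ('a \<Rightarrow> 'm \<Rightarrow> 'm) \<Rightarrow> ('m \<Rightarrow> 'a \<Rightarrow> 'm)
    \<Rightarrow> ('n, 'q) ring_scheme \<Rightarrow> ('a \<Rightarrow> 'n \<Rightarrow> 'n) \<Rightarrow> ('n \<Rightarrow> 'a \<Rightarrow> 'n) \<Rightarrow> 'm \<Rightarrow> 'n
    \<Rightarrow> ('m \<times> 'n \<Rightarrow>\<^sub>0 int) set set" where
  "cyc_pure A M la ra N la' ra' x y =
     cyc_null A M la ra N la' ra' #>\<^bsub>tensor A M ra N la'\<^esub> tsum A M ra N la' [(x, y)]"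


section \<open>Corings and right bialgebroids\<close>

locale coring = bimod K R C la ra
  for K :: "('k, 'p) ring_scheme" and R :: "('k, 'r, 'q) module_scheme"
    and C :: "('k, 'c, 's) module_scheme" and la :: "'r \<Rightarrow> 'c \<Rightarrow> 'c" and ra :: "'c \<Rightarrow> 'r \<Rightarrow> 'c"
    and \<Delta> :: "'c \<Rightarrow> ('c \<times> 'c \<Rightarrow>\<^sub>0 int) set" and \<epsilon> :: "'c \<Rightarrow> 'r" +
  assumes comult_hom: "\<Delta> \<in> hom (add_monoid C) (tensor (carrier R) C ra C la)"
    and comult_left_linear:
      "\<lbrakk>r \<in> carrier R; c \<in> carrier C; us \<in> treps (carrier R) C ra C la (\<Delta> c)\<rbrakk> \<Longrightarrow>
        \<Delta> (la r c) = tsum (carrier R) C ra C la [(la r c1, c2). (c1, c2) \<leftarrow> us]"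
    and comult_right_linear:
      "\<lbrakk>r \<in> carrier R; c \<in> carrier C; us \<in> treps (carrier R) C ra C la (\<Delta> c)\<rbrakk> \<Longrightarrow>
        \<Delta> (ra c r) = tsum (carrier R) C ra C la [(c1, ra c2 r). (c1, c2) \<leftarrow> us]"
    and comult_coassoc:
      "\<lbrakk>c \<in> carrier C; us \<in> treps (carrier R) C ra C la (\<Delta> c);
        ds \<in> (\<Pi> d\<in>carrier C. treps (carrier R) C ra C la (\<Delta> d))\<rbrakk> \<Longrightarrow>
        tsum3 (carrier R) C ra C la ra C la [(d1, d2, c2). (c1, c2) \<leftarrow> us, (d1, d2) \<leftarrow> ds c1]
          = tsum3 (carrier R) C ra C la ra C la [(c1, d1, d2). (c1, c2) \<leftarrow> us, (d1, d2) \<leftarrow> ds c2]"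
    and counit_hom: "\<epsilon> \<in> hom (add_monoid C) (add_monoid R)"
    and counit_left_linear:
      "\<lbrakk>r \<in> carrier R; c \<in> carrier C\<rbrakk> \<Longrightarrow> \<epsilon> (la r c) = r \<otimes>\<^bsub>R\<^esub> \<epsilon> c"
    and counit_right_linear:
      "\<lbrakk>r \<in> carrier R; c \<in> carrier C\<rbrakk> \<Longrightarrow> \<epsilon> (ra c r) = \<epsilon> c \<otimes>\<^bsub>R\<^esub> r"
    and counit_left:
      "\<lbrakk>c \<in> carrier C; us \<in> treps (carrier R) C ra C la (\<Delta> c)\<rbrakk> \<Longrightarrow>
        lsum C [la (\<epsilon> c1) c2. (c1, c2) \<leftarrow> us] = c"
    and counit_right:
      "\<lbrakk>c \<in> carrier C; us \<in> treps (carrier R) C ra C la (\<Delta> c)\<rbrakk> \<Longrightarrow>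
        lsum C [ra c1 (\<epsilon> c2). (c1, c2) \<leftarrow> us] = c"

text \<open>
  The record \<open>B\<close> below carries the algebra together with \<open>\<xi> = src\<close>, \<open>\<zeta> = tgt\<close>,
  \<open>\<Delta> = comult\<close> and \<open>\<epsilon> = counit\<close>.
\<close>

record ('k, 'r, 'b) bialgebroid = "('k, 'b) module" +
  src :: "'r \<Rightarrow> 'b"
  tgt :: "'r \<Rightarrow> 'b"
  comult :: "'b \<Rightarrow> ('b \<times> 'b \<Rightarrow>\<^sub>0 int) set"
  counit :: "'b \<Rightarrow> 'r"

definition blact :: "('k, 'r, 'b) bialgebroid \<Rightarrow> 'r \<Rightarrow> 'b \<Rightarrow> 'b" where
  "blact B r b = b \<otimes>\<^bsub>B\<^esub> tgt B r"

definition bract :: "('k, 'r, 'b) bialgebroid \<Rightarrow> 'b \<Rightarrow> 'r \<Rightarrow> 'b" where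
  "bract B b r = b \<otimes>\<^bsub>B\<^esub> src B r"

text \<open>
  \<open>X \<otimes>\<^sub>R B\<close>, its elements and their representatives, for a right \<open>R\<close>-module \<open>X\<close> with action \<open>ra\<close>.
  The case \<open>X = B\<close>, \<open>ra = bract B\<close> is \<open>B \<otimes>\<^sub>R B\<close>.
\<close>

abbreviation tensorB ::
  "('k, 'r, 'q) module_scheme \<Rightarrow> ('k, 'r, 'b) bialgebroid \<Rightarrow> ('x, 's) ring_scheme \<Rightarrow> ('x \<Rightarrow> 'r \<Rightarrow> 'x)
    \<Rightarrow> ('x \<times> 'b \<Rightarrow>\<^sub>0 int) set monoid" where
  "tensorB R B X ra \<equiv> tensor (carrier R) X ra B (blact B)"

abbreviation tsumB ::
  "('k, 'r, 'q) module_scheme \<Rightarrow> ('k, 'r, 'b) bialgebroid \<Rightarrow> ('x, 's) ring_scheme \<Rightarrow> ('x \<Rightarrow> 'r \<Rightarrow> 'x)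
    \<Rightarrow> ('x \<times> 'b) list \<Rightarrow> ('x \<times> 'b \<Rightarrow>\<^sub>0 int) set" where
  "tsumB R B X ra \<equiv> tsum (carrier R) X ra B (blact B)"

abbreviation trepsB ::
  "('k, 'r, 'q) module_scheme \<Rightarrow> ('k, 'r, 'b) bialgebroid \<Rightarrow> ('x, 's) ring_scheme \<Rightarrow> ('x \<Rightarrow> 'r \<Rightarrow> 'x)
    \<Rightarrow> ('x \<times> 'b \<Rightarrow>\<^sub>0 int) set \<Rightarrow> ('x \<times> 'b) list set" where
  "trepsB R B X ra \<equiv> treps (carrier R) X ra B (blact B)"

locale right_bialgebroid =
  R: assoc_algebra K R + B: assoc_algebra K B +
  coring K R B "blact B" "bract B" "comult B" "counit B"
  for K :: "('k, 'p) ring_scheme" and R :: "('k, 'r, 'q) module_scheme"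
    and B :: "('k, 'r, 'b) bialgebroid" +
  assumes src_hom: "src B \<in> algebra_hom K R B"
    and tgt_hom: "tgt B \<in> algebra_hom K (opposite R) B"
    and src_tgt_commute: "\<lbrakk>r \<in> carrier R; r' \<in> carrier R\<rbrakk> \<Longrightarrow>
      src B r \<otimes>\<^bsub>B\<^esub> tgt B r' = tgt B r' \<otimes>\<^bsub>B\<^esub> src B r"
    and comult_takeuchi:
      "\<lbrakk>r \<in> carrier R; b \<in> carrier B; us \<in> trepsB R B B (bract B) (comult B b)\<rbrakk> \<Longrightarrow>
        tsumB R B B (bract B) [(src B r \<otimes>\<^bsub>B\<^esub> b1, b2). (b1, b2) \<leftarrow> us]
          = tsumB R B B (bract B) [(b1, tgt B r \<otimes>\<^bsub>B\<^esub> b2). (b1, b2) \<leftarrow> us]"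
    and comult_one: "comult B \<one>\<^bsub>B\<^esub> = tsumB R B B (bract B) [(\<one>\<^bsub>B\<^esub>, \<one>\<^bsub>B\<^esub>)]"
    and comult_mult:
      "\<lbrakk>b \<in> carrier B; b' \<in> carrier B; us \<in> trepsB R B B (bract B) (comult B b);
        us' \<in> trepsB R B B (bract B) (comult B b')\<rbrakk> \<Longrightarrow>
        comult B (b \<otimes>\<^bsub>B\<^esub> b') = tsumB R B B (bract B)
          [(b1 \<otimes>\<^bsub>B\<^esub> b1', b2 \<otimes>\<^bsub>B\<^esub> b2'). (b1, b2) \<leftarrow> us, (b1', b2') \<leftarrow> us']"
    and counit_one: "counit B \<one>\<^bsub>B\<^esub> = \<one>\<^bsub>R\<^esub>"
    and counit_mult: "\<lbrakk>b \<in> carrier B; b' \<in> carrier B\<rbrakk> \<Longrightarrow>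
      counit B (b \<otimes>\<^bsub>B\<^esub> b') = counit B (src B (counit B b) \<otimes>\<^bsub>B\<^esub> b')"

text \<open>
  \<open>B \<otimes>\<^bsub>R\<^sup>o\<^sup>p\<^esub> B\<close>, where \<open>b \<zeta>(r) \<otimes> b' = b \<otimes> \<zeta>(r) b'\<close>.
\<close>

abbreviation tensor_op ::
  "('k, 'r, 'q) module_scheme \<Rightarrow> ('k, 'r, 'b) bialgebroid \<Rightarrow> ('b \<times> 'b \<Rightarrow>\<^sub>0 int) set monoid" where
  "tensor_op R B \<equiv>
     tensor (carrier R) B (\<lambda>b r. b \<otimes>\<^bsub>B\<^esub> tgt B r) B (\<lambda>r b. tgt B r \<otimes>\<^bsub>B\<^esub> b)"

abbreviation treps_op ::
  "('k, 'r, 'q) module_scheme \<Rightarrow> ('k, 'r, 'b) bialgebroid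
    \<Rightarrow> ('b \<times> 'b \<Rightarrow>\<^sub>0 int) set \<Rightarrow> ('b \<times> 'b) list set" where
  "treps_op R B \<equiv>
     treps (carrier R) B (\<lambda>b r. b \<otimes>\<^bsub>B\<^esub> tgt B r) B (\<lambda>r b. tgt B r \<otimes>\<^bsub>B\<^esub> b)"

text \<open>
  A map defined on a tensor product by a formula on pure tensors is, here and below, given by
  the common value of that formula over all representatives.
\<close>

definition hopf_map ::
  "('k, 'r, 'q) module_scheme \<Rightarrow> ('k, 'r, 'b) bialgebroid
    \<Rightarrow> ('b \<times> 'b \<Rightarrow>\<^sub>0 int) set \<Rightarrow> ('b \<times> 'b \<Rightarrow>\<^sub>0 int) set" where
  "hopf_map R B z = (THE w. \<forall>us \<in> treps_op R B z.
     \<forall>ds \<in> (\<Pi> d\<in>carrier B. trepsB R B B (bract B) (comult B d)).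
       w = tsumB R B B (bract B) [(b \<otimes>\<^bsub>B\<^esub> d1, d2). (b, b') \<leftarrow> us, (d1, d2) \<leftarrow> ds b'])"

text \<open>\<open>b\<^sub>- \<otimes> b\<^sub>+\<close>\<close>

definition hopf_transl ::
  "('k, 'r, 'q) module_scheme \<Rightarrow> ('k, 'r, 'b) bialgebroid \<Rightarrow> 'b \<Rightarrow> ('b \<times> 'b \<Rightarrow>\<^sub>0 int) set" where
  "hopf_transl R B b =
     inv_into (carrier (tensor_op R B)) (hopf_map R B) (tsumB R B B (bract B) [(\<one>\<^bsub>B\<^esub>, b)])"

locale right_xR_Hopf = right_bialgebroid K R B
  for K :: "('k, 'p) ring_scheme" and R :: "('k, 'r, 'q) module_scheme"
    and B :: "('k, 'r, 'b) bialgebroid" +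
  assumes hopf_map_bij:
    "bij_betw (hopf_map R B) (carrier (tensor_op R B)) (carrier (tensorB R B B (bract B)))"


section \<open>Comodules, comodule algebras and Galois extensions\<close>

locale right_comodule = right_bialgebroid K R B + right_mod K R X ra
  for K :: "('k, 'p) ring_scheme" and R :: "('k, 'r, 'q) module_scheme"
    and B :: "('k, 'r, 'b) bialgebroid" and X :: "('k, 'x, 's) module_scheme"
    and ra :: "'x \<Rightarrow> 'r \<Rightarrow> 'x" and \<rho> :: "'x \<Rightarrow> ('x \<times> 'b \<Rightarrow>\<^sub>0 int) set" +
  assumes coact_hom: "\<rho> \<in> hom (add_monoid X) (tensorB R B X ra)"
    and coact_right_linear:
      "\<lbrakk>r \<in> carrier R; x \<in> carrier X; us \<in> trepsB R B X ra (\<rho> x)\<rbrakk> \<Longrightarrow>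
        \<rho> (ra x r) = tsumB R B X ra [(x0, bract B x1 r). (x0, x1) \<leftarrow> us]"
    and coact_coassoc:
      "\<lbrakk>x \<in> carrier X; us \<in> trepsB R B X ra (\<rho> x);
        rs \<in> (\<Pi> y\<in>carrier X. trepsB R B X ra (\<rho> y));
        ds \<in> (\<Pi> d\<in>carrier B. trepsB R B B (bract B) (comult B d))\<rbrakk> \<Longrightarrow>
        tsum3 (carrier R) X ra B (blact B) (bract B) B (blact B)
            [(y0, y1, x1). (x0, x1) \<leftarrow> us, (y0, y1) \<leftarrow> rs x0]
          = tsum3 (carrier R) X ra B (blact B) (bract B) B (blact B)
            [(x0, d1, d2). (x0, x1) \<leftarrow> us, (d1, d2) \<leftarrow> ds x1]"
    and coact_counit:
      "\<lbrakk>x \<in> carrier X; us \<in> trepsB R B X ra (\<rho> x)\<rbrakk> \<Longrightarrow>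
        lsum X [ra x0 (counit B x1). (x0, x1) \<leftarrow> us] = x"

text \<open>The left \<open>R\<close>-action on a right comodule.\<close>

definition comod_lact ::
  "('k, 'r, 'q) module_scheme \<Rightarrow> ('k, 'r, 'b) bialgebroid \<Rightarrow> ('x, 's) ring_scheme \<Rightarrow> ('x \<Rightarrow> 'r \<Rightarrow> 'x)
    \<Rightarrow> ('x \<Rightarrow> ('x \<times> 'b \<Rightarrow>\<^sub>0 int) set) \<Rightarrow> 'r \<Rightarrow> 'x \<Rightarrow> 'x" where
  "comod_lact R B X ra \<rho> r x = (THE y. \<forall>us \<in> trepsB R B X ra (\<rho> x).
     y = lsum X [ra x0 (counit B (src B r \<otimes>\<^bsub>B\<^esub> x1)). (x0, x1) \<leftarrow> us])"

locale comodule_algebra = assoc_algebra K T + right_comodule K R B T ra \<rho>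
  for K :: "('k, 'p) ring_scheme" and R :: "('k, 'r, 'q) module_scheme"
    and B :: "('k, 'r, 'b) bialgebroid" and T :: "('k, 't, 's) module_scheme"
    and ra :: "'t \<Rightarrow> 'r \<Rightarrow> 't" and \<rho> :: "'t \<Rightarrow> ('t \<times> 'b \<Rightarrow>\<^sub>0 int) set" +
  assumes mult_balanced: "\<lbrakk>t \<in> carrier T; r \<in> carrier R; t' \<in> carrier T\<rbrakk> \<Longrightarrow>
      ra t r \<otimes>\<^bsub>T\<^esub> t' = t \<otimes>\<^bsub>T\<^esub> comod_lact R B T ra \<rho> r t'"
    and coact_one: "\<rho> \<one>\<^bsub>T\<^esub> = tsumB R B T ra [(\<one>\<^bsub>T\<^esub>, \<one>\<^bsub>B\<^esub>)]"
    and coact_mult: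
      "\<lbrakk>t \<in> carrier T; t' \<in> carrier T; us \<in> trepsB R B T ra (\<rho> t); us' \<in> trepsB R B T ra (\<rho> t')\<rbrakk> \<Longrightarrow>
        \<rho> (t \<otimes>\<^bsub>T\<^esub> t') = tsumB R B T ra
          [(t0 \<otimes>\<^bsub>T\<^esub> t0', t1 \<otimes>\<^bsub>B\<^esub> t1'). (t0, t1) \<leftarrow> us, (t0', t1') \<leftarrow> us']"

definition coinvariants ::
  "('k, 'r, 'q) module_scheme \<Rightarrow> ('k, 'r, 'b) bialgebroid \<Rightarrow> ('t, 's) ring_scheme \<Rightarrow> ('t \<Rightarrow> 'r \<Rightarrow> 't)
    \<Rightarrow> ('t \<Rightarrow> ('t \<times> 'b \<Rightarrow>\<^sub>0 int) set) \<Rightarrow> 't set" where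
  "coinvariants R B T ra \<rho> = {s \<in> carrier T. \<rho> s = tsumB R B T ra [(s, \<one>\<^bsub>B\<^esub>)]}"

abbreviation tensorS :: "'t set \<Rightarrow> ('t, 's) ring_scheme \<Rightarrow> ('t \<times> 't \<Rightarrow>\<^sub>0 int) set monoid" where
  "tensorS S T \<equiv> tensor S T (monoid.mult T) T (monoid.mult T)"

abbreviation trepsS ::
  "'t set \<Rightarrow> ('t, 's) ring_scheme \<Rightarrow> ('t \<times> 't \<Rightarrow>\<^sub>0 int) set \<Rightarrow> ('t \<times> 't) list set" where
  "trepsS S T \<equiv> treps S T (monoid.mult T) T (monoid.mult T)"

definition can ::
  "('k, 'r, 'q) module_scheme \<Rightarrow> ('k, 'r, 'b) bialgebroid \<Rightarrow> 't set \<Rightarrow> ('t, 's) ring_scheme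
    \<Rightarrow> ('t \<Rightarrow> 'r \<Rightarrow> 't) \<Rightarrow> ('t \<Rightarrow> ('t \<times> 'b \<Rightarrow>\<^sub>0 int) set)
    \<Rightarrow> ('t \<times> 't \<Rightarrow>\<^sub>0 int) set \<Rightarrow> ('t \<times> 'b \<Rightarrow>\<^sub>0 int) set" where
  "can R B S T ra \<rho> z = (THE w. \<forall>us \<in> trepsS S T z.
     \<forall>rs \<in> (\<Pi> t\<in>carrier T. trepsB R B T ra (\<rho> t)).
       w = tsumB R B T ra [(t' \<otimes>\<^bsub>T\<^esub> t0, t1). (t', t) \<leftarrow> us, (t0, t1) \<leftarrow> rs t])"

text \<open>\<open>b\<^bsup>{-}\<^esup> \<otimes>\<^sub>S b\<^bsup>{+}\<^esup>\<close>\<close>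

definition can_transl ::
  "('k, 'r, 'q) module_scheme \<Rightarrow> ('k, 'r, 'b) bialgebroid \<Rightarrow> 't set \<Rightarrow> ('t, 's) ring_scheme
    \<Rightarrow> ('t \<Rightarrow> 'r \<Rightarrow> 't) \<Rightarrow> ('t \<Rightarrow> ('t \<times> 'b \<Rightarrow>\<^sub>0 int) set) \<Rightarrow> 'b \<Rightarrow> ('t \<times> 't \<Rightarrow>\<^sub>0 int) set" where
  "can_transl R B S T ra \<rho> b =
     inv_into (carrier (tensorS S T)) (can R B S T ra \<rho>) (tsumB R B T ra [(\<one>\<^bsub>T\<^esub>, b)])"

locale galois_extension = comodule_algebra K R B T ra \<rho>
  for K :: "('k, 'p) ring_scheme" and R :: "('k, 'r, 'q) module_scheme"
    and B :: "('k, 'r, 'b) bialgebroid" and S :: "'t set" and T :: "('k, 't, 's) module_scheme"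
    and ra :: "'t \<Rightarrow> 'r \<Rightarrow> 't" and \<rho> :: "'t \<Rightarrow> ('t \<times> 'b \<Rightarrow>\<^sub>0 int) set" +
  assumes coinv: "S = coinvariants R B T ra \<rho>"
    and can_bij: "bij_betw (can R B S T ra \<rho>) (carrier (tensorS S T)) (carrier (tensorB R B T ra))"


section \<open>Anti Yetter-Drinfel'd modules\<close>

locale anti_YD_module =
  right_xR_Hopf K R B + right_comodule K R B X ra \<rho> + left_mod K B X act
  for K :: "('k, 'p) ring_scheme" and R :: "('k, 'r, 'q) module_scheme"
    and B :: "('k, 'r, 'b) bialgebroid" and X :: "('k, 'x, 's) module_scheme"
    and ra :: "'x \<Rightarrow> 'r \<Rightarrow> 'x" and \<rho> :: "'x \<Rightarrow> ('x \<times> 'b \<Rightarrow>\<^sub>0 int) set" and act :: "'b \<Rightarrow> 'x \<Rightarrow> 'x" +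
  assumes ra_eq_act: "\<lbrakk>x \<in> carrier X; r \<in> carrier R\<rbrakk> \<Longrightarrow> ra x r = act (tgt B r) x"
    and la_eq_act: "\<lbrakk>x \<in> carrier X; r \<in> carrier R\<rbrakk> \<Longrightarrow>
      comod_lact R B X ra \<rho> r x = act (src B r) x"
    and act_coact:
      "\<lbrakk>b \<in> carrier B; x \<in> carrier X;
        us \<in> trepsB R B B (bract B) (comult B b); vs \<in> trepsB R B X ra (\<rho> x);
        hs \<in> (\<Pi> d\<in>carrier B. treps_op R B (hopf_transl R B d))\<rbrakk> \<Longrightarrow>
        \<rho> (act b x) = tsumB R B X ra
          [(act bp x0, b2 \<otimes>\<^bsub>B\<^esub> x1 \<otimes>\<^bsub>B\<^esub> bm). (b1, b2) \<leftarrow> us, (x0, x1) \<leftarrow> vs, (bm, bp) \<leftarrow> hs b1]"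

locale stable_anti_YD_module = anti_YD_module K R B X ra \<rho> act
  for K :: "('k, 'p) ring_scheme" and R :: "('k, 'r, 'q) module_scheme"
    and B :: "('k, 'r, 'b) bialgebroid" and X :: "('k, 'x, 's) module_scheme"
    and ra :: "'x \<Rightarrow> 'r \<Rightarrow> 'x" and \<rho> :: "'x \<Rightarrow> ('x \<times> 'b \<Rightarrow>\<^sub>0 int) set" and act :: "'b \<Rightarrow> 'x \<Rightarrow> 'x" +
  assumes stable: "\<lbrakk>x \<in> carrier X; vs \<in> trepsB R B X ra (\<rho> x)\<rbrakk> \<Longrightarrow>
      lsum X [act x1 x0. (x0, x1) \<leftarrow> vs] = x"


section \<open>The quotient by commutators\<close>

definition commutators :: "('k, 'p) ring_scheme \<Rightarrow> 't set \<Rightarrow> ('k, 't, 's) module_scheme \<Rightarrow> 't set" where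
  "commutators K S T =
     gen_submodule K T {s \<otimes>\<^bsub>T\<^esub> t \<ominus>\<^bsub>T\<^esub> t \<otimes>\<^bsub>T\<^esub> s | s t. s \<in> S \<and> t \<in> carrier T}"

definition comm_quot :: "('k, 'p) ring_scheme \<Rightarrow> 't set \<Rightarrow> ('k, 't, 's) module_scheme \<Rightarrow> ('k, 't set) module" where
  "comm_quot K S T = quot_module T (commutators K S T)"

definition comm_proj :: "('k, 'p) ring_scheme \<Rightarrow> 't set \<Rightarrow> ('k, 't, 's) module_scheme \<Rightarrow> 't \<Rightarrow> 't set" where
  "comm_proj K S T t = commutators K S T +>\<^bsub>T\<^esub> t"

text \<open>The cyclic tensor product of the \<open>S\<close>-bimodules \<open>S\<close> and \<open>T\<close>.\<close>

abbreviation cycS :: "'t set \<Rightarrow> ('t, 's) ring_scheme \<Rightarrow> ('t \<times> 't \<Rightarrow>\<^sub>0 int) set set monoid" where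
  "cycS S T \<equiv> cyc_tensor S (T\<lparr>carrier := S\<rparr>) (monoid.mult T) (monoid.mult T) T (monoid.mult T) (monoid.mult T)"

abbreviation cyc_pureS :: "'t set \<Rightarrow> ('t, 's) ring_scheme \<Rightarrow> 't \<Rightarrow> 't \<Rightarrow> ('t \<times> 't \<Rightarrow>\<^sub>0 int) set set" where
  "cyc_pureS S T \<equiv> cyc_pure S (T\<lparr>carrier := S\<rparr>) (monoid.mult T) (monoid.mult T) T (monoid.mult T) (monoid.mult T)"

end

theory Submission
  imports Defs
begin

text \<open>
  All tensors are handled as formal sums, that is, elements of the free abelian group on pairs, taken
  modulo the relations of the tensor product in question. An identity in Sweedler notation is a congruence
  of formal sums, and a Sweedler sum may be rewritten along it once the summand is balanced.

  Write \<open>can\<^sup>-\<^sup>1(1 \<otimes> b) = b\<^bsup>{-}\<^esup> \<otimes> b\<^bsup>{+}\<^esup>\<close> and \<open>\<theta>\<^sup>-\<^sup>1(1 \<otimes> b) = b\<^sub>- \<otimes> b\<^sub>+\<close>. All identities for these elements are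
  obtained by applying the injective maps \<open>can\<close> and \<open>\<theta>\<close>. Centrality of \<open>b\<^bsup>{-}\<^esup> \<otimes> b\<^bsup>{+}\<^esup>\<close> makes the action on
  \<open>T/[S,T]\<close> well defined, multiplicativity makes it an action, and \<open>t\<^sub>0 t\<^sub>1\<^bsup>{-}\<^esup> \<otimes> t\<^sub>1\<^bsup>{+}\<^esup> = 1 \<otimes> t\<close> gives stability. For the
  compatibility of action and coaction, \<open>b\<^bsup>{-}\<^esup> \<otimes> \<rho>(b\<^bsup>{+}\<^esup>) = b\<^sub>1\<^bsup>{-}\<^esup> \<otimes> b\<^sub>1\<^bsup>{+}\<^esup> \<otimes> b\<^sub>2\<close> reduces the claim to the
  coaction on \<open>t b\<^bsup>{-}\<^esup>\<close>; this is computed by evaluating the well defined map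
  \<open>t' \<otimes> b \<mapsto> (b\<^sub>+ \<triangleright> (t t')\<^sub>0) \<otimes> d (t t')\<^sub>1 b\<^sub>-\<close> on both sides of \<open>1 \<otimes> b = can(b\<^bsup>{-}\<^esup> \<otimes> b\<^bsup>{+}\<^esup>)\<close> and using
  \<open>b\<^sub>1 b\<^sub>2\<^sub>- \<otimes> b\<^sub>2\<^sub>+ = 1 \<otimes> b\<close>.
\<close>

section \<open>Congruences of formal sums\<close>

text \<open>The difficulty is bookkeeping over three base rings: b^- \<otimes> b^+ lives over S, b_-
  \<otimes> b_+ over the opposite of R, \<rho> and \<Delta> over R, and T \<otimes> B over R is not
  an algebra. No sum may be rewritten before its summand is known to be balanced, and each such
  proof needs a commutation rule for R. On the side of T these rules rest on three facts:
  multiplication is right R-linear (\<open>mult_ra\<close>), which is not an axiom but follows from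
  injectivity of \<rho>; hence both R-actions on T are multiplications by elements
  \<open>e r\<close>; and these commute with S (\<open>e_S_comm\<close>). The element b^+ t b^- of T
  depends on the representative of b^- \<otimes> b^+, and only its class modulo [S,T] does not. The
  computations therefore take place on T, after application of a function that is additive and
  vanishes on [S,T] (\<open>tr\<close>); the functions \<open>frag_of\<close>, t \<mapsto> t
  \<otimes> b and \<rho> give the action, the compatibility and the coaction.\<close>

inductive_set addspan :: "'a::ab_group_add set \<Rightarrow> 'a set" for G where
  addspan_zero: "0 \<in> addspan G"
| addspan_base: "x \<in> G \<Longrightarrow> x \<in> addspan G"
| addspan_diff: "x \<in> addspan G \<Longrightarrow> y \<in> addspan G \<Longrightarrow> x - y \<in> addspan G"

lemma addspan_uminus: "x \<in> addspan G \<Longrightarrow> - x \<in> addspan G"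
  using addspan_diff[OF addspan_zero] by fastforce

lemma addspan_add: "x \<in> addspan G \<Longrightarrow> y \<in> addspan G \<Longrightarrow> x + y \<in> addspan G"
  using addspan_diff[OF _ addspan_uminus] by fastforce

text \<open>The congruence is indexed by a generating set \<open>G\<close>, not by the subgroup: a
  map then has to be checked on generators only, and adding relations to \<open>G\<close> weakens
  the congruence (\<open>eqm_mono\<close>). Zero and differences already give the generated
  subgroup, so \<open>addspan\<close> has the same shape as the induction rule
  \<open>frag_induction\<close>.\<close>

definition eqm :: "'a::ab_group_add \<Rightarrow> 'a set \<Rightarrow> 'a \<Rightarrow> bool" ("(_ \<simeq>[_] _)" [51, 0, 51] 50)
  where "x \<simeq>[G] y \<longleftrightarrow> x - y \<in> addspan G"

lemma eqm_refl [simp, intro!]: "x \<simeq>[G] x"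
  by (simp add: eqm_def addspan_zero)

lemma eqm_sym: "x \<simeq>[G] y \<Longrightarrow> y \<simeq>[G] x"
  unfolding eqm_def using addspan_uminus by fastforce

lemma eqm_trans [trans]: "x \<simeq>[G] y \<Longrightarrow> y \<simeq>[G] z \<Longrightarrow> x \<simeq>[G] z"
  unfolding eqm_def using addspan_add by fastforce

lemma eqm_trans_eq [trans]: "x \<simeq>[G] y \<Longrightarrow> y = z \<Longrightarrow> x \<simeq>[G] z"
  by simp

lemma eq_trans_eqm [trans]: "x = y \<Longrightarrow> y \<simeq>[G] z \<Longrightarrow> x \<simeq>[G] z"
  by simp

lemma eqm_add: "x \<simeq>[G] y \<Longrightarrow> x' \<simeq>[G] y' \<Longrightarrow> x + x' \<simeq>[G] y + y'"
  unfolding eqm_def using addspan_add by (fastforce simp: algebra_simps)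

lemma eqm_diff: "x \<simeq>[G] y \<Longrightarrow> x' \<simeq>[G] y' \<Longrightarrow> x - x' \<simeq>[G] y - y'"
  unfolding eqm_def using addspan_diff[of "x - y" G "x' - y'"] by (simp add: algebra_simps)

lemma eqm_base: "x - y \<in> G \<Longrightarrow> x \<simeq>[G] y"
  unfolding eqm_def by (rule addspan_base)

lemma eqm_base_add: "x - y - z \<in> G \<Longrightarrow> x \<simeq>[G] y + z"
  by (rule eqm_base) (simp add: algebra_simps)

lemma eqm_zero_iff: "x \<simeq>[G] 0 \<longleftrightarrow> x \<in> addspan G"
  by (simp add: eqm_def)

lemma eqm_iff_diff_add: "x - y - z \<simeq>[G] 0 \<longleftrightarrow> x \<simeq>[G] y + z"
  by (simp add: eqm_def algebra_simps)

lemma eqm_mono: "x \<simeq>[G] y \<Longrightarrow> G \<subseteq> H \<Longrightarrow> x \<simeq>[H] y"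
proof -
  assume *: "G \<subseteq> H"
  have "z \<in> addspan G \<Longrightarrow> z \<in> addspan H" for z
    by (induction rule: addspan.induct) (use * in \<open>auto intro: addspan.intros\<close>)
  then show "x \<simeq>[G] y \<Longrightarrow> x \<simeq>[H] y" by (simp add: eqm_def)
qed

text \<open>Additive extension commutes with differences, so the preimage of the subgroup generated
  by \<open>H\<close> is a subgroup, and it suffices that it contains \<open>G\<close>. The
  well-definedness lemmas for tensor products, triple tensor products and the quotient are all
  instances.\<close>

lemma eqm_extend:
  assumes "\<And>n. n \<in> G \<Longrightarrow> frag_extend f n \<simeq>[H] 0" and "x \<simeq>[G] y"
  shows "frag_extend f x \<simeq>[H] frag_extend f y"
proof -
  have "z \<in> addspan G \<Longrightarrow> frag_extend f z \<in> addspan H" for z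
  proof (induction rule: addspan.induct)
    case (addspan_base x) then show ?case using assms(1) by (simp add: eqm_zero_iff)
  qed (auto simp: frag_extend_diff intro: addspan.intros)
  then show ?thesis using assms(2) by (simp add: eqm_def frag_extend_diff[symmetric])
qed

section \<open>Sweedler sums\<close>

abbreviation keys :: "('a \<Rightarrow>\<^sub>0 'b::zero) \<Rightarrow> 'a set"
  where "keys \<equiv> Poly_Mapping.keys"

text \<open>\<open>Sw z f\<close> is the Sweedler sum of \<open>f\<close> over the tensor \<open>z\<close>. Since its values are formal sums, sums can be
  rearranged without closure conditions.\<close>

definition Sw :: "('a \<times> 'b \<Rightarrow>\<^sub>0 int) \<Rightarrow> ('a \<Rightarrow> 'b \<Rightarrow> 'c \<Rightarrow>\<^sub>0 int) \<Rightarrow> 'c \<Rightarrow>\<^sub>0 int"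
  where "Sw z f = frag_extend (\<lambda>(x, y). f x y) z"

definition fl :: "'a list \<Rightarrow> 'a \<Rightarrow>\<^sub>0 int"
  where "fl us = sum_list (map frag_of us)"

lemma Sw_of [simp]: "Sw (frag_of (a, b)) f = f a b"
  by (simp add: Sw_def)

lemma Sw_0 [simp]: "Sw 0 f = 0"
  by (simp add: Sw_def)

lemma Sw_add: "Sw (z + w) f = Sw z f + Sw w f"
  by (simp add: Sw_def frag_extend_add)

lemma Sw_diff: "Sw (z - w) f = Sw z f - Sw w f"
  by (simp add: Sw_def frag_extend_diff)

lemma frag_induct_UNIV:
  assumes "P 0" "\<And>x. P (frag_of x)" "\<And>a b. P a \<Longrightarrow> P b \<Longrightarrow> P (a - b)"
  shows "P z"
  by (rule frag_induction[of z UNIV]) (use assms in auto)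

lemma frag_induct_pair:
  assumes "P 0" "\<And>x y. P (frag_of (x, y))" "\<And>a b. P a \<Longrightarrow> P b \<Longrightarrow> P (a - b)"
  shows "P z"
  by (rule frag_induct_UNIV) (use assms in auto)

lemma extend_extend: "frag_extend g (frag_extend f z) = frag_extend (\<lambda>x. frag_extend g (f x)) z"
  by (induction z rule: frag_induct_UNIV) (auto simp: frag_extend_diff)

lemma extend_Sw: "frag_extend g (Sw z f) = Sw z (\<lambda>x y. frag_extend g (f x y))"
  unfolding Sw_def extend_extend by (simp add: case_prod_unfold)

lemma Sw_Sw: "Sw (Sw z f) g = Sw z (\<lambda>x y. Sw (f x y) g)"
  using extend_Sw unfolding Sw_def by blast

lemma Sw_fadd: "Sw z (\<lambda>x y. f x y + g x y) = Sw z f + Sw z g"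
  by (induction z rule: frag_induct_pair) (auto simp: Sw_diff)

lemma Sw_fdiff: "Sw z (\<lambda>x y. f x y - g x y) = Sw z f - Sw z g"
  by (induction z rule: frag_induct_pair) (auto simp: Sw_diff)

lemma Sw_frag_of [simp]: "Sw z (\<lambda>x y. frag_of (x, y)) = z"
  by (induction z rule: frag_induct_pair) (auto simp: Sw_diff)

lemma Sw_swap: "Sw z (\<lambda>x y. Sw w (\<lambda>a b. f x y a b)) = Sw w (\<lambda>a b. Sw z (\<lambda>x y. f x y a b))"
  \<comment> \<open>The last instance of \<open>Sw_fdiff\<close> says that the sum of the zero
    function vanishes, as the case \<open>z = 0\<close> requires.\<close>
  by (induction z rule: frag_induct_pair) (auto simp: Sw_diff Sw_fdiff Sw_fdiff[of _ "\<lambda>_ _. 0" "\<lambda>_ _. 0", simplified])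

text \<open>Carrier conditions are read off from the support of \<open>z\<close>, so the summands
  are compared only on pairs that can occur.\<close>

lemma Sw_cong:
  assumes "keys z \<subseteq> A \<times> B" "\<And>x y. x \<in> A \<Longrightarrow> y \<in> B \<Longrightarrow> f x y \<simeq>[G] g x y"
  shows "Sw z f \<simeq>[G] Sw z g"
  using assms(1)
  by (induction z rule: frag_induction) (use assms(2) in \<open>auto simp: Sw_diff eqm_diff\<close>)

lemma Sw_cong_eq:
  assumes "keys z \<subseteq> A \<times> B" "\<And>x y. x \<in> A \<Longrightarrow> y \<in> B \<Longrightarrow> f x y = g x y"
  shows "Sw z f = Sw z g"
  using assms(1) by (induction z rule: frag_induction) (use assms(2) in \<open>auto simp: Sw_diff\<close>)

lemma keys_Sw:
  assumes "keys z \<subseteq> A \<times> B" "\<And>x y. x \<in> A \<Longrightarrow> y \<in> B \<Longrightarrow> keys (f x y) \<subseteq> C"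
  shows "keys (Sw z f) \<subseteq> C"
proof -
  have "(\<Union>u\<in>keys z. keys (case u of (x, y) \<Rightarrow> f x y)) \<subseteq> C"
    using assms by (intro UN_least) auto
  then show ?thesis
    using keys_frag_extend[of "\<lambda>(x, y). f x y" z] unfolding Sw_def by (rule order_trans[rotated])
qed

lemma keys_Sw_frag:
  assumes "keys z \<subseteq> A \<times> B" "\<And>x y. x \<in> A \<Longrightarrow> y \<in> B \<Longrightarrow> g x y \<in> C"
  shows "keys (Sw z (\<lambda>x y. frag_of (g x y))) \<subseteq> C"
  by (rule keys_Sw[OF assms(1)]) (use assms(2) in auto)

lemma fl_Nil [simp]: "fl [] = 0"
  by (simp add: fl_def)

lemma fl_Cons: "fl (x # xs) = frag_of x + fl xs"
  by (simp add: fl_def)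

lemma fl_single [simp]: "fl [x] = frag_of x"
  by (simp add: fl_def)

lemma fl_append: "fl (xs @ ys) = fl xs + fl ys"
  by (simp add: fl_def)

lemma fl_map: "fl (map (\<lambda>(x, y). e x y) us) = Sw (fl us) (\<lambda>x y. frag_of (e x y))"
  by (induction us) (auto simp: fl_Cons Sw_add)

lemma fl_concat: "fl (concat (map (\<lambda>(x, y). L x y) us)) = Sw (fl us) (\<lambda>x y. fl (L x y))"
  by (induction us) (auto simp: fl_Cons fl_append Sw_add)

lemma keys_fl: "us \<in> lists A \<Longrightarrow> keys (fl us) \<subseteq> A"
proof (induction us)
  case (Cons a us)
  have "keys (frag_of a + fl us) \<subseteq> {a} \<union> keys (fl us)"
    using keys_add[of "frag_of a" "fl us"] by simp
  with Cons show ?case unfolding fl_Cons by auto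
qed simp

section \<open>Tensor products and balanced maps\<close>

text \<open>A biadditive balanced map into the quotient of the free abelian group by
  \<open>G\<close>, given by representatives. Congruence instead of equality is essential, as the
  maps in question involve chosen representatives such as \<open>ds b\<close>, which are additive in
  b only up to relations.\<close>

definition balanced ::
  "'a set \<Rightarrow> ('m, 'p) ring_scheme \<Rightarrow> ('m \<Rightarrow> 'a \<Rightarrow> 'm) \<Rightarrow> ('n, 'q) ring_scheme \<Rightarrow> ('a \<Rightarrow> 'n \<Rightarrow> 'n)
    \<Rightarrow> ('c \<Rightarrow>\<^sub>0 int) set \<Rightarrow> ('m \<Rightarrow> 'n \<Rightarrow> 'c \<Rightarrow>\<^sub>0 int) \<Rightarrow> bool" where
  "balanced A M ra N la G f \<longleftrightarrow>
     (\<forall>x\<in>carrier M. \<forall>x'\<in>carrier M. \<forall>y\<in>carrier N. f (x \<oplus>\<^bsub>M\<^esub> x') y \<simeq>[G] f x y + f x' y)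
   \<and> (\<forall>x\<in>carrier M. \<forall>y\<in>carrier N. \<forall>y'\<in>carrier N. f x (y \<oplus>\<^bsub>N\<^esub> y') \<simeq>[G] f x y + f x y')
   \<and> (\<forall>x\<in>carrier M. \<forall>a\<in>A. \<forall>y\<in>carrier N. f (ra x a) y \<simeq>[G] f x (la a y))"

lemma balancedI:
  assumes "\<And>x x' y. x \<in> carrier M \<Longrightarrow> x' \<in> carrier M \<Longrightarrow> y \<in> carrier N \<Longrightarrow> f (x \<oplus>\<^bsub>M\<^esub> x') y \<simeq>[G] f x y + f x' y"
    and "\<And>x y y'. x \<in> carrier M \<Longrightarrow> y \<in> carrier N \<Longrightarrow> y' \<in> carrier N \<Longrightarrow> f x (y \<oplus>\<^bsub>N\<^esub> y') \<simeq>[G] f x y + f x y'"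
    and "\<And>x a y. x \<in> carrier M \<Longrightarrow> a \<in> A \<Longrightarrow> y \<in> carrier N \<Longrightarrow> f (ra x a) y \<simeq>[G] f x (la a y)"
  shows "balanced A M ra N la G f"
  using assms unfolding balanced_def by auto

lemma balancedD:
  assumes "balanced A M ra N la G f"
  shows "x \<in> carrier M \<Longrightarrow> x' \<in> carrier M \<Longrightarrow> y \<in> carrier N \<Longrightarrow> f (x \<oplus>\<^bsub>M\<^esub> x') y \<simeq>[G] f x y + f x' y"
    and "x \<in> carrier M \<Longrightarrow> y \<in> carrier N \<Longrightarrow> y' \<in> carrier N \<Longrightarrow> f x (y \<oplus>\<^bsub>N\<^esub> y') \<simeq>[G] f x y + f x y'"
    and "x \<in> carrier M \<Longrightarrow> a \<in> A \<Longrightarrow> y \<in> carrier N \<Longrightarrow> f (ra x a) y \<simeq>[G] f x (la a y)"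
  using assms unfolding balanced_def by auto

lemma Sw_balanced:
  assumes bal: "balanced A M ra N la G f" and zw: "z \<simeq>[tensor_rels A M ra N la] w"
  shows "Sw z f \<simeq>[G] Sw w f"
  unfolding Sw_def
proof (rule eqm_extend[OF _ zw])
  fix n assume "n \<in> tensor_rels A M ra N la"
  then show "frag_extend (\<lambda>(x, y). f x y) n \<simeq>[G] 0"
    unfolding tensor_rels_def
  proof (elim UnE CollectE exE conjE)
    fix x a y
    assume "n = frag_of (ra x a, y) - frag_of (x, la a y)" "x \<in> carrier M" "a \<in> A" "y \<in> carrier N"
    then show ?thesis
      using balancedD(3)[OF bal, of x a y] by (simp add: frag_extend_diff eqm_def)
  qed (simp_all only: frag_extend_diff frag_extend_of prod.case eqm_iff_diff_add balancedD[OF bal])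
qed

lemma tensor_add_left:
  "x \<in> carrier M \<Longrightarrow> x' \<in> carrier M \<Longrightarrow> y \<in> carrier N \<Longrightarrow>
    frag_of (x \<oplus>\<^bsub>M\<^esub> x', y) \<simeq>[tensor_rels A M ra N la] frag_of (x, y) + frag_of (x', y)"
  by (rule eqm_base_add) (unfold tensor_rels_def, blast)

lemma tensor_add_right:
  "x \<in> carrier M \<Longrightarrow> y \<in> carrier N \<Longrightarrow> y' \<in> carrier N \<Longrightarrow>
    frag_of (x, y \<oplus>\<^bsub>N\<^esub> y') \<simeq>[tensor_rels A M ra N la] frag_of (x, y) + frag_of (x, y')"
  by (rule eqm_base_add) (unfold tensor_rels_def, blast)

lemma tensor_mid:
  "x \<in> carrier M \<Longrightarrow> a \<in> A \<Longrightarrow> y \<in> carrier N \<Longrightarrow>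
    frag_of (ra x a, y) \<simeq>[tensor_rels A M ra N la] frag_of (x, la a y)"
  by (rule eqm_base) (unfold tensor_rels_def, blast)

text \<open>\<open>addspan\<close> ignores the support, while \<open>generate\<close> lives in the
  free group on \<open>X\<close>; they agree because generators supported in \<open>X\<close> have
  sums supported in \<open>X\<close>. This connects the cosets of the definitions with
  congruences.\<close>

lemma generate_free_eq_addspan:
  assumes "\<And>g. g \<in> G \<Longrightarrow> keys g \<subseteq> X"
  shows "generate (free_Abelian_group X) G = addspan G"
    and "z \<in> addspan G \<Longrightarrow> keys z \<subseteq> X"
proof -
  show k: "keys z \<subseteq> X" if "z \<in> addspan G" for z
    using that
  proof (induction rule: addspan.induct)
    case (addspan_diff x y)
    then show ?case using keys_diff[of x y] by blast
  qed (simp_all add: assms)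
  show "generate (free_Abelian_group X) G = addspan G"
  proof (intro equalityI subsetI)
    fix z assume "z \<in> generate (free_Abelian_group X) G"
    then show "z \<in> addspan G"
      by (induction rule: generate.induct)
        (use assms in \<open>auto intro: addspan.intros addspan_add addspan_uminus\<close>)
  next
    fix z assume "z \<in> addspan G"
    then show "z \<in> generate (free_Abelian_group X) G"
    proof (induction rule: addspan.induct)
      case addspan_zero
      show ?case using generate.one[of "free_Abelian_group X" G] by simp
    next
      case (addspan_diff x y)
      have "inv\<^bsub>free_Abelian_group X\<^esub> y \<in> generate (free_Abelian_group X) G"
        by (rule group.generate_m_inv_closed) (use assms addspan_diff in auto)
      then have "- y \<in> generate (free_Abelian_group X) G" using k addspan_diff by simp
      from generate.eng[OF addspan_diff(3) this] show ?case by simp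
    qed (rule generate.incl)
  qed
qed

lemma free_coset_eq_iff:
  assumes "\<And>g. g \<in> G \<Longrightarrow> keys g \<subseteq> X" "keys z \<subseteq> X" "keys w \<subseteq> X"
  shows "generate (free_Abelian_group X) G #>\<^bsub>free_Abelian_group X\<^esub> z
       = generate (free_Abelian_group X) G #>\<^bsub>free_Abelian_group X\<^esub> w \<longleftrightarrow> z \<simeq>[G] w" (is "?l \<longleftrightarrow> _")
proof -
  have "?l \<longleftrightarrow> (\<lambda>h. h + z) ` addspan G = (\<lambda>h. h + w) ` addspan G"
    by (simp add: generate_free_eq_addspan[OF assms(1)] r_coset_def UNION_singleton_eq_range)
  also have "\<dots> \<longleftrightarrow> z \<simeq>[G] w"
  proof
    assume "(\<lambda>h. h + z) ` addspan G = (\<lambda>h. h + w) ` addspan G"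
    moreover have "0 + z \<in> (\<lambda>h. h + z) ` addspan G" using addspan_zero by blast
    ultimately show "z \<simeq>[G] w" by (auto simp: eqm_def)
  next
    assume "z \<simeq>[G] w"
    then have 1: "z - w \<in> addspan G" "w - z \<in> addspan G"
      using eqm_sym by (auto simp: eqm_def)
    show "(\<lambda>h. h + z) ` addspan G = (\<lambda>h. h + w) ` addspan G"
    proof (intro equalityI subsetI; elim imageE)
      fix x h assume "x = h + z" "h \<in> addspan G"
      with addspan_add[OF _ 1(1)] show "x \<in> (\<lambda>h. h + w) ` addspan G"
        by (intro image_eqI[of _ _ "h + (z - w)"]) auto
    next
      fix x h assume "x = h + w" "h \<in> addspan G"
      with addspan_add[OF _ 1(2)] show "x \<in> (\<lambda>h. h + z) ` addspan G"
        by (intro image_eqI[of _ _ "h + (w - z)"]) auto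
    qed
  qed
  finally show ?thesis .
qed

text \<open>For an additive f the equation f(0) = f(0 + 0) has this form, so it yields f(0) =
  0.\<close>

lemma eqm_zero_of_double: "x \<simeq>[G] x + x \<Longrightarrow> x \<simeq>[G] 0"
  unfolding eqm_def using addspan_uminus by fastforce

lemma keys_diff3: "keys (a - b - c) \<subseteq> keys a \<union> keys b \<union> keys c"
  for a b c :: "'a \<Rightarrow>\<^sub>0 int"
  using keys_diff[of "a - b" c] keys_diff[of a b] by blast

lemma lists_sum_exists:
  assumes neg: "\<And>x. x \<in> X \<Longrightarrow> \<exists>x'\<in>X. - frag_of x \<simeq>[G] frag_of x'" and z: "keys z \<subseteq> X"
  shows "\<exists>us\<in>lists X. fl us \<simeq>[G] z"
proof -
  \<comment> \<open>Lists have no negative coefficients. The induction therefore carries z and - z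
    together: a representative of a - b joins one of a with one of - b.\<close>
  have "(\<exists>us\<in>lists X. fl us \<simeq>[G] z) \<and> (\<exists>us\<in>lists X. fl us \<simeq>[G] - z)"
    using z
  proof (induction z rule: frag_induction)
    case zero
    then show ?case by (metis eqm_refl fl_Nil lists.Nil minus_zero)
  next
    case (one x)
    obtain x' where x': "x' \<in> X" "- frag_of x \<simeq>[G] frag_of x'" using neg one by blast
    have "[x] \<in> lists X" "[x'] \<in> lists X" using one x' by auto
    with x' show ?case by (metis eqm_refl eqm_sym fl_single)
  next
    case (diff a b)
    then obtain us vs us' vs' where l: "us \<in> lists X" "vs \<in> lists X" "us' \<in> lists X" "vs' \<in> lists X"
      and e: "fl us \<simeq>[G] a" "fl vs \<simeq>[G] b" "fl us' \<simeq>[G] - a" "fl vs' \<simeq>[G] - b" by blast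
    have "us @ vs' \<in> lists X" "us' @ vs \<in> lists X" using l by auto
    moreover have "fl (us @ vs') \<simeq>[G] a - b" "fl (us' @ vs) \<simeq>[G] - (a - b)"
      using eqm_add[OF e(1,4)] eqm_add[OF e(3,2)] by (simp_all add: fl_append)
    ultimately show ?case by blast
  qed
  then show ?thesis by blast
qed

text \<open>Just enough for the relations to lie in the free group on
  \<open>carrier M \<times> carrier N\<close>. The scalars are a bare set, so the same locale serves
  R, its opposite and S.\<close>

locale tensor_data =
  fixes A :: "'a set" and M :: "('m, 'p) ring_scheme" and ra :: "'m \<Rightarrow> 'a \<Rightarrow> 'm"
    and N :: "('n, 'q) ring_scheme" and la :: "'a \<Rightarrow> 'n \<Rightarrow> 'n"
  assumes ab_M: "abelian_group M" and ab_N: "abelian_group N"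
    and ra_clo: "x \<in> carrier M \<Longrightarrow> a \<in> A \<Longrightarrow> ra x a \<in> carrier M"
    and la_clo: "a \<in> A \<Longrightarrow> y \<in> carrier N \<Longrightarrow> la a y \<in> carrier N"
begin

abbreviation "rels \<equiv> tensor_rels A M ra N la"
abbreviation "F \<equiv> free_Abelian_group (carrier M \<times> carrier N)"
abbreviation "TP \<equiv> tensor A M ra N la"
abbreviation "ts \<equiv> tsum A M ra N la"

interpretation M: abelian_group M by (rule ab_M)
interpretation N: abelian_group N by (rule ab_N)

lemma keys_rels: "g \<in> rels \<Longrightarrow> keys g \<subseteq> carrier M \<times> carrier N"
  unfolding tensor_rels_def
  by (elim UnE CollectE exE conjE;
      simp; rule order_trans[OF keys_diff3] order_trans[OF keys_diff]; simp add: ra_clo la_clo)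

lemma coset_eq_iff:
  assumes "keys z \<subseteq> carrier M \<times> carrier N" "keys w \<subseteq> carrier M \<times> carrier N"
  shows "tensor_null A M ra N la #>\<^bsub>F\<^esub> z = tensor_null A M ra N la #>\<^bsub>F\<^esub> w \<longleftrightarrow> z \<simeq>[rels] w"
  unfolding tensor_null_def by (rule free_coset_eq_iff) (use keys_rels assms in auto)

lemma tsum_eq_iff:
  assumes "us \<in> lists (carrier M \<times> carrier N)" "vs \<in> lists (carrier M \<times> carrier N)"
  shows "ts us = ts vs \<longleftrightarrow> fl us \<simeq>[rels] fl vs"
  using coset_eq_iff[OF keys_fl[OF assms(1)] keys_fl[OF assms(2)]] by (simp add: tsum_def fl_def)

lemma null_normal: "tensor_null A M ra N la \<lhd> F"
proof (rule comm_group.subgroup_imp_normal[OF abelian_free_Abelian_group])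
  show "subgroup (tensor_null A M ra N la) F"
    unfolding tensor_null_def
    by (rule group.generate_is_subgroup) (use keys_rels in auto)
qed

lemma comm_group_tensor: "comm_group TP"
  unfolding tensor_def
  by (rule comm_group.abelian_FactGroup[OF abelian_free_Abelian_group])
    (use null_normal in \<open>simp add: normal_def\<close>)

lemma neg_pure:
  assumes "u \<in> carrier M \<times> carrier N"
  shows "\<exists>u'\<in>carrier M \<times> carrier N. - frag_of u \<simeq>[rels] frag_of u'"
proof -
  obtain x y where u: "u = (x, y)" "x \<in> carrier M" "y \<in> carrier N" using assms by blast
  have z: "frag_of (\<zero>\<^bsub>M\<^esub>, y) \<simeq>[rels] 0"
    using tensor_add_left[of "\<zero>\<^bsub>M\<^esub>" M "\<zero>\<^bsub>M\<^esub>" y N A ra la] u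
    by (intro eqm_zero_of_double) simp
  have "frag_of (x \<oplus>\<^bsub>M\<^esub> \<ominus>\<^bsub>M\<^esub> x, y) \<simeq>[rels] frag_of (x, y) + frag_of (\<ominus>\<^bsub>M\<^esub> x, y)"
    by (rule tensor_add_left) (use u in auto)
  then have "0 \<simeq>[rels] frag_of (x, y) + frag_of (\<ominus>\<^bsub>M\<^esub> x, y)"
    using eqm_trans[OF eqm_sym[OF z]] u by (simp add: M.r_neg)
  then have "- frag_of u \<simeq>[rels] frag_of (\<ominus>\<^bsub>M\<^esub> x, y)"
    using u by (simp add: eqm_def algebra_simps)
  then show ?thesis using u by (intro bexI[of _ "(\<ominus>\<^bsub>M\<^esub> x, y)"]) auto
qed

lemma list_rep: "keys z \<subseteq> carrier M \<times> carrier N \<Longrightarrow>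
    \<exists>us\<in>lists (carrier M \<times> carrier N). fl us \<simeq>[rels] z"
  by (rule lists_sum_exists[OF neg_pure])

lemma tsum_closed: "us \<in> lists (carrier M \<times> carrier N) \<Longrightarrow> ts us \<in> carrier TP"
  using keys_fl[of us "carrier M \<times> carrier N"]
  by (auto simp: tensor_def carrier_FactGroup tsum_def fl_def intro!: imageI)

lemma treps_nonempty:
  assumes "z \<in> carrier TP" shows "\<exists>us. us \<in> treps A M ra N la z"
proof -
  obtain w where w: "keys w \<subseteq> carrier M \<times> carrier N" "z = tensor_null A M ra N la #>\<^bsub>F\<^esub> w"
    using assms by (auto simp: tensor_def carrier_FactGroup)
  obtain us where us: "us \<in> lists (carrier M \<times> carrier N)" "fl us \<simeq>[rels] w" using list_rep[OF w(1)] by blast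
  then have "ts us = z" using coset_eq_iff[OF keys_fl[OF us(1)] w(1)] w by (simp add: tsum_def fl_def)
  with us show ?thesis by (auto simp: treps_def)
qed

lemma tsum_append:
  assumes "us \<in> lists (carrier M \<times> carrier N)" "vs \<in> lists (carrier M \<times> carrier N)"
  shows "ts us \<otimes>\<^bsub>TP\<^esub> ts vs = ts (us @ vs)"
  using normal.rcos_sum[OF null_normal, of "fl us" "fl vs"] keys_fl[OF assms(1)] keys_fl[OF assms(2)]
  by (simp add: tensor_def tsum_def fl_def)

lemma treps_eqm: "us \<in> treps A M ra N la z \<Longrightarrow> vs \<in> treps A M ra N la z \<Longrightarrow> fl us \<simeq>[rels] fl vs"
  unfolding treps_def using tsum_eq_iff by auto

lemma treps_tsum:
  "us \<in> treps A M ra N la (ts vs) \<Longrightarrow> vs \<in> lists (carrier M \<times> carrier N) \<Longrightarrow> fl us \<simeq>[rels] fl vs"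
  unfolding treps_def using tsum_eq_iff by auto

lemma treps_mult:
  assumes "us \<in> treps A M ra N la z" "vs \<in> treps A M ra N la w"
    "ws \<in> treps A M ra N la (z \<otimes>\<^bsub>TP\<^esub> w)"
  shows "fl ws \<simeq>[rels] fl us + fl vs"
proof -
  have "ts ws = ts (us @ vs)" using assms tsum_append by (auto simp: treps_def)
  then show ?thesis using assms tsum_eq_iff[of ws "us @ vs"] by (auto simp: treps_def fl_append)
qed

end

section \<open>Triple tensor products\<close>

text \<open>The middle variable belongs to both tensor signs, so the condition splits into two
  instances of \<open>balanced\<close>, and lemmas about binary tensor products apply to
  each.\<close>

definition balanced3 where
  "balanced3 A M ra N la ra' P la' G f \<longleftrightarrow>
     (\<forall>z\<in>carrier P. balanced A M ra N la G (\<lambda>x y. f x y z))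
   \<and> (\<forall>x\<in>carrier M. balanced A N ra' P la' G (\<lambda>y z. f x y z))"

lemma extend_balanced3:
  assumes bal: "balanced3 A M ra N la ra' P la' G f" and zw: "z \<simeq>[tensor3_rels A M ra N la ra' P la'] w"
  shows "frag_extend (\<lambda>(x, y, z). f x y z) z \<simeq>[G] frag_extend (\<lambda>(x, y, z). f x y z) w"
proof (rule eqm_extend[OF _ zw])
  have b1: "balanced A M ra N la G (\<lambda>x y. f x y z)" if "z \<in> carrier P" for z
    using bal that by (simp add: balanced3_def)
  have b2: "balanced A N ra' P la' G (\<lambda>y z. f x y z)" if "x \<in> carrier M" for x
    using bal that by (simp add: balanced3_def)
  fix n assume "n \<in> tensor3_rels A M ra N la ra' P la'"
  then show "frag_extend (\<lambda>(x, y, z). f x y z) n \<simeq>[G] 0"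
    unfolding tensor3_rels_def
  proof (elim UnE CollectE exE conjE)
    fix x a y z
    assume "n = frag_of (ra x a, y, z) - frag_of (x, la a y, z)" "x \<in> carrier M" "a \<in> A"
      "y \<in> carrier N" "z \<in> carrier P"
    then show ?thesis
      using balancedD(3)[OF b1, of z x a y] by (simp add: frag_extend_diff eqm_def)
  next
    fix x a y z
    assume "n = frag_of (x, ra' y a, z) - frag_of (x, y, la' a z)" "x \<in> carrier M" "a \<in> A"
      "y \<in> carrier N" "z \<in> carrier P"
    then show ?thesis
      using balancedD(3)[OF b2, of x y a z] by (simp add: frag_extend_diff eqm_def)
  qed (simp_all only: frag_extend_diff frag_extend_of prod.case eqm_iff_diff_add
      balancedD(1)[OF b1] balancedD(1,2)[OF b2])
qed

lemma tsum3_eq_iff: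
  assumes "tensor_data A M ra N la" "tensor_data A N ra' P la'"
    and "us \<in> lists (carrier M \<times> carrier N \<times> carrier P)" "vs \<in> lists (carrier M \<times> carrier N \<times> carrier P)"
  shows "tsum3 A M ra N la ra' P la' us = tsum3 A M ra N la ra' P la' vs \<longleftrightarrow> fl us \<simeq>[tensor3_rels A M ra N la ra' P la'] fl vs"
proof -
  interpret t1: tensor_data A M ra N la by fact
  interpret t2: tensor_data A N ra' P la' by fact
  interpret M: abelian_group M by (rule t1.ab_M)
  interpret N: abelian_group N by (rule t1.ab_N)
  interpret P: abelian_group P by (rule t2.ab_N)
  have "g \<in> tensor3_rels A M ra N la ra' P la' \<Longrightarrow> keys g \<subseteq> carrier M \<times> carrier N \<times> carrier P" for g
    unfolding tensor3_rels_def
    by (elim UnE CollectE exE conjE;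
        simp; rule order_trans[OF keys_diff3] order_trans[OF keys_diff];
        simp add: t1.ra_clo t1.la_clo t2.ra_clo t2.la_clo)
  from free_coset_eq_iff[OF this keys_fl[OF assms(3)] keys_fl[OF assms(4)]]
  show ?thesis by (simp add: tsum3_def fl_def)
qed

section \<open>Formal sums in an abelian group\<close>

text \<open>The free abelian group on \<open>carrier M\<close> modulo these relations is M itself.
  This turns sums in M, such as counit identities, into the same kind of congruence as identities
  between tensors.\<close>

definition add_rels :: "('m, 'p) ring_scheme \<Rightarrow> ('m \<Rightarrow>\<^sub>0 int) set" where
  "add_rels M = {frag_of (x \<oplus>\<^bsub>M\<^esub> x') - frag_of x - frag_of x' | x x'. x \<in> carrier M \<and> x' \<in> carrier M}"

lemma add_rels_base: "x \<in> carrier M \<Longrightarrow> x' \<in> carrier M \<Longrightarrow>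
    frag_of (x \<oplus>\<^bsub>M\<^esub> x') \<simeq>[add_rels M] frag_of x + frag_of x'"
  by (rule eqm_base_add) (auto simp: add_rels_def)

lemma lsum_closed:
  assumes "abelian_group M" "set xs \<subseteq> carrier M" shows "lsum M xs \<in> carrier M"
proof -
  interpret abelian_group M by fact
  show ?thesis using assms(2) by (induction xs) (auto simp: lsum_def)
qed

lemma frag_lsum:
  assumes "abelian_group M" "xs \<in> lists (carrier M)"
  shows "frag_of (lsum M xs) \<simeq>[add_rels M] fl xs"
proof -
  interpret abelian_group M by fact
  show ?thesis using assms(2)
  proof (induction xs)
    case Nil
    have "frag_of \<zero>\<^bsub>M\<^esub> \<simeq>[add_rels M] 0"
      using add_rels_base[of "\<zero>\<^bsub>M\<^esub>" M "\<zero>\<^bsub>M\<^esub>"] by (intro eqm_zero_of_double) simp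
    then show ?case by (simp add: lsum_def)
  next
    case (Cons x xs)
    have c: "lsum M xs \<in> carrier M" by (rule lsum_closed) (use Cons in \<open>auto intro: abelian_group_axioms\<close>)
    have "frag_of (lsum M (x # xs)) = frag_of (x \<oplus>\<^bsub>M\<^esub> lsum M xs)" by (simp add: lsum_def)
    also have "\<dots> \<simeq>[add_rels M] frag_of x + frag_of (lsum M xs)"
      by (rule add_rels_base) (use Cons c in auto)
    also have "\<dots> \<simeq>[add_rels M] frag_of x + fl xs"
      by (rule eqm_add) (use Cons in auto)
    finally show ?case by (simp add: fl_Cons)
  qed
qed

text \<open>The extension comes from the universal property of the free abelian group, and
  additivity of h kills the relations. The support is part of the conclusion, since additivity of e
  is known only on formal sums supported in \<open>carrier M\<close>.\<close>

lemma add_hom_extends: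
  assumes M: "abelian_group M" and H: "comm_group H" and h: "h \<in> hom (add_monoid M) H"
  obtains e where "e \<in> hom (free_Abelian_group (carrier M)) H" "\<And>x. x \<in> carrier M \<Longrightarrow> e (frag_of x) = h x"
    "\<And>z. z \<simeq>[add_rels M] 0 \<Longrightarrow> keys z \<subseteq> carrier M \<and> e z = \<one>\<^bsub>H\<^esub>"
proof -
  interpret M: abelian_group M by fact
  interpret H: comm_group H by fact
  obtain e where e: "e \<in> hom (free_Abelian_group (carrier M)) H"
    "\<And>x. x \<in> carrier M \<Longrightarrow> e (frag_of x) = h x"
    using H.free_Abelian_group_universal[of h "carrier M"] h by (auto simp: hom_def)
  interpret E: group_hom "free_Abelian_group (carrier M)" H e
    by (intro group_hom.intro group_hom_axioms.intro group_free_Abelian_group H.group_axioms e)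
  have hom_diff: "e (a - b) = e a \<otimes>\<^bsub>H\<^esub> inv\<^bsub>H\<^esub> e b" if "keys a \<subseteq> carrier M" "keys b \<subseteq> carrier M" for a b
    using E.hom_mult[of a "- b"] E.hom_inv[of b] that by simp
  have hc: "x \<in> carrier M \<Longrightarrow> h x \<in> carrier H" for x using h by (auto simp: hom_def)
  have kk: "keys z \<subseteq> carrier M \<and> e z = \<one>\<^bsub>H\<^esub>" if "z \<in> addspan (add_rels M)" for z
    using that
  proof (induction rule: addspan.induct)
    case addspan_zero
    then show ?case using E.hom_one by simp
  next
    case (addspan_base z)
    then obtain x y where z: "z = frag_of (x \<oplus>\<^bsub>M\<^esub> y) - frag_of x - frag_of y" "x \<in> carrier M" "y \<in> carrier M"
      by (auto simp: add_rels_def)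
    have k1: "keys (frag_of (x \<oplus>\<^bsub>M\<^esub> y) - frag_of x) \<subseteq> carrier M"
      by (rule order_trans[OF keys_diff]) (use z in auto)
    have kz: "keys z \<subseteq> carrier M"
      unfolding z(1) by (rule order_trans[OF keys_diff]) (use z k1 in auto)
    have "h (x \<oplus>\<^bsub>M\<^esub> y) = h x \<otimes>\<^bsub>H\<^esub> h y" using h z by (auto simp: hom_def)
    then have "e z = (h x \<otimes>\<^bsub>H\<^esub> h y) \<otimes>\<^bsub>H\<^esub> inv\<^bsub>H\<^esub> h x \<otimes>\<^bsub>H\<^esub> inv\<^bsub>H\<^esub> h y"
      unfolding z(1) using z k1 by (simp add: hom_diff e)
    also have "\<dots> = (h x \<otimes>\<^bsub>H\<^esub> h y) \<otimes>\<^bsub>H\<^esub> inv\<^bsub>H\<^esub> (h x \<otimes>\<^bsub>H\<^esub> h y)"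
      using z hc by (simp add: H.inv_mult H.m_assoc)
    finally have "e z = \<one>\<^bsub>H\<^esub>" using z hc by simp
    with kz show ?case by simp
  next
    case (addspan_diff x y)
    then show ?case using keys_diff[of x y] by (auto simp: hom_diff)
  qed
  show thesis by (rule that[OF e]) (simp_all add: eqm_zero_iff kk)
qed

text \<open>Evaluation of formal sums in M, the extension of the identity, shows that the relations
  identify no two elements. Equalities in T and in the quotient are recovered from congruences in
  this way.\<close>

lemma frag_eqm_imp_eq:
  assumes M: "abelian_group M" and "x \<in> carrier M" "y \<in> carrier M" "frag_of x \<simeq>[add_rels M] frag_of y"
  shows "x = y"
proof -
  interpret M: abelian_group M by fact
  obtain e where e: "e \<in> hom (free_Abelian_group (carrier M)) (add_monoid M)" "\<And>x. x \<in> carrier M \<Longrightarrow> e (frag_of x) = x"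
    "\<And>z. z \<simeq>[add_rels M] 0 \<Longrightarrow> keys z \<subseteq> carrier M \<and> e z = \<one>\<^bsub>add_monoid M\<^esub>"
    using add_hom_extends[OF M M.a_comm_group, of "\<lambda>x. x"] by (auto simp: hom_def)
  have "frag_of x - frag_of y \<simeq>[add_rels M] 0" using assms(4) by (simp add: eqm_def)
  then have k: "keys (frag_of x - frag_of y) \<subseteq> carrier M" "e (frag_of x - frag_of y) = \<zero>\<^bsub>M\<^esub>" using e(3) by auto
  have "e ((frag_of x - frag_of y) + frag_of y) = e (frag_of x - frag_of y) \<oplus>\<^bsub>M\<^esub> e (frag_of y)"
    using hom_mult[OF e(1), of "frag_of x - frag_of y" "frag_of y"] k(1) assms(3) by simp
  then show ?thesis using k e(2) assms by simp
qed

lemma map_lists: "us \<in> lists (A \<times> B) \<Longrightarrow> (\<And>x y. x \<in> A \<Longrightarrow> y \<in> B \<Longrightarrow> e x y \<in> C) \<Longrightarrow>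
    map (\<lambda>(x, y). e x y) us \<in> lists C"
  by (induction us) auto

lemma concat_map_lists:
  "us \<in> lists (A \<times> B) \<Longrightarrow> (\<And>x y. x \<in> A \<Longrightarrow> y \<in> B \<Longrightarrow> L x y \<in> lists C) \<Longrightarrow>
    concat (map (\<lambda>(x, y). L x y) us) \<in> lists C"
  by (induction us) fastforce+

lemma fl_map_Pair: "fl (map (Pair x) us) = Sw (fl us) (\<lambda>y z. frag_of (x, y, z))"
  using fl_map[of "\<lambda>y z. (x, y, z)" us] by (simp add: case_prod_unfold)

lemma treps_lists: "us \<in> treps A M ra N la z \<Longrightarrow> us \<in> lists (carrier M \<times> carrier N)"
  by (simp add: treps_def)

lemma additive_extend:
  assumes "\<And>x x'. x \<in> carrier M \<Longrightarrow> x' \<in> carrier M \<Longrightarrow> f (x \<oplus>\<^bsub>M\<^esub> x') \<simeq>[G] f x + f x'"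
    and "z \<simeq>[add_rels M] w"
  shows "frag_extend f z \<simeq>[G] frag_extend f w"
  by (rule eqm_extend[OF _ assms(2)])
    (auto simp: add_rels_def frag_extend_diff eqm_iff_diff_add assms(1))

section \<open>Right bialgebroids, with the coproduct as a formal sum\<close>

locale bialg =
  fixes K :: "('k, 'p) ring_scheme" and R :: "('k, 'r, 'q) module_scheme"
    and B :: "('k, 'r, 'b) bialgebroid"
  assumes bialg: "right_bialgebroid K R B"
begin

lemma coring_B: "coring K R B (blact B) (bract B) (comult B) (counit B)"
  using bialg by (simp add: right_bialgebroid_def)

sublocale R: ring R
  using bialg by (simp add: right_bialgebroid_def assoc_algebra_def)

sublocale B: ring B
  using bialg by (simp add: right_bialgebroid_def assoc_algebra_def)

abbreviation mB (infixl "\<star>" 70) where "x \<star> y \<equiv> x \<otimes>\<^bsub>B\<^esub> y"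
abbreviation "\<xi> \<equiv> src B"
abbreviation "\<zeta> \<equiv> tgt B"
abbreviation "\<epsilon> \<equiv> counit B"
abbreviation "BB \<equiv> tensor_rels (carrier R) B (bract B) B (blact B)"
abbreviation "Bop \<equiv> tensor_rels (carrier R) B (\<lambda>b r. b \<otimes>\<^bsub>B\<^esub> tgt B r) B (\<lambda>r b. tgt B r \<otimes>\<^bsub>B\<^esub> b)"

lemma src_simps [simp]:
  "r \<in> carrier R \<Longrightarrow> \<xi> r \<in> carrier B"
  "r \<in> carrier R \<Longrightarrow> s \<in> carrier R \<Longrightarrow> \<xi> (r \<otimes>\<^bsub>R\<^esub> s) = \<xi> r \<star> \<xi> s"
  "r \<in> carrier R \<Longrightarrow> s \<in> carrier R \<Longrightarrow> \<xi> (r \<oplus>\<^bsub>R\<^esub> s) = \<xi> r \<oplus>\<^bsub>B\<^esub> \<xi> s"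
  "\<xi> \<one>\<^bsub>R\<^esub> = \<one>\<^bsub>B\<^esub>"
  using right_bialgebroid.src_hom[OF bialg] by (auto simp: algebra_hom_def ring_hom_def)

lemma tgt_simps [simp]:
  "r \<in> carrier R \<Longrightarrow> \<zeta> r \<in> carrier B"
  "r \<in> carrier R \<Longrightarrow> s \<in> carrier R \<Longrightarrow> \<zeta> (r \<otimes>\<^bsub>R\<^esub> s) = \<zeta> s \<star> \<zeta> r"
  "r \<in> carrier R \<Longrightarrow> s \<in> carrier R \<Longrightarrow> \<zeta> (r \<oplus>\<^bsub>R\<^esub> s) = \<zeta> r \<oplus>\<^bsub>B\<^esub> \<zeta> s"
  "\<zeta> \<one>\<^bsub>R\<^esub> = \<one>\<^bsub>B\<^esub>"
  using right_bialgebroid.tgt_hom[OF bialg] by (auto simp: algebra_hom_def ring_hom_def opposite_def)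

lemma src_tgt_comm: "r \<in> carrier R \<Longrightarrow> s \<in> carrier R \<Longrightarrow> \<xi> r \<star> \<zeta> s = \<zeta> s \<star> \<xi> r"
  using right_bialgebroid.src_tgt_commute[OF bialg] .

lemma counit_simps [simp]:
  "b \<in> carrier B \<Longrightarrow> \<epsilon> b \<in> carrier R"
  "b \<in> carrier B \<Longrightarrow> c \<in> carrier B \<Longrightarrow> \<epsilon> (b \<oplus>\<^bsub>B\<^esub> c) = \<epsilon> b \<oplus>\<^bsub>R\<^esub> \<epsilon> c"
  "\<epsilon> \<one>\<^bsub>B\<^esub> = \<one>\<^bsub>R\<^esub>"
  using coring.counit_hom[OF coring_B] right_bialgebroid.counit_one[OF bialg]
  by (auto simp: hom_def)

lemma counit_tgt: "r \<in> carrier R \<Longrightarrow> b \<in> carrier B \<Longrightarrow> \<epsilon> (b \<star> \<zeta> r) = r \<otimes>\<^bsub>R\<^esub> \<epsilon> b"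
  using coring.counit_left_linear[OF coring_B] by (simp add: blact_def)

lemma counit_src: "r \<in> carrier R \<Longrightarrow> b \<in> carrier B \<Longrightarrow> \<epsilon> (b \<star> \<xi> r) = \<epsilon> b \<otimes>\<^bsub>R\<^esub> r"
  using coring.counit_right_linear[OF coring_B] by (simp add: bract_def)

lemma counit_of_src [simp]: "r \<in> carrier R \<Longrightarrow> \<epsilon> (\<xi> r) = r"
  using counit_src[of r "\<one>\<^bsub>B\<^esub>"] by simp

lemma counit_mult: "b \<in> carrier B \<Longrightarrow> c \<in> carrier B \<Longrightarrow> \<epsilon> (b \<star> c) = \<epsilon> (\<xi> (\<epsilon> b) \<star> c)"
  using right_bialgebroid.counit_mult[OF bialg] .

lemma blact_eq: "blact B r b = b \<star> \<zeta> r" and bract_eq: "bract B b r = b \<star> \<xi> r"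
  by (simp_all add: blact_def bract_def)

sublocale BBt: tensor_data "carrier R" B "bract B" B "blact B"
  by unfold_locales (auto simp: blact_eq bract_eq)

sublocale Bopt: tensor_data "carrier R" B "\<lambda>b r. b \<otimes>\<^bsub>B\<^esub> tgt B r" B "\<lambda>r b. tgt B r \<otimes>\<^bsub>B\<^esub> b"
  by unfold_locales auto

lemma comult_closed: "b \<in> carrier B \<Longrightarrow> comult B b \<in> carrier (tensorB R B B (bract B))"
  using coring.comult_hom[OF coring_B] by (auto simp: hom_def)

text \<open>Formal sums representing \<open>\<Delta>(b)\<close>, and below \<open>rho\<close>, \<open>hs\<close>, \<open>cs\<close> representing \<open>\<rho>(t)\<close>, \<open>b\<^sub>- \<otimes> b\<^sub>+\<close>
  and \<open>b\<^bsup>{-}\<^esup> \<otimes> b\<^bsup>{+}\<^esup>\<close>.\<close>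

definition "dl b = (SOME us. us \<in> trepsB R B B (bract B) (comult B b))"
definition "ds b = fl (dl b)"

lemma dl: "b \<in> carrier B \<Longrightarrow> dl b \<in> trepsB R B B (bract B) (comult B b)"
  unfolding dl_def by (rule someI_ex) (rule BBt.treps_nonempty[OF comult_closed])

lemma dl_lists: "b \<in> carrier B \<Longrightarrow> dl b \<in> lists (carrier B \<times> carrier B)"
  using dl treps_lists by blast

lemma dl_mem: "(x, y) \<in> set (dl b) \<Longrightarrow> b \<in> carrier B \<Longrightarrow> x \<in> carrier B \<and> y \<in> carrier B"
  using dl_lists[of b] by auto

lemma ds_keys: "b \<in> carrier B \<Longrightarrow> keys (ds b) \<subseteq> carrier B \<times> carrier B"
  unfolding ds_def using dl_lists by (rule keys_fl)

lemma ds_rep: "b \<in> carrier B \<Longrightarrow> us \<in> trepsB R B B (bract B) (comult B b) \<Longrightarrow> fl us \<simeq>[BB] ds b"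
  unfolding ds_def using dl BBt.treps_eqm by blast

lemma ds_tsum: "b \<in> carrier B \<Longrightarrow> comult B b = tsumB R B B (bract B) vs \<Longrightarrow>
    vs \<in> lists (carrier B \<times> carrier B) \<Longrightarrow> ds b \<simeq>[BB] fl vs"
  unfolding ds_def using dl[of b] BBt.treps_tsum by metis

lemma ds_add:
  assumes "b \<in> carrier B" "c \<in> carrier B"
  shows "ds (b \<oplus>\<^bsub>B\<^esub> c) \<simeq>[BB] ds b + ds c"
proof -
  have "comult B (b \<oplus>\<^bsub>B\<^esub> c) = comult B b \<otimes>\<^bsub>tensorB R B B (bract B)\<^esub> comult B c"
    using coring.comult_hom[OF coring_B] assms by (auto simp: hom_def)
  then show ?thesis unfolding ds_def
    using BBt.treps_mult[OF dl dl, OF assms] dl[of "b \<oplus>\<^bsub>B\<^esub> c"] assms by simp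
qed

lemma ds_tgt:
  assumes "b \<in> carrier B" "r \<in> carrier R"
  shows "ds (b \<star> \<zeta> r) \<simeq>[BB] Sw (ds b) (\<lambda>x y. frag_of (x \<star> \<zeta> r, y))"
proof -
  have "comult B (blact B r b) = tsumB R B B (bract B) [(blact B r x, y). (x, y) \<leftarrow> dl b]"
    by (rule coring.comult_left_linear[OF coring_B]) (use assms dl in auto)
  then have "ds (blact B r b) \<simeq>[BB] fl [(blact B r x, y). (x, y) \<leftarrow> dl b]"
    by (rule ds_tsum[rotated]) (use assms in \<open>auto simp: blact_eq dest!: dl_mem\<close>)
  then show ?thesis by (simp add: fl_map ds_def blact_eq)
qed

lemma ds_takeuchi:
  assumes "b \<in> carrier B" "r \<in> carrier R"
  shows "Sw (ds b) (\<lambda>x y. frag_of (\<xi> r \<star> x, y)) \<simeq>[BB] Sw (ds b) (\<lambda>x y. frag_of (x, \<zeta> r \<star> y))"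
proof -
  have "fl [(\<xi> r \<star> x, y). (x, y) \<leftarrow> dl b] \<simeq>[BB] fl [(x, \<zeta> r \<star> y). (x, y) \<leftarrow> dl b]"
    by (rule iffD1[OF BBt.tsum_eq_iff, OF _ _ right_bialgebroid.comult_takeuchi[OF bialg assms(2,1) dl[OF assms(1)]]])
      (use assms in \<open>auto dest!: dl_mem\<close>)
  then show ?thesis by (simp add: fl_map ds_def)
qed

lemma ds_one: "ds \<one>\<^bsub>B\<^esub> \<simeq>[BB] frag_of (\<one>\<^bsub>B\<^esub>, \<one>\<^bsub>B\<^esub>)"
  using ds_tsum[OF _ right_bialgebroid.comult_one[OF bialg]] by simp

lemma ds_mult:
  assumes "b \<in> carrier B" "c \<in> carrier B"
  shows "ds (b \<star> c) \<simeq>[BB] Sw (ds b) (\<lambda>b1 b2. Sw (ds c) (\<lambda>c1 c2. frag_of (b1 \<star> c1, b2 \<star> c2)))"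
proof -
  have "ds (b \<star> c) \<simeq>[BB] fl [(b1 \<star> c1, b2 \<star> c2). (b1, b2) \<leftarrow> dl b, (c1, c2) \<leftarrow> dl c]"
    by (rule ds_tsum[OF _ right_bialgebroid.comult_mult[OF bialg _ _ dl dl]])
      (use assms in \<open>auto dest!: dl_mem\<close>)
  then show ?thesis by (simp add: fl_map fl_concat ds_def)
qed

lemma ds_counit_left:
  assumes "b \<in> carrier B"
  shows "Sw (ds b) (\<lambda>x y. frag_of (y \<star> \<zeta> (\<epsilon> x))) \<simeq>[add_rels B] frag_of b"
proof -
  have "frag_of (lsum B [blact B (\<epsilon> x) y. (x, y) \<leftarrow> dl b]) \<simeq>[add_rels B] fl [blact B (\<epsilon> x) y. (x, y) \<leftarrow> dl b]"
    by (rule frag_lsum) (use assms B.abelian_group_axioms in \<open>auto simp: blact_eq dest!: dl_mem\<close>)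
  then show ?thesis
    using coring.counit_left[OF coring_B assms dl[OF assms]]
    by (simp add: fl_map ds_def blact_eq eqm_sym)
qed

end

section \<open>Right comodules and their left R-action\<close>

locale comod = bialg K R B
  for K :: "('k, 'p) ring_scheme" and R :: "('k, 'r, 'q) module_scheme"
    and B :: "('k, 'r, 'b) bialgebroid" +
  fixes X :: "('k, 'x, 's) module_scheme"
    and ra :: "'x \<Rightarrow> 'r \<Rightarrow> 'x" and \<rho> :: "'x \<Rightarrow> ('x \<times> 'b \<Rightarrow>\<^sub>0 int) set"
  assumes comodule: "right_comodule K R B X ra \<rho>"
begin

lemma right_mod_X: "right_mod K R X ra"
  using comodule by (simp add: right_comodule_def)

sublocale X: abelian_group X
  using right_mod_X by (simp add: right_mod_def module_def)

lemmas ra_closed [simp] = right_mod.ra_closed[OF right_mod_X]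
lemmas ra_add_left = right_mod.ra_add_left[OF right_mod_X]
lemmas ra_add_right = right_mod.ra_add_right[OF right_mod_X]
lemmas ra_assoc = right_mod.ra_assoc[OF right_mod_X]
lemmas ra_one [simp] = right_mod.ra_one[OF right_mod_X]

abbreviation "XB \<equiv> tensor_rels (carrier R) X ra B (blact B)"

sublocale XBt: tensor_data "carrier R" X ra B "blact B"
  by unfold_locales (auto simp: blact_eq)

lemma XB_mid: "x \<in> carrier X \<Longrightarrow> r \<in> carrier R \<Longrightarrow> b \<in> carrier B \<Longrightarrow>
    frag_of (ra x r, b) \<simeq>[XB] frag_of (x, b \<star> \<zeta> r)"
  using tensor_mid[of x X r "carrier R" b B ra "blact B"] by (simp add: blact_eq)

lemma rho_closed: "x \<in> carrier X \<Longrightarrow> \<rho> x \<in> carrier (tensorB R B X ra)"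
  using right_comodule.coact_hom[OF comodule] by (auto simp: hom_def)

definition "rl x = (SOME us. us \<in> trepsB R B X ra (\<rho> x))"
definition "rho x = fl (rl x)"

lemma rl: "x \<in> carrier X \<Longrightarrow> rl x \<in> trepsB R B X ra (\<rho> x)"
  unfolding rl_def by (rule someI_ex) (rule XBt.treps_nonempty[OF rho_closed])

lemma rl_lists: "x \<in> carrier X \<Longrightarrow> rl x \<in> lists (carrier X \<times> carrier B)"
  using rl treps_lists by blast

lemma rl_mem: "(x0, x1) \<in> set (rl x) \<Longrightarrow> x \<in> carrier X \<Longrightarrow> x0 \<in> carrier X \<and> x1 \<in> carrier B"
  using rl_lists[of x] by auto

lemma rho_keys: "x \<in> carrier X \<Longrightarrow> keys (rho x) \<subseteq> carrier X \<times> carrier B"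
  unfolding rho_def using rl_lists by (rule keys_fl)

lemma rho_rep: "x \<in> carrier X \<Longrightarrow> us \<in> trepsB R B X ra (\<rho> x) \<Longrightarrow> fl us \<simeq>[XB] rho x"
  unfolding rho_def using rl XBt.treps_eqm by blast

lemma rho_tsum: "x \<in> carrier X \<Longrightarrow> \<rho> x = tsumB R B X ra vs \<Longrightarrow>
    vs \<in> lists (carrier X \<times> carrier B) \<Longrightarrow> rho x \<simeq>[XB] fl vs"
  unfolding rho_def using rl[of x] XBt.treps_tsum by metis

lemma rho_add:
  assumes "x \<in> carrier X" "y \<in> carrier X"
  shows "rho (x \<oplus>\<^bsub>X\<^esub> y) \<simeq>[XB] rho x + rho y"
proof -
  have "\<rho> (x \<oplus>\<^bsub>X\<^esub> y) = \<rho> x \<otimes>\<^bsub>tensorB R B X ra\<^esub> \<rho> y"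
    using right_comodule.coact_hom[OF comodule] assms by (auto simp: hom_def)
  then show ?thesis unfolding rho_def
    using XBt.treps_mult[OF rl rl, OF assms] rl[of "x \<oplus>\<^bsub>X\<^esub> y"] assms by simp
qed

lemma rho_ra:
  assumes "x \<in> carrier X" "r \<in> carrier R"
  shows "rho (ra x r) \<simeq>[XB] Sw (rho x) (\<lambda>x0 x1. frag_of (x0, x1 \<star> \<xi> r))"
proof -
  have "\<rho> (ra x r) = tsumB R B X ra [(x0, bract B x1 r). (x0, x1) \<leftarrow> rl x]"
    by (rule right_comodule.coact_right_linear[OF comodule]) (use assms rl in auto)
  then have "rho (ra x r) \<simeq>[XB] fl [(x0, bract B x1 r). (x0, x1) \<leftarrow> rl x]"
    by (rule rho_tsum[rotated]) (use assms in \<open>auto simp: bract_eq dest!: dl_mem rl_mem\<close>)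
  then show ?thesis by (simp add: fl_map rho_def bract_eq)
qed

text \<open>The axiom is an equality in the triple tensor product; pushing it along a balanced
  \<open>f\<close> gives a rewrite rule for double Sweedler sums.\<close>

lemma rho_coassoc:
  assumes "x \<in> carrier X" "balanced3 (carrier R) X ra B (blact B) (bract B) B (blact B) G f"
  shows "Sw (rho x) (\<lambda>x0 x1. Sw (rho x0) (\<lambda>y0 y1. f y0 y1 x1))
     \<simeq>[G] Sw (rho x) (\<lambda>x0 x1. Sw (ds x1) (\<lambda>d1 d2. f x0 d1 d2))"
proof -
  have "fl [(y0, y1, x1). (x0, x1) \<leftarrow> rl x, (y0, y1) \<leftarrow> rl x0]
     \<simeq>[tensor3_rels (carrier R) X ra B (blact B) (bract B) B (blact B)]
       fl [(x0, d1, d2). (x0, x1) \<leftarrow> rl x, (d1, d2) \<leftarrow> dl x1]"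
    by (rule iffD1[OF tsum3_eq_iff, OF XBt.tensor_data_axioms BBt.tensor_data_axioms _ _
          right_comodule.coact_coassoc[OF comodule assms(1) rl[OF assms(1)]]])
      (use assms dl rl in \<open>auto dest!: dl_mem rl_mem\<close>)
  from extend_balanced3[OF assms(2) this] show ?thesis
    by (simp add: fl_map fl_concat fl_map_Pair ds_def rho_def extend_Sw)
qed

lemma rho_counit:
  assumes "x \<in> carrier X"
  shows "Sw (rho x) (\<lambda>x0 x1. frag_of (ra x0 (\<epsilon> x1))) \<simeq>[add_rels X] frag_of x"
proof -
  have "frag_of (lsum X [ra x0 (\<epsilon> x1). (x0, x1) \<leftarrow> rl x]) \<simeq>[add_rels X] fl [ra x0 (\<epsilon> x1). (x0, x1) \<leftarrow> rl x]"
    by (rule frag_lsum) (use assms X.abelian_group_axioms in \<open>auto dest!: dl_mem rl_mem\<close>)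
  then show ?thesis
    using right_comodule.coact_counit[OF comodule assms rl[OF assms]]
    by (simp add: fl_map rho_def eqm_sym)
qed

abbreviation "la \<equiv> comod_lact R B X ra \<rho>"

text \<open>Shows that x_0 \<epsilon>(\<xi>(r) x_1) depends only on \<rho>(x), so that the
  description by \<open>THE\<close> in \<open>comod_lact\<close> denotes something. Moving s across
  the tensor sign is \<epsilon>(b \<zeta>(s)) = s \<epsilon>(b).\<close>

lemma balanced_la: "r \<in> carrier R \<Longrightarrow>
  balanced (carrier R) X ra B (blact B) (add_rels X) (\<lambda>x0 x1. frag_of (ra x0 (\<epsilon> (\<xi> r \<star> x1))))"
  by (rule balancedI)
    (simp_all add: ra_add_left ra_add_right B.r_distr add_rels_base blact_eq counit_tgt ra_assoc B.m_assoc[symmetric])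

lemma la_props:
  assumes "x \<in> carrier X" "r \<in> carrier R"
  shows la_closed [simp]: "la r x \<in> carrier X"
    and frag_la: "frag_of (la r x) \<simeq>[add_rels X] Sw (rho x) (\<lambda>x0 x1. frag_of (ra x0 (\<epsilon> (\<xi> r \<star> x1))))"
proof -
  let ?L = "\<lambda>us. lsum X [ra x0 (\<epsilon> (\<xi> r \<star> x1)). (x0, x1) \<leftarrow> us]"
  have l: "[ra x0 (\<epsilon> (\<xi> r \<star> x1)). (x0, x1) \<leftarrow> us] \<in> lists (carrier X)" if "us \<in> trepsB R B X ra (\<rho> x)" for us
    using that assms by (intro map_lists[OF treps_lists]) auto
  have c: "?L us \<in> carrier X" if "us \<in> trepsB R B X ra (\<rho> x)" for us
    by (rule lsum_closed[OF X.abelian_group_axioms]) (use that l in blast)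
  have f: "frag_of (?L us) \<simeq>[add_rels X] Sw (rho x) (\<lambda>x0 x1. frag_of (ra x0 (\<epsilon> (\<xi> r \<star> x1))))"
    if "us \<in> trepsB R B X ra (\<rho> x)" for us
  proof -
    have "frag_of (?L us) \<simeq>[add_rels X] Sw (fl us) (\<lambda>x0 x1. frag_of (ra x0 (\<epsilon> (\<xi> r \<star> x1))))"
      using frag_lsum[OF X.abelian_group_axioms l[OF that]] by (simp add: fl_map)
    also have "\<dots> \<simeq>[add_rels X] Sw (rho x) (\<lambda>x0 x1. frag_of (ra x0 (\<epsilon> (\<xi> r \<star> x1))))"
      by (rule Sw_balanced[OF balanced_la rho_rep]) (use assms that in auto)
    finally show ?thesis .
  qed
  have "la r x = ?L (rl x)"
    unfolding comod_lact_def
  proof (rule the_equality)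
    show "\<forall>us\<in>trepsB R B X ra (\<rho> x). ?L (rl x) = ?L us"
    proof
      fix us assume us: "us \<in> trepsB R B X ra (\<rho> x)"
      show "?L (rl x) = ?L us"
        by (rule frag_eqm_imp_eq[OF X.abelian_group_axioms c[OF rl[OF assms(1)]] c[OF us]
              eqm_trans[OF f[OF rl[OF assms(1)]] eqm_sym[OF f[OF us]]]])
    qed
  qed (use rl[OF assms(1)] in blast)
  with c f rl assms show "la r x \<in> carrier X"
    "frag_of (la r x) \<simeq>[add_rels X] Sw (rho x) (\<lambda>x0 x1. frag_of (ra x0 (\<epsilon> (\<xi> r \<star> x1))))" by auto
qed

text \<open>By the counit axiom, id \<otimes> \<epsilon> is a left inverse of \<rho>.\<close>

lemma rho_inj:
  assumes "x \<in> carrier X" "y \<in> carrier X" "rho x \<simeq>[XB] rho y"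
  shows "x = y"
proof -
  have b: "balanced (carrier R) X ra B (blact B) (add_rels X) (\<lambda>x0 x1. frag_of (ra x0 (\<epsilon> x1)))"
    by (rule balancedI) (simp_all add: ra_add_left ra_add_right add_rels_base blact_eq counit_tgt ra_assoc)
  have "frag_of x \<simeq>[add_rels X] Sw (rho x) (\<lambda>x0 x1. frag_of (ra x0 (\<epsilon> x1)))"
    using eqm_sym[OF rho_counit[OF assms(1)]] .
  also have "\<dots> \<simeq>[add_rels X] Sw (rho y) (\<lambda>x0 x1. frag_of (ra x0 (\<epsilon> x1)))"
    by (rule Sw_balanced[OF b assms(3)])
  also have "\<dots> \<simeq>[add_rels X] frag_of y" by (rule rho_counit[OF assms(2)])
  finally show ?thesis by (rule frag_eqm_imp_eq[OF X.abelian_group_axioms assms(1,2)])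
qed

text \<open>Expanding the left action on \<open>x0\<close>, coassociativity moves the Takeuchi condition of \<open>\<Delta>\<close> to the comodule.\<close>

lemma rho_takeuchi:
  assumes "x \<in> carrier X" "r \<in> carrier R"
  shows "Sw (rho x) (\<lambda>x0 x1. frag_of (la r x0, x1)) \<simeq>[XB] Sw (rho x) (\<lambda>x0 x1. frag_of (x0, \<zeta> r \<star> x1))"
proof -
  have "Sw (rho x) (\<lambda>x0 x1. frag_of (la r x0, x1))
      \<simeq>[XB] Sw (rho x) (\<lambda>x0 x1. Sw (rho x0) (\<lambda>y0 y1. frag_of (ra y0 (\<epsilon> (\<xi> r \<star> y1)), x1)))"
  proof (rule Sw_cong[OF rho_keys[OF assms(1)]])
    fix x0 x1 assume x: "x0 \<in> carrier X" "x1 \<in> carrier B"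
    have "frag_extend (\<lambda>z. frag_of (z, x1)) (frag_of (la r x0))
       \<simeq>[XB] frag_extend (\<lambda>z. frag_of (z, x1)) (Sw (rho x0) (\<lambda>x0 x1. frag_of (ra x0 (\<epsilon> (\<xi> r \<star> x1)))))"
      by (rule additive_extend[OF _ frag_la]) (use x assms in \<open>auto intro: tensor_add_left\<close>)
    then show "frag_of (la r x0, x1) \<simeq>[XB] Sw (rho x0) (\<lambda>y0 y1. frag_of (ra y0 (\<epsilon> (\<xi> r \<star> y1)), x1))"
      by (simp add: extend_Sw)
  qed
  also have "\<dots> \<simeq>[XB] Sw (rho x) (\<lambda>x0 x1. Sw (ds x1) (\<lambda>d1 d2. frag_of (ra x0 (\<epsilon> (\<xi> r \<star> d1)), d2)))"
    by (rule rho_coassoc[OF assms(1)], unfold balanced3_def, intro conjI ballI balancedI)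
      (use assms in \<open>simp_all add: ra_add_left ra_add_right B.r_distr blact_eq bract_eq counit_tgt counit_src
         ra_assoc B.m_assoc[symmetric] tensor_add_left tensor_add_right
         XB_mid\<close>)
  also have "\<dots> \<simeq>[XB] Sw (rho x) (\<lambda>x0 x1. frag_of (x0, \<zeta> r \<star> x1))"
  proof (rule Sw_cong[OF rho_keys[OF assms(1)]])
    fix x0 x1 assume x: "x0 \<in> carrier X" "x1 \<in> carrier B"
    have b: "balanced (carrier R) B (bract B) B (blact B) XB (\<lambda>d1 d2. frag_of (ra x0 (\<epsilon> d1), d2))"
      by (rule balancedI) (use x in \<open>simp_all add: ra_add_right blact_eq bract_eq counit_src ra_assoc
         tensor_add_left tensor_add_right XB_mid\<close>)
    have "Sw (ds x1) (\<lambda>d1 d2. frag_of (ra x0 (\<epsilon> (\<xi> r \<star> d1)), d2))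
       = Sw (Sw (ds x1) (\<lambda>d1 d2. frag_of (\<xi> r \<star> d1, d2))) (\<lambda>d1 d2. frag_of (ra x0 (\<epsilon> d1), d2))"
      by (simp add: Sw_Sw)
    also have "\<dots> \<simeq>[XB] Sw (Sw (ds x1) (\<lambda>d1 d2. frag_of (d1, \<zeta> r \<star> d2))) (\<lambda>d1 d2. frag_of (ra x0 (\<epsilon> d1), d2))"
      by (rule Sw_balanced[OF b ds_takeuchi]) (use x assms in auto)
    also have "\<dots> = Sw (ds x1) (\<lambda>d1 d2. frag_of (ra x0 (\<epsilon> d1), \<zeta> r \<star> d2))"
      by (simp add: Sw_Sw)
    \<comment> \<open>The scalar \<epsilon>(d_1) crosses to the B-side, where the left counit law
      contracts d_2 \<zeta>(\<epsilon>(d_1)) to x_1.\<close>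
    also have "\<dots> \<simeq>[XB] Sw (ds x1) (\<lambda>d1 d2. frag_of (x0, \<zeta> r \<star> (d2 \<star> \<zeta> (\<epsilon> d1))))"
      by (rule Sw_cong[OF ds_keys[OF x(2)]])
        (use x assms in \<open>simp add: B.m_assoc[symmetric] XB_mid\<close>)
    also have "\<dots> = frag_extend (\<lambda>b. frag_of (x0, \<zeta> r \<star> b)) (Sw (ds x1) (\<lambda>d1 d2. frag_of (d2 \<star> \<zeta> (\<epsilon> d1))))"
      by (simp add: extend_Sw)
    also have "\<dots> \<simeq>[XB] frag_extend (\<lambda>b. frag_of (x0, \<zeta> r \<star> b)) (frag_of x1)"
      by (rule additive_extend[OF _ ds_counit_left[OF x(2)]])
        (use x assms in \<open>simp add: B.r_distr tensor_add_right\<close>)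
    finally show "Sw (ds x1) (\<lambda>d1 d2. frag_of (ra x0 (\<epsilon> (\<xi> r \<star> d1)), d2)) \<simeq>[XB] frag_of (x0, \<zeta> r \<star> x1)"
      by simp
  qed
  finally show ?thesis .
qed

end

section \<open>Inverting the Galois maps\<close>

text \<open>Both \<open>hopf_map\<close> and \<open>can\<close> are instances of the map \<open>\<theta>\<close> below.\<close>

lemma translation_map:
  fixes m :: "'m \<Rightarrow> 'm \<Rightarrow> 'm" and D :: "'m \<Rightarrow> ('m \<times> 'o \<Rightarrow>\<^sub>0 int) set"
    and M :: "('m, 'p) ring_scheme" and P :: "('o, 'q) ring_scheme"
  assumes \<theta>_def: "\<And>z. \<theta> z = (THE w. \<forall>us \<in> treps A M ra M la z.
       \<forall>ds \<in> (\<Pi> d\<in>carrier M. treps A' M ra' P la' (D d)).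
         w = tsum A' M ra' P la' [(m b d1, d2). (b, b') \<leftarrow> us, (d1, d2) \<leftarrow> ds b'])"
    and td1: "tensor_data A M ra M la" and td2: "tensor_data A' M ra' P la'"
    and m: "\<And>x y. x \<in> carrier M \<Longrightarrow> y \<in> carrier M \<Longrightarrow> m x y \<in> carrier M"
    and dl: "\<And>d. d \<in> carrier M \<Longrightarrow> dl d \<in> treps A' M ra' P la' (D d)"
    and bal1: "balanced A M ra M la (tensor_rels A' M ra' P la')
        (\<lambda>b b'. Sw (fl (dl b')) (\<lambda>d1 d2. frag_of (m b d1, d2)))"
    and bal2: "\<And>b. b \<in> carrier M \<Longrightarrow> balanced A' M ra' P la' (tensor_rels A' M ra' P la')
        (\<lambda>d1 d2. frag_of (m b d1, d2))"
    and bij: "bij_betw \<theta> (carrier (tensor A M ra M la)) (carrier (tensor A' M ra' P la'))"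
  shows translation_map_inj: "keys z \<subseteq> carrier M \<times> carrier M \<Longrightarrow> keys w \<subseteq> carrier M \<times> carrier M \<Longrightarrow>
        Sw z (\<lambda>b b'. Sw (fl (dl b')) (\<lambda>d1 d2. frag_of (m b d1, d2)))
         \<simeq>[tensor_rels A' M ra' P la'] Sw w (\<lambda>b b'. Sw (fl (dl b')) (\<lambda>d1 d2. frag_of (m b d1, d2))) \<Longrightarrow>
        z \<simeq>[tensor_rels A M ra M la] w"
    and translation_map_inv: "v \<in> lists (carrier M \<times> carrier P) \<Longrightarrow>
        inv_into (carrier (tensor A M ra M la)) \<theta> (tsum A' M ra' P la' v) \<in> carrier (tensor A M ra M la)"
    and translation_map_apply_inv: "v \<in> lists (carrier M \<times> carrier P) \<Longrightarrow>
        us \<in> treps A M ra M la (inv_into (carrier (tensor A M ra M la)) \<theta> (tsum A' M ra' P la' v)) \<Longrightarrow>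
        Sw (fl us) (\<lambda>b b'. Sw (fl (dl b')) (\<lambda>d1 d2. frag_of (m b d1, d2)))
         \<simeq>[tensor_rels A' M ra' P la'] fl v"
proof -
  interpret t1: tensor_data A M ra M la by fact
  interpret t2: tensor_data A' M ra' P la' by fact
  let ?L = "\<lambda>us ds. [(m b d1, d2). (b, b') \<leftarrow> us, (d1, d2) \<leftarrow> ds b']"
  let ?\<Theta> = "\<lambda>z. Sw z (\<lambda>b b'. Sw (fl (dl b')) (\<lambda>d1 d2. frag_of (m b d1, d2)))"
  have L: "?L us ds \<in> lists (carrier M \<times> carrier P)"
    if "us \<in> lists (carrier M \<times> carrier M)" "ds \<in> (\<Pi> d\<in>carrier M. treps A' M ra' P la' (D d))" for us ds
  proof (rule concat_map_lists[OF that(1)])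
    fix x y assume "x \<in> carrier M" "y \<in> carrier M"
    then show "map (\<lambda>(d1, d2). (m x d1, d2)) (ds y) \<in> lists (carrier M \<times> carrier P)"
      using that(2) by (intro map_lists[OF treps_lists]) (auto simp: m)
  qed
  have dlPi: "dl \<in> (\<Pi> d\<in>carrier M. treps A' M ra' P la' (D d))" using dl by auto
  \<comment> \<open>By \<open>bal2\<close> the formula for \<theta> may use any representatives
    \<open>ds\<close>; replacing them by \<open>dl\<close> turns it into the fixed function
    \<open>?\<Theta>\<close> of the formal sum.\<close>
  have flL: "fl (?L us ds) \<simeq>[t2.rels] ?\<Theta> (fl us)"
    if us: "us \<in> lists (carrier M \<times> carrier M)" and ds: "ds \<in> (\<Pi> d\<in>carrier M. treps A' M ra' P la' (D d))" for us ds
  proof -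
    have "Sw (fl us) (\<lambda>b b'. Sw (fl (ds b')) (\<lambda>d1 d2. frag_of (m b d1, d2))) \<simeq>[t2.rels] ?\<Theta> (fl us)"
    proof (rule Sw_cong[OF keys_fl[OF us]])
      fix b b' assume b: "b \<in> carrier M" "b' \<in> carrier M"
      have "fl (ds b') \<simeq>[t2.rels] fl (dl b')"
        using t2.treps_eqm[OF _ dl[OF b(2)]] ds b(2) by auto
      from Sw_balanced[OF bal2[OF b(1)] this]
      show "Sw (fl (ds b')) (\<lambda>d1 d2. frag_of (m b d1, d2)) \<simeq>[t2.rels] Sw (fl (dl b')) (\<lambda>d1 d2. frag_of (m b d1, d2))" .
    qed
    then show ?thesis by (simp add: fl_concat fl_map)
  qed
  \<comment> \<open>All choices of representatives give congruent sums, and \<open>us\<close> with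
    \<open>dl\<close> is one of them, so \<open>THE\<close> picks their common value.\<close>
  have val: "\<theta> z = t2.ts (?L us dl)" if us: "us \<in> treps A M ra M la z" for z us
    unfolding \<theta>_def
  proof (rule the_equality)
    show "\<forall>us'\<in>treps A M ra M la z. \<forall>ds\<in>(\<Pi> d\<in>carrier M. treps A' M ra' P la' (D d)).
        t2.ts (?L us dl) = t2.ts (?L us' ds)"
    proof (intro ballI)
      fix us' ds assume us': "us' \<in> treps A M ra M la z" and ds: "ds \<in> (\<Pi> d\<in>carrier M. treps A' M ra' P la' (D d))"
      note l = treps_lists[OF us] treps_lists[OF us']
      have "fl (?L us dl) \<simeq>[t2.rels] ?\<Theta> (fl us)" by (rule flL[OF l(1) dlPi])
      also have "\<dots> \<simeq>[t2.rels] ?\<Theta> (fl us')" by (rule Sw_balanced[OF bal1 t1.treps_eqm[OF us us']])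
      also have "\<dots> \<simeq>[t2.rels] fl (?L us' ds)" by (rule eqm_sym[OF flL[OF l(2) ds]])
      finally show "t2.ts (?L us dl) = t2.ts (?L us' ds)"
        using t2.tsum_eq_iff[OF L[OF l(1) dlPi] L[OF l(2) ds]] by blast
    qed
  qed (use us dlPi in blast)
  show "z \<simeq>[t1.rels] w" if kz: "keys z \<subseteq> carrier M \<times> carrier M" and kw: "keys w \<subseteq> carrier M \<times> carrier M"
    and e: "?\<Theta> z \<simeq>[t2.rels] ?\<Theta> w"
  proof -
    \<comment> \<open>Values of \<theta> are known on cosets given by lists, so z and w are replaced
      by congruent lists; \<open>bal1\<close> carries the hypothesis over.\<close>
    obtain us vs where us: "us \<in> lists (carrier M \<times> carrier M)" "fl us \<simeq>[t1.rels] z"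
      and vs: "vs \<in> lists (carrier M \<times> carrier M)" "fl vs \<simeq>[t1.rels] w"
      using t1.list_rep[OF kz] t1.list_rep[OF kw] by blast
    have "fl (?L us dl) \<simeq>[t2.rels] ?\<Theta> (fl us)" by (rule flL[OF us(1) dlPi])
    also have "\<dots> \<simeq>[t2.rels] ?\<Theta> z" by (rule Sw_balanced[OF bal1 us(2)])
    also have "\<dots> \<simeq>[t2.rels] ?\<Theta> w" by (rule e)
    also have "\<dots> \<simeq>[t2.rels] ?\<Theta> (fl vs)" by (rule Sw_balanced[OF bal1 eqm_sym[OF vs(2)]])
    also have "\<dots> \<simeq>[t2.rels] fl (?L vs dl)" by (rule eqm_sym[OF flL[OF vs(1) dlPi]])
    finally have "t2.ts (?L us dl) = t2.ts (?L vs dl)"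
      using t2.tsum_eq_iff[OF L[OF us(1) dlPi] L[OF vs(1) dlPi]] by blast
    then have "\<theta> (t1.ts us) = \<theta> (t1.ts vs)"
      using val[of us "t1.ts us"] val[of vs "t1.ts vs"] us(1) vs(1) by (simp add: treps_def)
    then have "t1.ts us = t1.ts vs"
      by (rule inj_onD[OF bij_betw_imp_inj_on[OF bij]]) (intro t1.tsum_closed us(1) vs(1))+
    then have "fl us \<simeq>[t1.rels] fl vs" using t1.tsum_eq_iff us(1) vs(1) by blast
    then show ?thesis using us(2) vs(2) eqm_sym eqm_trans by blast
  qed
  let ?y = "\<lambda>v. inv_into (carrier t1.TP) \<theta> (t2.ts v)"
  have y: "?y v \<in> carrier t1.TP" "\<theta> (?y v) = t2.ts v" if "v \<in> lists (carrier M \<times> carrier P)" for v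
  proof -
    have "t2.ts v \<in> \<theta> ` carrier t1.TP" using bij t2.tsum_closed[OF that] by (simp add: bij_betw_def)
    then show "?y v \<in> carrier t1.TP" "\<theta> (?y v) = t2.ts v"
      by (rule inv_into_into, rule f_inv_into_f)
  qed
  then show "v \<in> lists (carrier M \<times> carrier P) \<Longrightarrow> ?y v \<in> carrier t1.TP" by blast
  show "?\<Theta> (fl us) \<simeq>[t2.rels] fl v" if v: "v \<in> lists (carrier M \<times> carrier P)" and us: "us \<in> treps A M ra M la (?y v)"
  proof -
    note l = treps_lists[OF us]
    have "t2.ts (?L us dl) = t2.ts v" using val[OF us] y[OF v] by simp
    then have "fl (?L us dl) \<simeq>[t2.rels] fl v" using t2.tsum_eq_iff[OF L[OF l dlPi] v] by blast
    with flL[OF l dlPi] show ?thesis using eqm_sym eqm_trans by blast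
  qed
qed

locale hopf = bialg K R B
  for K :: "('k, 'p) ring_scheme" and R :: "('k, 'r, 'q) module_scheme"
    and B :: "('k, 'r, 'b) bialgebroid" +
  assumes hopf: "right_xR_Hopf K R B"
begin

lemma BB_mid: "x \<in> carrier B \<Longrightarrow> r \<in> carrier R \<Longrightarrow> b \<in> carrier B \<Longrightarrow>
    frag_of (x \<star> \<xi> r, b) \<simeq>[BB] frag_of (x, b \<star> \<zeta> r)"
  using tensor_mid[of x B r "carrier R" b B "bract B" "blact B"] by (simp add: blact_eq bract_eq)

lemma bal_mult_left: "b \<in> carrier B \<Longrightarrow>
    balanced (carrier R) B (bract B) B (blact B) BB (\<lambda>d1 d2. frag_of (b \<star> d1, d2))"
  by (rule balancedI)
    (simp_all add: B.r_distr tensor_add_left tensor_add_right blact_eq bract_eq B.m_assoc[symmetric] BB_mid)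

text \<open>The coring axioms control multiplication by \<zeta>(r) from the right only. For the left
  side, \<Delta>(\<zeta>(r)) = \<zeta>(r) \<otimes> 1 is deduced from \<Delta>(1) and combined with
  multiplicativity. This makes \<theta> well defined over the opposite of R.\<close>

lemma ds_tgt_left:
  assumes "b \<in> carrier B" "r \<in> carrier R"
  shows "ds (\<zeta> r \<star> b) \<simeq>[BB] Sw (ds b) (\<lambda>x y. frag_of (\<zeta> r \<star> x, y))"
proof -
  have z: "ds (\<zeta> r) \<simeq>[BB] frag_of (\<zeta> r, \<one>\<^bsub>B\<^esub>)"
  proof -
    have "ds (\<one>\<^bsub>B\<^esub> \<star> \<zeta> r) \<simeq>[BB] Sw (ds \<one>\<^bsub>B\<^esub>) (\<lambda>x y. frag_of (x \<star> \<zeta> r, y))"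
      by (rule ds_tgt) (use assms in auto)
    also have "\<dots> \<simeq>[BB] Sw (frag_of (\<one>\<^bsub>B\<^esub>, \<one>\<^bsub>B\<^esub>)) (\<lambda>x y. frag_of (x \<star> \<zeta> r, y))"
      by (rule Sw_balanced[OF _ ds_one], rule balancedI)
        (use assms in \<open>simp_all add: B.l_distr tensor_add_left tensor_add_right blact_eq bract_eq B.m_assoc
          src_tgt_comm\<close>, use assms in \<open>simp add: B.m_assoc[symmetric] BB_mid\<close>)
    finally show ?thesis using assms by simp
  qed
  have "ds (\<zeta> r \<star> b) \<simeq>[BB] Sw (ds (\<zeta> r)) (\<lambda>b1 b2. Sw (ds b) (\<lambda>c1 c2. frag_of (b1 \<star> c1, b2 \<star> c2)))"
    by (rule ds_mult) (use assms in auto)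
  also have "\<dots> \<simeq>[BB] Sw (frag_of (\<zeta> r, \<one>\<^bsub>B\<^esub>)) (\<lambda>b1 b2. Sw (ds b) (\<lambda>c1 c2. frag_of (b1 \<star> c1, b2 \<star> c2)))"
  proof (rule Sw_balanced[OF _ z], rule balancedI)
    fix x x' y assume "x \<in> carrier B" "x' \<in> carrier B" "y \<in> carrier B"
    then show "Sw (ds b) (\<lambda>c1 c2. frag_of ((x \<oplus>\<^bsub>B\<^esub> x') \<star> c1, y \<star> c2))
       \<simeq>[BB] Sw (ds b) (\<lambda>c1 c2. frag_of (x \<star> c1, y \<star> c2)) + Sw (ds b) (\<lambda>c1 c2. frag_of (x' \<star> c1, y \<star> c2))"
      unfolding Sw_fadd[symmetric]
      by (intro Sw_cong[OF ds_keys[OF assms(1)]]) (simp add: B.l_distr tensor_add_left)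
  next
    fix x y y' assume "x \<in> carrier B" "y \<in> carrier B" "y' \<in> carrier B"
    then show "Sw (ds b) (\<lambda>c1 c2. frag_of (x \<star> c1, (y \<oplus>\<^bsub>B\<^esub> y') \<star> c2))
       \<simeq>[BB] Sw (ds b) (\<lambda>c1 c2. frag_of (x \<star> c1, y \<star> c2)) + Sw (ds b) (\<lambda>c1 c2. frag_of (x \<star> c1, y' \<star> c2))"
      unfolding Sw_fadd[symmetric]
      by (intro Sw_cong[OF ds_keys[OF assms(1)]]) (simp add: B.l_distr tensor_add_right)
  next
    \<comment> \<open>Componentwise multiplication is balanced in the left factor because
      \<Delta>(b) satisfies the Takeuchi condition.\<close>
    fix x a y assume x: "x \<in> carrier B" "a \<in> carrier R" "y \<in> carrier B"
    have bal: "balanced (carrier R) B (bract B) B (blact B) BB (\<lambda>c1 c2. frag_of (x \<star> c1, y \<star> c2))"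
      by (rule balancedI) (use x in \<open>simp_all add: B.r_distr tensor_add_left tensor_add_right
          blact_eq bract_eq B.m_assoc[symmetric] BB_mid\<close>)
    have "Sw (ds b) (\<lambda>c1 c2. frag_of (bract B x a \<star> c1, y \<star> c2))
       = Sw (Sw (ds b) (\<lambda>c1 c2. frag_of (\<xi> a \<star> c1, c2))) (\<lambda>c1 c2. frag_of (x \<star> c1, y \<star> c2))"
      unfolding Sw_Sw by (rule Sw_cong_eq[OF ds_keys[OF assms(1)]]) (use x in \<open>simp add: bract_eq B.m_assoc\<close>)
    also have "\<dots> \<simeq>[BB] Sw (Sw (ds b) (\<lambda>c1 c2. frag_of (c1, \<zeta> a \<star> c2))) (\<lambda>c1 c2. frag_of (x \<star> c1, y \<star> c2))"
      by (rule Sw_balanced[OF bal ds_takeuchi[OF assms(1) x(2)]])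
    also have "\<dots> = Sw (ds b) (\<lambda>c1 c2. frag_of (x \<star> c1, blact B a y \<star> c2))"
      unfolding Sw_Sw by (rule Sw_cong_eq[OF ds_keys[OF assms(1)]]) (use x in \<open>simp add: blact_eq B.m_assoc\<close>)
    finally show "Sw (ds b) (\<lambda>c1 c2. frag_of (bract B x a \<star> c1, y \<star> c2))
        \<simeq>[BB] Sw (ds b) (\<lambda>c1 c2. frag_of (x \<star> c1, blact B a y \<star> c2))" .
  qed
  also have "\<dots> = Sw (ds b) (\<lambda>x y. frag_of (\<zeta> r \<star> x, y))"
    unfolding Sw_of by (rule Sw_cong_eq[OF ds_keys[OF assms(1)]]) simp
  finally show ?thesis .
qed

definition "\<Theta> z = Sw z (\<lambda>b b'. Sw (ds b') (\<lambda>d1 d2. frag_of (b \<star> d1, d2)))"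

lemma balanced_\<Theta>: "balanced (carrier R) B (\<lambda>b r. b \<star> \<zeta> r) B (\<lambda>r b. \<zeta> r \<star> b) BB
    (\<lambda>b b'. Sw (ds b') (\<lambda>d1 d2. frag_of (b \<star> d1, d2)))"
proof (rule balancedI)
  fix x x' y assume x: "x \<in> carrier B" "x' \<in> carrier B" "y \<in> carrier B"
  then show "Sw (ds y) (\<lambda>d1 d2. frag_of ((x \<oplus>\<^bsub>B\<^esub> x') \<star> d1, d2))
     \<simeq>[BB] Sw (ds y) (\<lambda>d1 d2. frag_of (x \<star> d1, d2)) + Sw (ds y) (\<lambda>d1 d2. frag_of (x' \<star> d1, d2))"
    unfolding Sw_fadd[symmetric]
    by (intro Sw_cong[OF ds_keys[OF x(3)]]) (simp add: B.l_distr tensor_add_left)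
next
  fix x y y' assume x: "x \<in> carrier B" "y \<in> carrier B" "y' \<in> carrier B"
  then show "Sw (ds (y \<oplus>\<^bsub>B\<^esub> y')) (\<lambda>d1 d2. frag_of (x \<star> d1, d2))
     \<simeq>[BB] Sw (ds y) (\<lambda>d1 d2. frag_of (x \<star> d1, d2)) + Sw (ds y') (\<lambda>d1 d2. frag_of (x \<star> d1, d2))"
    unfolding Sw_add[symmetric] by (intro Sw_balanced[OF bal_mult_left ds_add])
next
  fix x a y assume x: "x \<in> carrier B" "a \<in> carrier R" "y \<in> carrier B"
  have "Sw (ds (\<zeta> a \<star> y)) (\<lambda>d1 d2. frag_of (x \<star> d1, d2))
     \<simeq>[BB] Sw (Sw (ds y) (\<lambda>d1 d2. frag_of (\<zeta> a \<star> d1, d2))) (\<lambda>d1 d2. frag_of (x \<star> d1, d2))"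
    by (intro Sw_balanced[OF bal_mult_left ds_tgt_left] x)
  also have "\<dots> = Sw (ds y) (\<lambda>d1 d2. frag_of (x \<star> \<zeta> a \<star> d1, d2))"
    unfolding Sw_Sw by (rule Sw_cong_eq[OF ds_keys[OF x(3)]]) (use x in \<open>simp add: B.m_assoc\<close>)
  finally show "Sw (ds y) (\<lambda>d1 d2. frag_of (x \<star> \<zeta> a \<star> d1, d2))
     \<simeq>[BB] Sw (ds (\<zeta> a \<star> y)) (\<lambda>d1 d2. frag_of (x \<star> d1, d2))" by (rule eqm_sym)
qed

definition "hl b = (SOME us. us \<in> treps_op R B (hopf_transl R B b))"
definition "hs b = fl (hl b)"

lemmas transl_B = translation_map[where D = "comult B" and m = "monoid.mult B" and dl = dl
      and \<theta> = "hopf_map R B",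
    OF hopf_map_def Bopt.tensor_data_axioms BBt.tensor_data_axioms _ dl balanced_\<Theta>[unfolded ds_def] bal_mult_left
      right_xR_Hopf.hopf_map_bij[OF hopf],
    folded ds_def, simplified]

lemma hl: "b \<in> carrier B \<Longrightarrow> hl b \<in> treps_op R B (hopf_transl R B b)"
  unfolding hl_def hopf_transl_def
  by (rule someI_ex) (use transl_B(2)[of "[(\<one>\<^bsub>B\<^esub>, b)]"] Bopt.treps_nonempty in auto)

lemma hs_keys: "b \<in> carrier B \<Longrightarrow> keys (hs b) \<subseteq> carrier B \<times> carrier B"
  unfolding hs_def using treps_lists[OF hl] by (rule keys_fl)

lemma hs_rep: "b \<in> carrier B \<Longrightarrow> us \<in> treps_op R B (hopf_transl R B b) \<Longrightarrow> fl us \<simeq>[Bop] hs b"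
  unfolding hs_def using hl Bopt.treps_eqm by blast

lemma \<Theta>_inj: "keys z \<subseteq> carrier B \<times> carrier B \<Longrightarrow> keys w \<subseteq> carrier B \<times> carrier B \<Longrightarrow>
    \<Theta> z \<simeq>[BB] \<Theta> w \<Longrightarrow> z \<simeq>[Bop] w"
  unfolding \<Theta>_def by (rule transl_B(1))

lemma \<Theta>_hs: "b \<in> carrier B \<Longrightarrow> \<Theta> (hs b) \<simeq>[BB] frag_of (\<one>\<^bsub>B\<^esub>, b)"
  using transl_B(3)[of "[(\<one>\<^bsub>B\<^esub>, b)]" "hl b"] hl[of b] by (simp add: hs_def hopf_transl_def \<Theta>_def)

end

lemma balanced_comp:
  assumes "balanced A M ra N la (tensor_rels A' M' ra' N' la') f" "balanced A' M' ra' N' la' G g"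
  shows "balanced A M ra N la G (\<lambda>x y. Sw (f x y) g)"
  by (rule balancedI; (unfold Sw_add[symmetric])?; rule Sw_balanced[OF assms(2)]; rule balancedD[OF assms(1)])

section \<open>Identities for b_- \<otimes> b_+\<close>

context hopf
begin

abbreviation "balBB \<equiv> balanced (carrier R) B (bract B) B (blact B)"
abbreviation "balop \<equiv> balanced (carrier R) B (\<lambda>b r. b \<star> \<zeta> r) B (\<lambda>r b. \<zeta> r \<star> b)"

lemma BB_midI: "u = x \<star> \<xi> r \<Longrightarrow> c = b \<star> \<zeta> r \<Longrightarrow> x \<in> carrier B \<Longrightarrow> r \<in> carrier R \<Longrightarrow> b \<in> carrier B \<Longrightarrow>
    frag_of (u, b) \<simeq>[BB] frag_of (x, c)"
  using BB_mid by simp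

lemma \<Theta>_Sw: "\<Theta> (Sw z f) = Sw z (\<lambda>x y. \<Theta> (f x y))"
  by (simp add: \<Theta>_def Sw_Sw)

lemma \<Theta>_of: "\<Theta> (frag_of (b, c)) = Sw (ds c) (\<lambda>d1 d2. frag_of (b \<star> d1, d2))"
  by (simp add: \<Theta>_def)

lemma \<Theta>_mult_left:
  assumes "keys z \<subseteq> carrier B \<times> carrier B" "a \<in> carrier B"
  shows "\<Theta> (Sw z (\<lambda>b c. frag_of (a \<star> b, c))) = Sw (\<Theta> z) (\<lambda>x y. frag_of (a \<star> x, y))"
  unfolding \<Theta>_def Sw_Sw Sw_of
  by (intro Sw_cong_eq[OF assms(1)] Sw_cong_eq[OF ds_keys]) (use assms in \<open>auto simp: B.m_assoc\<close>)

text \<open>\<theta> is left B-linear, so the pure tensor a \<otimes> b has the preimage a b_-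
  \<otimes> b_+.\<close>

lemma \<Theta>_hs_mult_left:
  assumes "b \<in> carrier B" "a \<in> carrier B"
  shows "\<Theta> (Sw (hs b) (\<lambda>x y. frag_of (a \<star> x, y))) \<simeq>[BB] frag_of (a, b)"
  unfolding \<Theta>_mult_left[OF hs_keys[OF assms(1)] assms(2)]
  using Sw_balanced[OF bal_mult_left[OF assms(2)] \<Theta>_hs[OF assms(1)]] assms by simp

lemma hs_add:
  assumes "b \<in> carrier B" "c \<in> carrier B"
  shows "hs (b \<oplus>\<^bsub>B\<^esub> c) \<simeq>[Bop] hs b + hs c"
proof (rule \<Theta>_inj)
  have "\<Theta> (hs (b \<oplus>\<^bsub>B\<^esub> c)) \<simeq>[BB] frag_of (\<one>\<^bsub>B\<^esub>, b \<oplus>\<^bsub>B\<^esub> c)" by (rule \<Theta>_hs) (use assms in auto)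
  also have "\<dots> \<simeq>[BB] frag_of (\<one>\<^bsub>B\<^esub>, b) + frag_of (\<one>\<^bsub>B\<^esub>, c)" by (rule tensor_add_right) (use assms in auto)
  also have "\<dots> \<simeq>[BB] \<Theta> (hs b) + \<Theta> (hs c)" by (intro eqm_add eqm_sym[OF \<Theta>_hs] assms)
  finally show "\<Theta> (hs (b \<oplus>\<^bsub>B\<^esub> c)) \<simeq>[BB] \<Theta> (hs b + hs c)" by (simp add: \<Theta>_def Sw_add)
  show "keys (hs b + hs c) \<subseteq> carrier B \<times> carrier B"
    using keys_add[of "hs b" "hs c"] hs_keys assms by blast
qed (use assms hs_keys in simp)

text \<open>Under \<theta> the two sides become 1 \<otimes> b \<zeta>(r) and \<xi>(r) \<otimes> b,
  which the middle relation over R identifies.\<close>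

lemma hs_tgt:
  assumes "b \<in> carrier B" "r \<in> carrier R"
  shows "hs (b \<star> \<zeta> r) \<simeq>[Bop] Sw (hs b) (\<lambda>x y. frag_of (\<xi> r \<star> x, y))"
proof (rule \<Theta>_inj)
  have "\<Theta> (hs (b \<star> \<zeta> r)) \<simeq>[BB] frag_of (\<one>\<^bsub>B\<^esub>, b \<star> \<zeta> r)" by (rule \<Theta>_hs) (use assms in auto)
  also have "\<dots> \<simeq>[BB] frag_of (\<xi> r, b)" by (rule eqm_sym, rule BB_midI[of _ _ r]) (use assms in auto)
  also have "\<dots> \<simeq>[BB] \<Theta> (Sw (hs b) (\<lambda>x y. frag_of (\<xi> r \<star> x, y)))"
    by (rule eqm_sym, rule \<Theta>_hs_mult_left) (use assms in auto)
  finally show "\<Theta> (hs (b \<star> \<zeta> r)) \<simeq>[BB] \<Theta> (Sw (hs b) (\<lambda>x y. frag_of (\<xi> r \<star> x, y)))" .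
  show "keys (Sw (hs b) (\<lambda>x y. frag_of (\<xi> r \<star> x, y))) \<subseteq> carrier B \<times> carrier B"
    by (rule keys_Sw_frag[OF hs_keys]) (use assms in auto)
qed (use assms hs_keys in simp)

text \<open>Both sides have image \<zeta>(r) \<otimes> b under \<theta>. For the left one this uses
  that x \<otimes> y \<mapsto> x \<zeta>(r) \<otimes> y is balanced, that is, that the ranges of
  \<xi> and \<zeta> commute.\<close>

lemma hs_tgt_comm:
  assumes "b \<in> carrier B" "r \<in> carrier R"
  shows "Sw (hs b) (\<lambda>x y. frag_of (x, y \<star> \<zeta> r)) \<simeq>[Bop] Sw (hs b) (\<lambda>x y. frag_of (\<zeta> r \<star> x, y))"
proof (rule \<Theta>_inj)
  have bal: "balBB BB (\<lambda>x y. frag_of (x \<star> \<zeta> r, y))"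
    by (rule balancedI, simp_all add: B.l_distr assms tensor_add_left tensor_add_right, rule BB_midI)
      (use assms in \<open>auto simp: bract_eq blact_eq B.m_assoc src_tgt_comm\<close>)
  have "\<Theta> (Sw (hs b) (\<lambda>x y. frag_of (x, y \<star> \<zeta> r))) = Sw (hs b) (\<lambda>x y. Sw (ds (y \<star> \<zeta> r)) (\<lambda>d1 d2. frag_of (x \<star> d1, d2)))"
    by (simp add: \<Theta>_Sw \<Theta>_of)
  also have "\<dots> \<simeq>[BB] Sw (hs b) (\<lambda>x y. Sw (Sw (ds y) (\<lambda>d1 d2. frag_of (d1 \<star> \<zeta> r, d2))) (\<lambda>d1 d2. frag_of (x \<star> d1, d2)))"
    by (intro Sw_cong[OF hs_keys] Sw_balanced[OF bal_mult_left ds_tgt]) (use assms in auto)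
  also have "\<dots> = Sw (\<Theta> (hs b)) (\<lambda>x y. frag_of (x \<star> \<zeta> r, y))"
    unfolding \<Theta>_def Sw_Sw Sw_of
    by (intro Sw_cong_eq[OF hs_keys] Sw_cong_eq[OF ds_keys]) (use assms in \<open>auto simp: B.m_assoc\<close>)
  also have "\<dots> \<simeq>[BB] frag_of (\<zeta> r, b)"
    using Sw_balanced[OF bal \<Theta>_hs[OF assms(1)]] assms by simp
  also have "\<dots> \<simeq>[BB] \<Theta> (Sw (hs b) (\<lambda>x y. frag_of (\<zeta> r \<star> x, y)))"
    by (rule eqm_sym, rule \<Theta>_hs_mult_left) (use assms in auto)
  finally show "\<Theta> (Sw (hs b) (\<lambda>x y. frag_of (x, y \<star> \<zeta> r))) \<simeq>[BB] \<Theta> (Sw (hs b) (\<lambda>x y. frag_of (\<zeta> r \<star> x, y)))" .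
qed (rule keys_Sw_frag[OF hs_keys]; use assms in auto)+

text \<open>By \<open>\<Theta>_hs_mult_left\<close>, \<theta> sends the left side to b_1 \<otimes>
  b_2, and this is also \<theta>(1 \<otimes> b).\<close>

lemma ds_hs:
  assumes "b \<in> carrier B"
  shows "Sw (ds b) (\<lambda>x y. Sw (hs y) (\<lambda>m p. frag_of (x \<star> m, p))) \<simeq>[Bop] frag_of (\<one>\<^bsub>B\<^esub>, b)"
proof (rule \<Theta>_inj)
  have "\<Theta> (Sw (ds b) (\<lambda>x y. Sw (hs y) (\<lambda>m p. frag_of (x \<star> m, p)))) \<simeq>[BB] Sw (ds b) (\<lambda>x y. frag_of (x, y))"
    unfolding \<Theta>_Sw[of "ds b"] by (intro Sw_cong[OF ds_keys[OF assms]] \<Theta>_hs_mult_left)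
  also have "\<dots> = Sw (ds b) (\<lambda>x y. frag_of (\<one>\<^bsub>B\<^esub> \<star> x, y))" by (rule Sw_cong_eq[OF ds_keys[OF assms]]) simp
  finally show "\<Theta> (Sw (ds b) (\<lambda>x y. Sw (hs y) (\<lambda>m p. frag_of (x \<star> m, p)))) \<simeq>[BB] \<Theta> (frag_of (\<one>\<^bsub>B\<^esub>, b))"
    by (simp only: \<Theta>_of)
  show "keys (Sw (ds b) (\<lambda>x y. Sw (hs y) (\<lambda>m p. frag_of (x \<star> m, p)))) \<subseteq> carrier B \<times> carrier B"
    by (rule keys_Sw[OF ds_keys[OF assms]], rule keys_Sw_frag[OF hs_keys]) auto
qed (use assms in simp)

end

section \<open>Comodule algebras, coinvariants and the map can\<close>

locale galois = hopf K R B + comod K R B T ra \<rho>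
  for K :: "('k, 'p) ring_scheme" and R :: "('k, 'r, 'q) module_scheme"
    and B :: "('k, 'r, 'b) bialgebroid" and T :: "('k, 't, 's) module_scheme"
    and ra :: "'t \<Rightarrow> 'r \<Rightarrow> 't" and \<rho> :: "'t \<Rightarrow> ('t \<times> 'b \<Rightarrow>\<^sub>0 int) set" +
  fixes S :: "'t set"
  assumes galois: "galois_extension K R B S T ra \<rho>"
begin

lemma comodule_algebra: "comodule_algebra K R B T ra \<rho>"
  using galois by (simp add: galois_extension_def)

lemma algebra_T: "assoc_algebra K T"
  using comodule_algebra by (simp add: comodule_algebra_def)

sublocale T: ring T
  using algebra_T by (simp add: assoc_algebra_def)

abbreviation mT (infixl "\<cdot>" 70) where "x \<cdot> y \<equiv> x \<otimes>\<^bsub>T\<^esub> y"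
abbreviation "TS \<equiv> tensor_rels S T (monoid.mult T) T (monoid.mult T)"
abbreviation "TB \<equiv> XB"

lemma ra_mult: "t \<in> carrier T \<Longrightarrow> r \<in> carrier R \<Longrightarrow> t' \<in> carrier T \<Longrightarrow> ra t r \<cdot> t' = t \<cdot> la r t'"
  using comodule_algebra.mult_balanced[OF comodule_algebra] .

lemma rho_one: "rho \<one>\<^bsub>T\<^esub> \<simeq>[TB] frag_of (\<one>\<^bsub>T\<^esub>, \<one>\<^bsub>B\<^esub>)"
  using rho_tsum[OF _ comodule_algebra.coact_one[OF comodule_algebra]] by simp

lemma rho_mult:
  assumes "t \<in> carrier T" "t' \<in> carrier T"
  shows "rho (t \<cdot> t') \<simeq>[TB] Sw (rho t) (\<lambda>x0 x1. Sw (rho t') (\<lambda>y0 y1. frag_of (x0 \<cdot> y0, x1 \<star> y1)))"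
proof -
  have "rho (t \<cdot> t') \<simeq>[TB] fl [(x0 \<cdot> y0, x1 \<star> y1). (x0, x1) \<leftarrow> rl t, (y0, y1) \<leftarrow> rl t']"
    by (rule rho_tsum[OF _ comodule_algebra.coact_mult[OF comodule_algebra _ _ rl rl]])
      (use assms in \<open>auto dest!: rl_mem\<close>)
  then show ?thesis by (simp add: fl_map fl_concat rho_def)
qed

lemma mem_S_iff: "s \<in> S \<longleftrightarrow> s \<in> carrier T \<and> rho s \<simeq>[TB] frag_of (s, \<one>\<^bsub>B\<^esub>)"
proof -
  have "\<rho> s = XBt.ts [(s, \<one>\<^bsub>B\<^esub>)] \<longleftrightarrow> rho s \<simeq>[TB] frag_of (s, \<one>\<^bsub>B\<^esub>)" if s: "s \<in> carrier T"
  proof -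
    have "XBt.ts (rl s) = \<rho> s" using rl[OF s] by (simp add: treps_def)
    then show ?thesis
      using XBt.tsum_eq_iff[OF rl_lists[OF s], of "[(s, \<one>\<^bsub>B\<^esub>)]"] s by (simp add: rho_def)
  qed
  then show ?thesis
    using galois_extension.coinv[OF galois] by (auto simp: coinvariants_def)
qed

lemma S_closed [simp]: "s \<in> S \<Longrightarrow> s \<in> carrier T"
  and rho_S: "s \<in> S \<Longrightarrow> rho s \<simeq>[TB] frag_of (s, \<one>\<^bsub>B\<^esub>)"
  using mem_S_iff by auto

sublocale TSt: tensor_data S T "monoid.mult T" T "monoid.mult T"
  by unfold_locales auto

text \<open>The axioms only say that multiplication is balanced over R. Right linearity follows
  because t(t' r) and (t t')r have the same coaction t_0 t'_0 \<otimes> t_1 t'_1 \<xi>(r) and \<rho>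
  is injective.\<close>

lemma mult_ra:
  assumes "t \<in> carrier T" "t' \<in> carrier T" "r \<in> carrier R"
  shows "t \<cdot> ra t' r = ra (t \<cdot> t') r"
proof (rule rho_inj)
  \<comment> \<open>Explicit lists are used because the product formula holds for every choice of
    representatives; rewriting inside it by congruences would call for
    \<open>bal_prod_right\<close>, which rests on this lemma.\<close>
  let ?v = "[(y0, bract B y1 r). (y0, y1) \<leftarrow> rl t']"
  let ?w = "[(x0 \<cdot> y0, x1 \<star> y1). (x0, x1) \<leftarrow> rl t, (y0, y1) \<leftarrow> rl t']"
  let ?f = "\<lambda>x0 x1. Sw (rho t') (\<lambda>y0 y1. frag_of (x0 \<cdot> y0, x1 \<star> (y1 \<star> \<xi> r)))"
  have v: "?v \<in> trepsB R B T ra (\<rho> (ra t' r))"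
    using right_comodule.coact_right_linear[OF comodule assms(3,2) rl[OF assms(2)]] assms
    by (auto simp: treps_def bract_eq dest!: rl_mem)
  have w: "?w \<in> trepsB R B T ra (\<rho> (t \<cdot> t'))"
    using comodule_algebra.coact_mult[OF comodule_algebra assms(1,2) rl rl] assms
    by (auto simp: treps_def dest!: rl_mem)
  have "\<rho> (t \<cdot> ra t' r) = XBt.ts [(x0 \<cdot> y0, x1 \<star> y1). (x0, x1) \<leftarrow> rl t, (y0, y1) \<leftarrow> ?v]"
    by (rule comodule_algebra.coact_mult[OF comodule_algebra _ _ rl v]) (use assms in auto)
  then have "rho (t \<cdot> ra t' r) \<simeq>[TB] fl [(x0 \<cdot> y0, x1 \<star> y1). (x0, x1) \<leftarrow> rl t, (y0, y1) \<leftarrow> ?v]"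
    by (rule rho_tsum[rotated]) (use assms in \<open>auto simp: bract_eq dest!: rl_mem\<close>)
  also have "\<dots> = Sw (rho t) ?f"
    by (simp only: fl_concat fl_map Sw_Sw Sw_of rho_def bract_eq)
  also have "\<dots> = Sw (rho t) (\<lambda>x0 x1. Sw (rho t') (\<lambda>y0 y1. frag_of (x0 \<cdot> y0, x1 \<star> y1 \<star> \<xi> r)))"
    by (intro Sw_cong_eq[OF rho_keys]) (use assms in \<open>auto simp: B.m_assoc\<close>)
  also have "\<dots> = fl [(z0, bract B z1 r). (z0, z1) \<leftarrow> ?w]"
    by (simp only: fl_concat fl_map Sw_Sw Sw_of rho_def bract_eq)
  also have "\<dots> \<simeq>[TB] rho (ra (t \<cdot> t') r)"
    by (rule eqm_sym, rule rho_tsum[OF _ right_comodule.coact_right_linear[OF comodule assms(3) _ w]])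
      (use assms in \<open>auto simp: bract_eq dest!: rl_mem\<close>)
  finally show "rho (t \<cdot> ra t' r) \<simeq>[TB] rho (ra (t \<cdot> t') r)" .
qed (use assms in auto)

text \<open>By \<open>mult_ra\<close> and balancedness, the right and left R-actions on T are
  multiplication by \<open>e r\<close> from the right and from the left.\<close>

definition "e r = ra \<one>\<^bsub>T\<^esub> r"

lemma e_closed [simp]: "r \<in> carrier R \<Longrightarrow> e r \<in> carrier T"
  by (simp add: e_def)

lemma ra_e: "t \<in> carrier T \<Longrightarrow> r \<in> carrier R \<Longrightarrow> ra t r = t \<cdot> e r"
  using mult_ra[of t "\<one>\<^bsub>T\<^esub>" r] by (simp add: e_def)

lemma la_e: "t \<in> carrier T \<Longrightarrow> r \<in> carrier R \<Longrightarrow> la r t = e r \<cdot> t"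
  using ra_mult[of "\<one>\<^bsub>T\<^esub>" r t] by (simp add: e_def)

text \<open>For a coinvariant s the formula for the left action gives r s = s \<epsilon>(\<xi>(r)) =
  s r. This lets the R-action pass to T/[S,T].\<close>

lemma e_S_comm:
  assumes "s \<in> S" "r \<in> carrier R"
  shows "e r \<cdot> s = s \<cdot> e r"
proof -
  have "frag_of (la r s) \<simeq>[add_rels T] Sw (rho s) (\<lambda>x0 x1. frag_of (ra x0 (\<epsilon> (\<xi> r \<star> x1))))"
    using assms by (intro frag_la) auto
  also have "\<dots> \<simeq>[add_rels T] Sw (frag_of (s, \<one>\<^bsub>B\<^esub>)) (\<lambda>x0 x1. frag_of (ra x0 (\<epsilon> (\<xi> r \<star> x1))))"
    by (rule Sw_balanced[OF balanced_la rho_S]) (use assms in auto)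
  also have "\<dots> = frag_of (ra s r)" using assms by simp
  finally have "la r s = ra s r"
    by (rule frag_eqm_imp_eq[OF X.abelian_group_axioms, rotated 2]) (use assms in auto)
  then show ?thesis using assms by (simp add: la_e ra_e)
qed

abbreviation "balTB \<equiv> balanced (carrier R) T ra B (blact B)"
abbreviation "balTS \<equiv> balanced S T (monoid.mult T) T (monoid.mult T)"

lemma TB_midI: "u = x \<cdot> e r \<Longrightarrow> c = b \<star> \<zeta> r \<Longrightarrow> x \<in> carrier T \<Longrightarrow> r \<in> carrier R \<Longrightarrow> b \<in> carrier B \<Longrightarrow>
    frag_of (u, b) \<simeq>[TB] frag_of (x, c)"
  using XB_mid[of x r b] by (simp add: ra_e)

text \<open>The product of \<open>T \<otimes>\<^sub>R B\<close> is defined on the Takeuchi part only, hence the sum over \<open>rho t\<close>.\<close>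

lemma bal_prod_right: "a \<in> carrier T \<Longrightarrow> b \<in> carrier B \<Longrightarrow> balTB TB (\<lambda>y0 y1. frag_of (a \<cdot> y0, b \<star> y1))"
  by (rule balancedI, simp_all add: T.r_distr B.r_distr tensor_add_left tensor_add_right, rule TB_midI)
    (auto simp: ra_e blact_eq T.m_assoc B.m_assoc)

lemma bal_mult_left_T: "a \<in> carrier T \<Longrightarrow> balTB TB (\<lambda>y0 y1. frag_of (a \<cdot> y0, y1))"
  by (rule balancedI, simp_all add: T.r_distr tensor_add_left tensor_add_right, rule TB_midI)
    (auto simp: ra_e blact_eq T.m_assoc)

lemma bal_mult_left_B: "b \<in> carrier B \<Longrightarrow> balTB TB (\<lambda>y0 y1. frag_of (y0, b \<star> y1))"
  by (rule balancedI, simp_all add: B.r_distr tensor_add_left tensor_add_right, rule TB_midI)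
    (auto simp: ra_e blact_eq B.m_assoc)

lemma bal_mult_S: "s \<in> S \<Longrightarrow> balTB TB (\<lambda>y0 y1. frag_of (y0 \<cdot> s, y1))"
  by (rule balancedI, simp_all add: T.l_distr tensor_add_left tensor_add_right, rule TB_midI)
    (auto simp: ra_e blact_eq T.m_assoc e_S_comm)

lemma bal_prod_left:
  assumes t: "t \<in> carrier T"
  shows "balTB TB (\<lambda>x0 x1. Sw (rho t) (\<lambda>y0 y1. frag_of (x0 \<cdot> y0, x1 \<star> y1)))"
proof (rule balancedI)
  fix x a y assume x: "x \<in> carrier T" "a \<in> carrier R" "y \<in> carrier B"
  have "Sw (rho t) (\<lambda>y0 y1. frag_of (ra x a \<cdot> y0, y \<star> y1))
     = Sw (Sw (rho t) (\<lambda>y0 y1. frag_of (la a y0, y1))) (\<lambda>y0 y1. frag_of (x \<cdot> y0, y \<star> y1))"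
    unfolding Sw_Sw Sw_of by (rule Sw_cong_eq[OF rho_keys[OF t]]) (use x in \<open>simp add: ra_mult\<close>)
  \<comment> \<open>Once across the multiplication, the scalar sits to the left of y_0;
    \<open>rho_takeuchi\<close> carries it to y_1.\<close>
  also have "\<dots> \<simeq>[TB] Sw (Sw (rho t) (\<lambda>y0 y1. frag_of (y0, \<zeta> a \<star> y1))) (\<lambda>y0 y1. frag_of (x \<cdot> y0, y \<star> y1))"
    by (intro Sw_balanced[OF bal_prod_right rho_takeuchi] x t)
  also have "\<dots> = Sw (rho t) (\<lambda>y0 y1. frag_of (x \<cdot> y0, blact B a y \<star> y1))"
    unfolding Sw_Sw Sw_of by (rule Sw_cong_eq[OF rho_keys[OF t]]) (use x in \<open>simp add: blact_eq B.m_assoc\<close>)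
  finally show "Sw (rho t) (\<lambda>y0 y1. frag_of (ra x a \<cdot> y0, y \<star> y1))
     \<simeq>[TB] Sw (rho t) (\<lambda>y0 y1. frag_of (x \<cdot> y0, blact B a y \<star> y1))" .
qed (unfold Sw_fadd[symmetric]; rule Sw_cong[OF rho_keys[OF t]];
    simp add: T.l_distr B.l_distr tensor_add_left tensor_add_right)+

lemma rho_e: "r \<in> carrier R \<Longrightarrow> rho (e r) \<simeq>[TB] frag_of (\<one>\<^bsub>T\<^esub>, \<xi> r)"
proof -
  assume r: "r \<in> carrier R"
  have "rho (e r) \<simeq>[TB] Sw (rho \<one>\<^bsub>T\<^esub>) (\<lambda>x0 x1. frag_of (x0, x1 \<star> \<xi> r))"
    unfolding e_def by (rule rho_ra) (use r in auto)
  also have "\<dots> \<simeq>[TB] Sw (frag_of (\<one>\<^bsub>T\<^esub>, \<one>\<^bsub>B\<^esub>)) (\<lambda>x0 x1. frag_of (x0, x1 \<star> \<xi> r))"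
    by (rule Sw_balanced[OF _ rho_one], rule balancedI, simp_all add: r B.l_distr tensor_add_left tensor_add_right, rule TB_midI)
     (use r in \<open>auto simp: ra_e blact_eq B.m_assoc src_tgt_comm\<close>)
  finally show ?thesis using r by simp
qed

lemma rho_S_left:
  assumes "s \<in> S" "t \<in> carrier T"
  shows "rho (s \<cdot> t) \<simeq>[TB] Sw (rho t) (\<lambda>y0 y1. frag_of (s \<cdot> y0, y1))"
proof -
  have "rho (s \<cdot> t) \<simeq>[TB] Sw (rho s) (\<lambda>x0 x1. Sw (rho t) (\<lambda>y0 y1. frag_of (x0 \<cdot> y0, x1 \<star> y1)))"
    by (rule rho_mult) (use assms in auto)
  also have "\<dots> \<simeq>[TB] Sw (frag_of (s, \<one>\<^bsub>B\<^esub>)) (\<lambda>x0 x1. Sw (rho t) (\<lambda>y0 y1. frag_of (x0 \<cdot> y0, x1 \<star> y1)))"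
    by (rule Sw_balanced[OF bal_prod_left rho_S]) (use assms in auto)
  also have "\<dots> = Sw (rho t) (\<lambda>y0 y1. frag_of (s \<cdot> y0, y1))"
    unfolding Sw_of by (rule Sw_cong_eq[OF rho_keys]) (use assms in auto)
  finally show ?thesis .
qed

lemma rho_S_right:
  assumes "s \<in> S" "t \<in> carrier T"
  shows "rho (t \<cdot> s) \<simeq>[TB] Sw (rho t) (\<lambda>x0 x1. frag_of (x0 \<cdot> s, x1))"
proof -
  have "rho (t \<cdot> s) \<simeq>[TB] Sw (rho t) (\<lambda>x0 x1. Sw (rho s) (\<lambda>y0 y1. frag_of (x0 \<cdot> y0, x1 \<star> y1)))"
    by (rule rho_mult) (use assms in auto)
  also have "\<dots> \<simeq>[TB] Sw (rho t) (\<lambda>x0 x1. Sw (frag_of (s, \<one>\<^bsub>B\<^esub>)) (\<lambda>y0 y1. frag_of (x0 \<cdot> y0, x1 \<star> y1)))"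
    by (intro Sw_cong[OF rho_keys] Sw_balanced[OF bal_prod_right rho_S]) (use assms in auto)
  also have "\<dots> = Sw (rho t) (\<lambda>x0 x1. frag_of (x0 \<cdot> s, x1))"
    unfolding Sw_of by (rule Sw_cong_eq[OF rho_keys]) (use assms in auto)
  finally show ?thesis .
qed

lemma balanced_CAN: "balTS TB (\<lambda>t' t. Sw (rho t) (\<lambda>t0 t1. frag_of (t' \<cdot> t0, t1)))"
proof (rule balancedI)
  fix x x' y assume x: "x \<in> carrier T" "x' \<in> carrier T" "y \<in> carrier T"
  then show "Sw (rho y) (\<lambda>d1 d2. frag_of ((x \<oplus>\<^bsub>T\<^esub> x') \<cdot> d1, d2))
     \<simeq>[TB] Sw (rho y) (\<lambda>d1 d2. frag_of (x \<cdot> d1, d2)) + Sw (rho y) (\<lambda>d1 d2. frag_of (x' \<cdot> d1, d2))"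
    unfolding Sw_fadd[symmetric]
    by (intro Sw_cong[OF rho_keys[OF x(3)]]) (simp add: T.l_distr tensor_add_left)
next
  fix x y y' assume x: "x \<in> carrier T" "y \<in> carrier T" "y' \<in> carrier T"
  then show "Sw (rho (y \<oplus>\<^bsub>T\<^esub> y')) (\<lambda>d1 d2. frag_of (x \<cdot> d1, d2))
     \<simeq>[TB] Sw (rho y) (\<lambda>d1 d2. frag_of (x \<cdot> d1, d2)) + Sw (rho y') (\<lambda>d1 d2. frag_of (x \<cdot> d1, d2))"
    unfolding Sw_add[symmetric] by (intro Sw_balanced[OF bal_mult_left_T rho_add])
next
  fix x s y assume x: "x \<in> carrier T" "s \<in> S" "y \<in> carrier T"
  have "Sw (rho (s \<cdot> y)) (\<lambda>d1 d2. frag_of (x \<cdot> d1, d2))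
     \<simeq>[TB] Sw (Sw (rho y) (\<lambda>d1 d2. frag_of (s \<cdot> d1, d2))) (\<lambda>d1 d2. frag_of (x \<cdot> d1, d2))"
    by (intro Sw_balanced[OF bal_mult_left_T rho_S_left] x)
  also have "\<dots> = Sw (rho y) (\<lambda>d1 d2. frag_of (x \<cdot> s \<cdot> d1, d2))"
    unfolding Sw_Sw by (rule Sw_cong_eq[OF rho_keys[OF x(3)]]) (use x in \<open>simp add: T.m_assoc\<close>)
  finally show "Sw (rho y) (\<lambda>d1 d2. frag_of (x \<cdot> s \<cdot> d1, d2))
     \<simeq>[TB] Sw (rho (s \<cdot> y)) (\<lambda>d1 d2. frag_of (x \<cdot> d1, d2))" by (rule eqm_sym)
qed

definition "CAN z = Sw z (\<lambda>t' t. Sw (rho t) (\<lambda>t0 t1. frag_of (t' \<cdot> t0, t1)))"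
definition "cl b = (SOME us. us \<in> trepsS S T (can_transl R B S T ra \<rho> b))"
definition "cs b = fl (cl b)"

lemmas transl_T = translation_map[where D = \<rho> and m = "monoid.mult T" and dl = rl
      and \<theta> = "can R B S T ra \<rho>",
    OF can_def TSt.tensor_data_axioms XBt.tensor_data_axioms _ rl balanced_CAN[unfolded rho_def] bal_mult_left_T
      galois_extension.can_bij[OF galois],
    folded rho_def, simplified]

lemma cl: "b \<in> carrier B \<Longrightarrow> cl b \<in> trepsS S T (can_transl R B S T ra \<rho> b)"
  unfolding cl_def can_transl_def
  by (rule someI_ex) (use transl_T(2)[of "[(\<one>\<^bsub>T\<^esub>, b)]"] TSt.treps_nonempty in auto)

lemma cs_keys: "b \<in> carrier B \<Longrightarrow> keys (cs b) \<subseteq> carrier T \<times> carrier T"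
  unfolding cs_def using treps_lists[OF cl] by (rule keys_fl)

lemma cs_rep: "b \<in> carrier B \<Longrightarrow> us \<in> trepsS S T (can_transl R B S T ra \<rho> b) \<Longrightarrow> fl us \<simeq>[TS] cs b"
  unfolding cs_def using cl TSt.treps_eqm by blast

lemma CAN_inj: "keys z \<subseteq> carrier T \<times> carrier T \<Longrightarrow> keys w \<subseteq> carrier T \<times> carrier T \<Longrightarrow>
    CAN z \<simeq>[TB] CAN w \<Longrightarrow> z \<simeq>[TS] w"
  unfolding CAN_def by (rule transl_T(1))

lemma CAN_cs: "b \<in> carrier B \<Longrightarrow> CAN (cs b) \<simeq>[TB] frag_of (\<one>\<^bsub>T\<^esub>, b)"
  using transl_T(3)[of "[(\<one>\<^bsub>T\<^esub>, b)]" "cl b"] cl[of b] by (simp add: cs_def can_transl_def CAN_def)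

end

section \<open>Identities for b^- \<otimes> b^+\<close>

context galois
begin

lemma CAN_Sw: "CAN (Sw z f) = Sw z (\<lambda>x y. CAN (f x y))"
  by (simp add: CAN_def Sw_Sw)

lemma CAN_of: "CAN (frag_of (x, t)) = Sw (rho t) (\<lambda>t0 t1. frag_of (x \<cdot> t0, t1))"
  by (simp add: CAN_def)

lemma CAN_one_left: "t \<in> carrier T \<Longrightarrow> CAN (frag_of (\<one>\<^bsub>T\<^esub>, t)) = rho t"
  unfolding CAN_of using Sw_cong_eq[OF rho_keys, of t "\<lambda>t0 t1. frag_of (\<one>\<^bsub>T\<^esub> \<cdot> t0, t1)" "\<lambda>t0 t1. frag_of (t0, t1)"]
  by simp

lemma CAN_cs_mult_left:
  assumes "b \<in> carrier B" "a \<in> carrier T"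
  shows "CAN (Sw (cs b) (\<lambda>x y. frag_of (a \<cdot> x, y))) \<simeq>[TB] frag_of (a, b)"
proof -
  have "CAN (Sw (cs b) (\<lambda>x y. frag_of (a \<cdot> x, y))) = Sw (CAN (cs b)) (\<lambda>x y. frag_of (a \<cdot> x, y))"
    unfolding CAN_def Sw_Sw Sw_of
    by (intro Sw_cong_eq[OF cs_keys[OF assms(1)]] Sw_cong_eq[OF rho_keys]) (use assms in \<open>auto simp: T.m_assoc\<close>)
  then show ?thesis
    using Sw_balanced[OF bal_mult_left_T[OF assms(2)] CAN_cs[OF assms(1)]] assms by simp
qed

lemma cs_add:
  assumes "b \<in> carrier B" "c \<in> carrier B"
  shows "cs (b \<oplus>\<^bsub>B\<^esub> c) \<simeq>[TS] cs b + cs c"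
proof (rule CAN_inj)
  have "CAN (cs (b \<oplus>\<^bsub>B\<^esub> c)) \<simeq>[TB] frag_of (\<one>\<^bsub>T\<^esub>, b \<oplus>\<^bsub>B\<^esub> c)" by (rule CAN_cs) (use assms in auto)
  also have "\<dots> \<simeq>[TB] frag_of (\<one>\<^bsub>T\<^esub>, b) + frag_of (\<one>\<^bsub>T\<^esub>, c)" by (rule tensor_add_right) (use assms in auto)
  also have "\<dots> \<simeq>[TB] CAN (cs b) + CAN (cs c)" by (intro eqm_add eqm_sym[OF CAN_cs] assms)
  finally show "CAN (cs (b \<oplus>\<^bsub>B\<^esub> c)) \<simeq>[TB] CAN (cs b + cs c)" by (simp add: CAN_def Sw_add)
  show "keys (cs b + cs c) \<subseteq> carrier T \<times> carrier T"
    using keys_add[of "cs b" "cs c"] cs_keys assms by blast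
qed (use assms cs_keys in simp)

lemma cs_one: "cs \<one>\<^bsub>B\<^esub> \<simeq>[TS] frag_of (\<one>\<^bsub>T\<^esub>, \<one>\<^bsub>T\<^esub>)"
proof (rule CAN_inj)
  have "CAN (cs \<one>\<^bsub>B\<^esub>) \<simeq>[TB] frag_of (\<one>\<^bsub>T\<^esub>, \<one>\<^bsub>B\<^esub>)" by (rule CAN_cs) auto
  also have "\<dots> \<simeq>[TB] CAN (frag_of (\<one>\<^bsub>T\<^esub>, \<one>\<^bsub>T\<^esub>))"
    using eqm_sym[OF rho_one] by (simp add: CAN_one_left)
  finally show "CAN (cs \<one>\<^bsub>B\<^esub>) \<simeq>[TB] CAN (frag_of (\<one>\<^bsub>T\<^esub>, \<one>\<^bsub>T\<^esub>))" .
qed (use cs_keys in simp_all)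

text \<open>can(1 \<otimes> e r) = \<rho>(e r) = 1 \<otimes> \<xi>(r). Hence \<xi>(r) will act on
  T/[S,T] as left multiplication by \<open>e r\<close>.\<close>

lemma cs_src: "r \<in> carrier R \<Longrightarrow> cs (\<xi> r) \<simeq>[TS] frag_of (\<one>\<^bsub>T\<^esub>, e r)"
proof (rule CAN_inj)
  assume r: "r \<in> carrier R"
  have "CAN (cs (\<xi> r)) \<simeq>[TB] frag_of (\<one>\<^bsub>T\<^esub>, \<xi> r)" by (rule CAN_cs) (use r in auto)
  also have "\<dots> \<simeq>[TB] CAN (frag_of (\<one>\<^bsub>T\<^esub>, e r))"
    using eqm_sym[OF rho_e[OF r]] r by (simp add: CAN_one_left)
  finally show "CAN (cs (\<xi> r)) \<simeq>[TB] CAN (frag_of (\<one>\<^bsub>T\<^esub>, e r))" .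
qed (use cs_keys in simp_all)

text \<open>In T \<otimes> B over R, 1 \<otimes> \<zeta>(r) equals e r \<otimes> 1, which is can(e r
  \<otimes> 1). Hence \<zeta>(r) will act as right multiplication by \<open>e r\<close>.\<close>

lemma cs_tgt: "r \<in> carrier R \<Longrightarrow> cs (\<zeta> r) \<simeq>[TS] frag_of (e r, \<one>\<^bsub>T\<^esub>)"
proof (rule CAN_inj)
  assume r: "r \<in> carrier R"
  have "CAN (cs (\<zeta> r)) \<simeq>[TB] frag_of (\<one>\<^bsub>T\<^esub>, \<zeta> r)" by (rule CAN_cs) (use r in auto)
  also have "\<dots> \<simeq>[TB] frag_of (e r, \<one>\<^bsub>B\<^esub>)" by (rule eqm_sym, rule TB_midI[of _ _ r]) (use r in auto)
  also have "\<dots> \<simeq>[TB] CAN (frag_of (e r, \<one>\<^bsub>T\<^esub>))"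
    unfolding CAN_of using eqm_sym[OF Sw_balanced[OF bal_mult_left_T[OF e_closed[OF r]] rho_one]] r by simp
  finally show "CAN (cs (\<zeta> r)) \<simeq>[TB] CAN (frag_of (e r, \<one>\<^bsub>T\<^esub>))" .
qed (use cs_keys in simp_all)

text \<open>Under can the inner pair collapses first: b^- b^+_0 \<otimes> b^+_1 becomes 1 \<otimes>
  b, which leaves c^- c^+_0 \<otimes> b c^+_1 = 1 \<otimes> b c. The nesting reverses the order on
  the left leg.\<close>

lemma cs_mult:
  assumes b: "b \<in> carrier B" and c: "c \<in> carrier B"
  shows "cs (b \<star> c) \<simeq>[TS] Sw (cs c) (\<lambda>dm dp. Sw (cs b) (\<lambda>cm cp. frag_of (dm \<cdot> cm, cp \<cdot> dp)))" (is "_ \<simeq>[TS] ?w")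
proof (rule CAN_inj)
  have "CAN ?w = Sw (cs c) (\<lambda>dm dp. Sw (cs b) (\<lambda>cm cp. Sw (rho (cp \<cdot> dp)) (\<lambda>t0 t1. frag_of (dm \<cdot> cm \<cdot> t0, t1))))"
    by (simp add: CAN_Sw CAN_of)
  also have "\<dots> \<simeq>[TB] Sw (cs c) (\<lambda>dm dp. Sw (cs b) (\<lambda>cm cp.
      Sw (Sw (rho cp) (\<lambda>x0 x1. Sw (rho dp) (\<lambda>y0 y1. frag_of (x0 \<cdot> y0, x1 \<star> y1)))) (\<lambda>t0 t1. frag_of (dm \<cdot> cm \<cdot> t0, t1))))"
    by (intro Sw_cong[OF cs_keys[OF c]] Sw_cong[OF cs_keys[OF b]] Sw_balanced[OF bal_mult_left_T rho_mult]) auto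
  also have "\<dots> = Sw (cs c) (\<lambda>dm dp. Sw (Sw (CAN (cs b)) (\<lambda>x0 x1. Sw (rho dp) (\<lambda>y0 y1. frag_of (x0 \<cdot> y0, x1 \<star> y1))))
       (\<lambda>t0 t1. frag_of (dm \<cdot> t0, t1)))"
    unfolding CAN_def Sw_Sw Sw_of
    by (intro Sw_cong_eq[OF cs_keys[OF c]] Sw_cong_eq[OF cs_keys[OF b]] Sw_cong_eq[OF rho_keys]) (auto simp: T.m_assoc)
  also have "\<dots> \<simeq>[TB] Sw (cs c) (\<lambda>dm dp. Sw (Sw (frag_of (\<one>\<^bsub>T\<^esub>, b)) (\<lambda>x0 x1. Sw (rho dp) (\<lambda>y0 y1. frag_of (x0 \<cdot> y0, x1 \<star> y1))))
       (\<lambda>t0 t1. frag_of (dm \<cdot> t0, t1)))"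
    by (intro Sw_cong[OF cs_keys[OF c]] Sw_balanced[OF bal_mult_left_T] Sw_balanced[OF bal_prod_left CAN_cs] b)
  also have "\<dots> = Sw (CAN (cs c)) (\<lambda>x y. frag_of (x, b \<star> y))"
    unfolding CAN_def Sw_Sw Sw_of
    by (intro Sw_cong_eq[OF cs_keys[OF c]] Sw_cong_eq[OF rho_keys]) auto
  also have "\<dots> \<simeq>[TB] frag_of (\<one>\<^bsub>T\<^esub>, b \<star> c)"
    using Sw_balanced[OF bal_mult_left_B[OF b] CAN_cs[OF c]] by simp
  also have "\<dots> \<simeq>[TB] CAN (cs (b \<star> c))" by (rule eqm_sym[OF CAN_cs]) (use b c in auto)
  finally show "CAN (cs (b \<star> c)) \<simeq>[TB] CAN ?w" by (rule eqm_sym)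
  show "keys ?w \<subseteq> carrier T \<times> carrier T"
    by (rule keys_Sw[OF cs_keys[OF c]], rule keys_Sw_frag[OF cs_keys[OF b]]) auto
qed (use b c cs_keys in simp)

text \<open>Both sides have image s \<otimes> b under can. For the right one, multiplication by s
  passes through \<rho> and has to be balanced over R, which is \<open>e_S_comm\<close>.\<close>

lemma cs_central:
  assumes b: "b \<in> carrier B" and s: "s \<in> S"
  shows "Sw (cs b) (\<lambda>x y. frag_of (s \<cdot> x, y)) \<simeq>[TS] Sw (cs b) (\<lambda>x y. frag_of (x, y \<cdot> s))"
proof (rule CAN_inj)
  have "CAN (Sw (cs b) (\<lambda>x y. frag_of (x, y \<cdot> s))) = Sw (cs b) (\<lambda>x y. Sw (rho (y \<cdot> s)) (\<lambda>t0 t1. frag_of (x \<cdot> t0, t1)))"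
    by (simp add: CAN_Sw CAN_of)
  also have "\<dots> \<simeq>[TB] Sw (cs b) (\<lambda>x y. Sw (Sw (rho y) (\<lambda>t0 t1. frag_of (t0 \<cdot> s, t1))) (\<lambda>t0 t1. frag_of (x \<cdot> t0, t1)))"
    by (intro Sw_cong[OF cs_keys[OF b]] Sw_balanced[OF bal_mult_left_T rho_S_right] s)
  also have "\<dots> = Sw (CAN (cs b)) (\<lambda>x y. frag_of (x \<cdot> s, y))"
    unfolding CAN_def Sw_Sw Sw_of
    by (intro Sw_cong_eq[OF cs_keys[OF b]] Sw_cong_eq[OF rho_keys]) (use s in \<open>auto simp: T.m_assoc\<close>)
  also have "\<dots> \<simeq>[TB] frag_of (s, b)"
    using Sw_balanced[OF bal_mult_S[OF s] CAN_cs[OF b]] s by simp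
  also have "\<dots> \<simeq>[TB] CAN (Sw (cs b) (\<lambda>x y. frag_of (s \<cdot> x, y)))"
    by (rule eqm_sym, rule CAN_cs_mult_left) (use s b in auto)
  finally show "CAN (Sw (cs b) (\<lambda>x y. frag_of (s \<cdot> x, y))) \<simeq>[TB] CAN (Sw (cs b) (\<lambda>x y. frag_of (x, y \<cdot> s)))"
    by (rule eqm_sym)
qed (rule keys_Sw_frag[OF cs_keys]; use s b in auto)+

text \<open>Applying can termwise gives t_0 \<otimes> t_1 = \<rho>(t) = can(1 \<otimes> t).\<close>

lemma rho_cs:
  assumes t: "t \<in> carrier T"
  shows "Sw (rho t) (\<lambda>t0 t1. Sw (cs t1) (\<lambda>cm cp. frag_of (t0 \<cdot> cm, cp))) \<simeq>[TS] frag_of (\<one>\<^bsub>T\<^esub>, t)" (is "?w \<simeq>[TS] _")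
proof (rule CAN_inj)
  have "CAN ?w \<simeq>[TB] Sw (rho t) (\<lambda>x y. frag_of (x, y))"
    unfolding CAN_Sw[of "rho t"] by (intro Sw_cong[OF rho_keys[OF t]] CAN_cs_mult_left)
  then show "CAN ?w \<simeq>[TB] CAN (frag_of (\<one>\<^bsub>T\<^esub>, t))" using t by (simp add: CAN_one_left)
  show "keys ?w \<subseteq> carrier T \<times> carrier T"
    by (rule keys_Sw[OF rho_keys[OF t]], rule keys_Sw_frag[OF cs_keys]) auto
qed (use t in simp)

section \<open>Functions that vanish on commutators\<close>

text \<open>Additive functions on T/[S,T] with values in the quotient by \<open>G\<close>, lifted to
  T. The universal one is \<open>frag_of\<close> modulo \<open>CT\<close>.\<close>

definition tr :: "('c \<Rightarrow>\<^sub>0 int) set \<Rightarrow> ('t \<Rightarrow> 'c \<Rightarrow>\<^sub>0 int) \<Rightarrow> bool" where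
  "tr G f \<longleftrightarrow> (\<forall>x\<in>carrier T. \<forall>y\<in>carrier T. f (x \<oplus>\<^bsub>T\<^esub> y) \<simeq>[G] f x + f y)
     \<and> (\<forall>s\<in>S. \<forall>x\<in>carrier T. f (s \<cdot> x) \<simeq>[G] f (x \<cdot> s))"

lemma trD:
  assumes "tr G f"
  shows tr_add: "x \<in> carrier T \<Longrightarrow> y \<in> carrier T \<Longrightarrow> f (x \<oplus>\<^bsub>T\<^esub> y) \<simeq>[G] f x + f y"
    and tr_comm: "s \<in> S \<Longrightarrow> x \<in> carrier T \<Longrightarrow> f (s \<cdot> x) \<simeq>[G] f (x \<cdot> s)"
  using assms by (auto simp: tr_def)

text \<open>The product y t x is arranged so that an s on the far right, behind x, can be moved
  cyclically to the far left, in front of y. This is what gives b^+ t b^- a meaning under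
  \<open>f\<close>.\<close>

lemma bal_tr:
  assumes f: "tr G f" and t: "t \<in> carrier T"
  shows "balTS G (\<lambda>x y. f (y \<cdot> t \<cdot> x))"
proof (rule balancedI)
  fix x s y assume x: "x \<in> carrier T" "s \<in> S" "y \<in> carrier T"
  have "f (y \<cdot> t \<cdot> (x \<cdot> s)) = f (y \<cdot> t \<cdot> x \<cdot> s)" using x t by (simp add: T.m_assoc)
  also have "\<dots> \<simeq>[G] f (s \<cdot> (y \<cdot> t \<cdot> x))" by (rule eqm_sym, rule tr_comm[OF f]) (use x t in auto)
  also have "\<dots> = f (s \<cdot> y \<cdot> t \<cdot> x)" using x t by (simp add: T.m_assoc)
  finally show "f (y \<cdot> t \<cdot> (x \<cdot> s)) \<simeq>[G] f (s \<cdot> y \<cdot> t \<cdot> x)" .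
qed (simp_all add: t T.l_distr T.r_distr tr_add[OF f])

text \<open>\<open>f\<close> applied to a representative of \<open>b \<triangleright> p(t)\<close>.\<close>

definition "act1 b f t = Sw (cs b) (\<lambda>cm cp. f (cp \<cdot> t \<cdot> cm))"

lemma act1_add:
  assumes f: "tr G f" and "t \<in> carrier T" "b \<in> carrier B" "c \<in> carrier B"
  shows "act1 (b \<oplus>\<^bsub>B\<^esub> c) f t \<simeq>[G] act1 b f t + act1 c f t"
  unfolding act1_def Sw_add[symmetric] by (intro Sw_balanced[OF bal_tr cs_add] assms)

lemma tr_act1:
  assumes f: "tr G f" and b: "b \<in> carrier B"
  shows "tr G (act1 b f)"
  unfolding tr_def
proof (intro conjI ballI)
  fix x y assume x: "x \<in> carrier T" "y \<in> carrier T"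
  then show "act1 b f (x \<oplus>\<^bsub>T\<^esub> y) \<simeq>[G] act1 b f x + act1 b f y"
    unfolding act1_def Sw_fadd[symmetric]
    by (intro Sw_cong[OF cs_keys[OF b]]) (simp add: T.l_distr T.r_distr tr_add[OF f])
next
  fix s x assume x: "s \<in> S" "x \<in> carrier T"
  have "act1 b f (s \<cdot> x) = Sw (Sw (cs b) (\<lambda>cm cp. frag_of (cm, cp \<cdot> s))) (\<lambda>cm cp. f (cp \<cdot> x \<cdot> cm))"
    unfolding act1_def Sw_Sw Sw_of by (intro Sw_cong_eq[OF cs_keys[OF b]]) (use x in \<open>auto simp: T.m_assoc\<close>)
  \<comment> \<open>Centrality carries s from the right of b^+ to the left of b^-, so s changes
    sides of x.\<close>
  also have "\<dots> \<simeq>[G] Sw (Sw (cs b) (\<lambda>cm cp. frag_of (s \<cdot> cm, cp))) (\<lambda>cm cp. f (cp \<cdot> x \<cdot> cm))"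
    by (intro Sw_balanced[OF bal_tr[OF f] eqm_sym[OF cs_central]] x b)
  also have "\<dots> = act1 b f (x \<cdot> s)"
    unfolding act1_def Sw_Sw Sw_of by (intro Sw_cong_eq[OF cs_keys[OF b]]) (use x in \<open>auto simp: T.m_assoc\<close>)
  finally show "act1 b f (s \<cdot> x) \<simeq>[G] act1 b f (x \<cdot> s)" .
qed

lemma act1_one:
  assumes f: "tr G f" and t: "t \<in> carrier T"
  shows "act1 \<one>\<^bsub>B\<^esub> f t \<simeq>[G] f t"
  unfolding act1_def using Sw_balanced[OF bal_tr[OF assms] cs_one] t by simp

lemma act1_src:
  assumes f: "tr G f" and t: "t \<in> carrier T" "r \<in> carrier R"
  shows "act1 (\<xi> r) f t \<simeq>[G] f (e r \<cdot> t)"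
  unfolding act1_def using Sw_balanced[OF bal_tr[OF f t(1)] cs_src[OF t(2)]] t by simp

lemma act1_tgt:
  assumes f: "tr G f" and t: "t \<in> carrier T" "r \<in> carrier R"
  shows "act1 (\<zeta> r) f t \<simeq>[G] f (t \<cdot> e r)"
  unfolding act1_def using Sw_balanced[OF bal_tr[OF f t(1)] cs_tgt[OF t(2)]] t by simp

text \<open>\<open>act1\<close> works on functions by precomposition, hence the reversed order; on
  T/[S,T] this says that b c acts as b after c.\<close>

lemma act1_mult:
  assumes f: "tr G f" and t: "t \<in> carrier T" "b \<in> carrier B" "c \<in> carrier B"
  shows "act1 (b \<star> c) f t \<simeq>[G] act1 c (act1 b f) t"
proof -
  have "act1 (b \<star> c) f t \<simeq>[G] Sw (Sw (cs c) (\<lambda>dm dp. Sw (cs b) (\<lambda>cm cp. frag_of (dm \<cdot> cm, cp \<cdot> dp))))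
      (\<lambda>cm cp. f (cp \<cdot> t \<cdot> cm))"
    unfolding act1_def by (intro Sw_balanced[OF bal_tr[OF f] cs_mult] t)
  also have "\<dots> = act1 c (act1 b f) t"
    unfolding act1_def Sw_Sw Sw_of
    by (intro Sw_cong_eq[OF cs_keys[OF t(3)]] Sw_cong_eq[OF cs_keys[OF t(2)]]) (use t in \<open>auto simp: T.m_assoc\<close>)
  finally show ?thesis .
qed

text \<open>By \<open>rho_cs\<close> the sum t_1^+ y t_0 t_1^- contracts to t y 1. The choice y = 1
  is stability; the free factor y serves the compatibility of action and coaction.\<close>

lemma act1_rho:
  assumes f: "tr G f" and t: "t \<in> carrier T" "y \<in> carrier T"
  shows "Sw (rho t) (\<lambda>t0 t1. act1 t1 f (y \<cdot> t0)) \<simeq>[G] f (t \<cdot> y)"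
proof -
  have "Sw (rho t) (\<lambda>t0 t1. act1 t1 f (y \<cdot> t0))
      = Sw (Sw (rho t) (\<lambda>t0 t1. Sw (cs t1) (\<lambda>cm cp. frag_of (t0 \<cdot> cm, cp)))) (\<lambda>cm cp. f (cp \<cdot> y \<cdot> cm))"
    unfolding act1_def Sw_Sw Sw_of
    by (intro Sw_cong_eq[OF rho_keys] Sw_cong_eq[OF cs_keys]) (use t in \<open>auto simp: T.m_assoc\<close>)
  also have "\<dots> \<simeq>[G] f (t \<cdot> y)"
    using Sw_balanced[OF bal_tr[OF f t(2)] rho_cs[OF t(1)]] t by simp
  finally show ?thesis .
qed

end

context galois
begin

section \<open>The compatibility of action and coaction\<close>

text \<open>Congruence modulo \<open>CT\<close> is equality in \<open>T/[S,T]\<close>, and congruence modulo \<open>CB\<close> is equality in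
  \<open>T/[S,T] \<otimes>\<^sub>R B\<close>, both on representatives in \<open>T\<close>.\<close>

definition "CT = add_rels T \<union> {frag_of (s \<cdot> t) - frag_of (t \<cdot> s) | s t. s \<in> S \<and> t \<in> carrier T}"

definition "CB = TB \<union> {frag_of (s \<cdot> t, b) - frag_of (t \<cdot> s, b) | s t b. s \<in> S \<and> t \<in> carrier T \<and> b \<in> carrier B}"

lemma CB_mono: "x \<simeq>[TB] y \<Longrightarrow> x \<simeq>[CB] y"
  by (erule eqm_mono) (simp add: CB_def)

lemma balCB: "balanced A M ra' N la' TB f \<Longrightarrow> balanced A M ra' N la' CB f"
  unfolding balanced_def using CB_mono by blast

lemma tr_CB: "b \<in> carrier B \<Longrightarrow> tr CB (\<lambda>t. frag_of (t, b))"
  unfolding tr_def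
  by (intro conjI ballI, rule CB_mono, rule tensor_add_left, simp_all, rule eqm_base)
    (auto simp: CB_def)

text \<open>The term \<open>(h\<^sub>+ \<triangleright> y\<^sub>0) \<otimes> d y\<^sub>1 h\<^sub>-\<close> of the Yetter-Drinfel'd condition, before the
  decomposition of \<open>h\<close> is inserted.\<close>

definition "yd d y0 y1 m p = act1 p (\<lambda>x. frag_of (x, d \<star> y1 \<star> m)) y0"

text \<open>A factor \<zeta>(r) on the left of the acting element acts last, as right multiplication
  by \<open>e r\<close>; across the tensor sign over R it becomes \<zeta>(r) on the right of the
  B-leg.\<close>

lemma bal_yd:
  assumes d: "d \<in> carrier B" "y0 \<in> carrier T" "y1 \<in> carrier B"
  shows "balop CB (yd d y0 y1)"
proof (rule balancedI)
  fix x x' y assume x: "x \<in> carrier B" "x' \<in> carrier B" "y \<in> carrier B"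
  show "yd d y0 y1 (x \<oplus>\<^bsub>B\<^esub> x') y \<simeq>[CB] yd d y0 y1 x y + yd d y0 y1 x' y"
    unfolding yd_def act1_def Sw_fadd[symmetric]
    by (intro Sw_cong[OF cs_keys[OF x(3)]] CB_mono) (use x d in \<open>simp add: B.r_distr tensor_add_right\<close>)
next
  fix x y y' assume x: "x \<in> carrier B" "y \<in> carrier B" "y' \<in> carrier B"
  show "yd d y0 y1 x (y \<oplus>\<^bsub>B\<^esub> y') \<simeq>[CB] yd d y0 y1 x y + yd d y0 y1 x y'"
    unfolding yd_def by (intro act1_add tr_CB) (use x d in auto)
next
  fix x r y assume x: "x \<in> carrier B" "r \<in> carrier R" "y \<in> carrier B"
  have f: "tr CB (\<lambda>x'. frag_of (x', d \<star> y1 \<star> x))" by (rule tr_CB) (use x d in auto)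
  have "yd d y0 y1 x (\<zeta> r \<star> y) \<simeq>[CB] act1 y (act1 (\<zeta> r) (\<lambda>x'. frag_of (x', d \<star> y1 \<star> x))) y0"
    unfolding yd_def by (rule act1_mult[OF f]) (use x d in auto)
  also have "\<dots> \<simeq>[CB] yd d y0 y1 (x \<star> \<zeta> r) y"
    unfolding yd_def act1_def[of y]
  proof (rule Sw_cong[OF cs_keys[OF x(3)]])
    fix cm cp assume c: "cm \<in> carrier T" "cp \<in> carrier T"
    have "act1 (\<zeta> r) (\<lambda>x'. frag_of (x', d \<star> y1 \<star> x)) (cp \<cdot> y0 \<cdot> cm) \<simeq>[CB] frag_of (cp \<cdot> y0 \<cdot> cm \<cdot> e r, d \<star> y1 \<star> x)"
      by (rule act1_tgt[OF f]) (use c x d in auto)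
    also have "\<dots> \<simeq>[CB] frag_of (cp \<cdot> y0 \<cdot> cm, d \<star> y1 \<star> (x \<star> \<zeta> r))"
      by (rule CB_mono, rule TB_midI[of _ _ r]) (use c x d in \<open>auto simp: B.m_assoc\<close>)
    finally show "act1 (\<zeta> r) (\<lambda>x'. frag_of (x', d \<star> y1 \<star> x)) (cp \<cdot> y0 \<cdot> cm)
       \<simeq>[CB] frag_of (cp \<cdot> y0 \<cdot> cm, d \<star> y1 \<star> (x \<star> \<zeta> r))" .
  qed
  finally show "yd d y0 y1 (x \<star> \<zeta> r) y \<simeq>[CB] yd d y0 y1 x (\<zeta> r \<star> y)" by (rule eqm_sym)
qed

lemma yd_assoc: "d \<in> carrier B \<Longrightarrow> y1 \<in> carrier B \<Longrightarrow> a \<in> carrier B \<Longrightarrow> m \<in> carrier B \<Longrightarrow>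
    yd d y0 (y1 \<star> a) m p = yd d y0 y1 (a \<star> m) p"
  by (simp add: yd_def B.m_assoc)

text \<open>In the Yetter-Drinfel'd condition \<open>b\<close> and \<open>d\<close> are the two legs
  of \<Delta>; they are kept independent so that the first leg can be varied alone, as in
  \<open>bal_ydh2\<close>.\<close>

definition "ydh d b y0 y1 = Sw (hs b) (yd d y0 y1)"

text \<open>A scalar on y_0 multiplies b_+ by \<zeta>(r) from the right; \<open>hs_tgt_comm\<close>
  moves it to the left of b_-, that is, to the right of y_1.\<close>

lemma bal_ydh:
  assumes d: "d \<in> carrier B" "b \<in> carrier B"
  shows "balTB CB (ydh d b)"
proof (rule balancedI)
  fix x x' y assume x: "x \<in> carrier T" "x' \<in> carrier T" "y \<in> carrier B"
  show "ydh d b (x \<oplus>\<^bsub>T\<^esub> x') y \<simeq>[CB] ydh d b x y + ydh d b x' y"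
    unfolding ydh_def Sw_fadd[symmetric] yd_def
    by (intro Sw_cong[OF hs_keys[OF d(2)]] tr_add[OF tr_act1[OF tr_CB]]) (use x d in auto)
next
  fix x y y' assume x: "x \<in> carrier T" "y \<in> carrier B" "y' \<in> carrier B"
  show "ydh d b x (y \<oplus>\<^bsub>B\<^esub> y') \<simeq>[CB] ydh d b x y + ydh d b x y'"
    unfolding ydh_def Sw_fadd[symmetric] yd_def act1_def
    by (intro Sw_cong[OF hs_keys[OF d(2)]] Sw_cong[OF cs_keys] CB_mono)
      (use x d in \<open>auto simp: B.r_distr B.l_distr tensor_add_right\<close>)
next
  fix x r y assume x: "x \<in> carrier T" "r \<in> carrier R" "y \<in> carrier B"
  have "ydh d b (ra x r) y \<simeq>[CB] Sw (hs b) (\<lambda>m p. yd d x y m (p \<star> \<zeta> r))"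
    unfolding ydh_def
  proof (rule Sw_cong[OF hs_keys[OF d(2)]])
    fix m p assume m: "m \<in> carrier B" "p \<in> carrier B"
    let ?f = "\<lambda>x'. frag_of (x', d \<star> y \<star> m)"
    have f: "tr CB ?f" by (rule tr_CB) (use m x d in auto)
    have "yd d x y m (p \<star> \<zeta> r) \<simeq>[CB] act1 (\<zeta> r) (act1 p ?f) x"
      unfolding yd_def by (rule act1_mult[OF f]) (use m x in auto)
    also have "\<dots> \<simeq>[CB] act1 p ?f (x \<cdot> e r)"
      by (rule act1_tgt[OF tr_act1[OF f]]) (use m x in auto)
    finally show "yd d (ra x r) y m p \<simeq>[CB] yd d x y m (p \<star> \<zeta> r)"
      using x by (simp add: yd_def ra_e eqm_sym)
  qed
  also have "\<dots> = Sw (Sw (hs b) (\<lambda>m p. frag_of (m, p \<star> \<zeta> r))) (yd d x y)"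
    by (simp add: Sw_Sw)
  also have "\<dots> \<simeq>[CB] Sw (Sw (hs b) (\<lambda>m p. frag_of (\<zeta> r \<star> m, p))) (yd d x y)"
    by (intro Sw_balanced[OF bal_yd hs_tgt_comm] d x)
  also have "\<dots> = ydh d b x (blact B r y)"
    unfolding ydh_def Sw_Sw Sw_of
    by (rule Sw_cong_eq[OF hs_keys[OF d(2)]]) (use x d in \<open>simp add: yd_assoc blact_eq\<close>)
  finally show "ydh d b (ra x r) y \<simeq>[CB] ydh d b x (blact B r y)" .
qed

text \<open>Crossing R is \<open>hs_tgt\<close>: b \<zeta>(r) gives \<xi>(r) b_-, and \<xi>(r) is
  absorbed on the right of y_1. Coassociativity will insert the two legs of a coproduct into y_1 and
  b.\<close>

lemma bal_ydh2:
  assumes d: "d \<in> carrier B" "y0 \<in> carrier T"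
  shows "balBB CB (\<lambda>y1 b. ydh d b y0 y1)"
proof (rule balancedI)
  fix x y y' assume x: "x \<in> carrier B" "y \<in> carrier B" "y' \<in> carrier B"
  show "ydh d (y \<oplus>\<^bsub>B\<^esub> y') y0 x \<simeq>[CB] ydh d y y0 x + ydh d y' y0 x"
    unfolding ydh_def Sw_add[symmetric] by (intro Sw_balanced[OF bal_yd hs_add] x d)
next
  fix x r b assume x: "x \<in> carrier B" "r \<in> carrier R" "b \<in> carrier B"
  have "ydh d (blact B r b) y0 x \<simeq>[CB] Sw (Sw (hs b) (\<lambda>m p. frag_of (\<xi> r \<star> m, p))) (yd d y0 x)"
    unfolding ydh_def blact_eq by (intro Sw_balanced[OF bal_yd hs_tgt] x d)
  also have "\<dots> = ydh d b y0 (bract B x r)"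
    unfolding ydh_def Sw_Sw Sw_of
    by (rule Sw_cong_eq[OF hs_keys[OF x(3)]]) (use x d in \<open>simp add: yd_assoc bract_eq\<close>)
  finally show "ydh d b y0 (bract B x r) \<simeq>[CB] ydh d (blact B r b) y0 x" by (rule eqm_sym)
qed (rule balancedD[OF bal_ydh]; use d in auto)

text \<open>Right linearity of the multiplication and of \<rho> turns a scalar on x into \<xi>(r) on
  the B-leg of the coaction, which \<open>bal_ydh2\<close> exchanges for \<zeta>(r) on b. This
  permits the auxiliary map to be evaluated on can(b^- \<otimes> b^+).\<close>

lemma bal_rho_ydh:
  assumes d: "d \<in> carrier B" "t \<in> carrier T"
  shows "balTB CB (\<lambda>x b. Sw (rho (t \<cdot> x)) (ydh d b))"
proof (rule balancedI)
  fix x x' b assume x: "x \<in> carrier T" "x' \<in> carrier T" "b \<in> carrier B"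
  have "Sw (rho (t \<cdot> (x \<oplus>\<^bsub>T\<^esub> x'))) (ydh d b) \<simeq>[CB] Sw (rho (t \<cdot> x) + rho (t \<cdot> x')) (ydh d b)"
    unfolding T.r_distr[OF x(1,2) d(2)] by (intro Sw_balanced[OF bal_ydh rho_add]) (use x d in auto)
  then show "Sw (rho (t \<cdot> (x \<oplus>\<^bsub>T\<^esub> x'))) (ydh d b) \<simeq>[CB] Sw (rho (t \<cdot> x)) (ydh d b) + Sw (rho (t \<cdot> x')) (ydh d b)"
    by (simp add: Sw_add)
next
  fix x b b' assume x: "x \<in> carrier T" "b \<in> carrier B" "b' \<in> carrier B"
  have k: "keys (rho (t \<cdot> x)) \<subseteq> carrier T \<times> carrier B" by (rule rho_keys) (use x d in auto)
  show "Sw (rho (t \<cdot> x)) (ydh d (b \<oplus>\<^bsub>B\<^esub> b')) \<simeq>[CB] Sw (rho (t \<cdot> x)) (ydh d b) + Sw (rho (t \<cdot> x)) (ydh d b')"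
    unfolding Sw_fadd[symmetric]
    by (rule Sw_cong[OF k], rule balancedD(2)[OF bal_ydh2]) (use x d in auto)
next
  fix x r b assume x: "x \<in> carrier T" "r \<in> carrier R" "b \<in> carrier B"
  have k: "keys (rho (t \<cdot> x)) \<subseteq> carrier T \<times> carrier B" by (rule rho_keys) (use x d in auto)
  have "Sw (rho (t \<cdot> ra x r)) (ydh d b)
     \<simeq>[CB] Sw (Sw (rho (t \<cdot> x)) (\<lambda>x0 x1. frag_of (x0, x1 \<star> \<xi> r))) (ydh d b)"
    unfolding mult_ra[OF d(2) x(1,2)] by (intro Sw_balanced[OF bal_ydh rho_ra]) (use x d in auto)
  also have "\<dots> = Sw (rho (t \<cdot> x)) (\<lambda>x0 x1. ydh d b x0 (bract B x1 r))"
    by (simp add: Sw_Sw bract_eq)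
  also have "\<dots> \<simeq>[CB] Sw (rho (t \<cdot> x)) (ydh d (blact B r b))"
    by (rule Sw_cong[OF k], rule balancedD(3)[OF bal_ydh2]) (use x d in auto)
  finally show "Sw (rho (t \<cdot> ra x r)) (ydh d b) \<simeq>[CB] Sw (rho (t \<cdot> x)) (ydh d (blact B r b))" .
qed

text \<open>Cancels \<open>b\<^sub>-\<close> against the coaction of \<open>u\<close>: coassociativity produces
  \<open>b\<^sub>1 b\<^sub>2\<^sub>- \<otimes> b\<^sub>2\<^sub>+ = 1 \<otimes> b\<close>.\<close>

lemma rho_ydh:
  assumes d: "d \<in> carrier B" "y \<in> carrier T" "u \<in> carrier T"
  shows "Sw (rho u) (\<lambda>u0 u1. Sw (rho (y \<cdot> u0)) (ydh d u1)) \<simeq>[CB] Sw (rho y) (\<lambda>w0 w1. frag_of (u \<cdot> w0, d \<star> w1))"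
proof -
  note ku = rho_keys[OF d(3)] and ky = rho_keys[OF d(2)]
  have "Sw (rho u) (\<lambda>u0 u1. Sw (rho (y \<cdot> u0)) (ydh d u1))
     \<simeq>[CB] Sw (rho u) (\<lambda>u0 u1. Sw (Sw (rho y) (\<lambda>w0 w1. Sw (rho u0) (\<lambda>v0 v1. frag_of (w0 \<cdot> v0, w1 \<star> v1)))) (ydh d u1))"
    by (intro Sw_cong[OF ku] Sw_balanced[OF bal_ydh rho_mult] d)
  also have "\<dots> = Sw (rho y) (\<lambda>w0 w1. Sw (rho u) (\<lambda>u0 u1. Sw (rho u0) (\<lambda>v0 v1. ydh d u1 (w0 \<cdot> v0) (w1 \<star> v1))))"
    unfolding Sw_Sw Sw_of by (rule Sw_swap)
  also have "\<dots> \<simeq>[CB] Sw (rho y) (\<lambda>w0 w1. frag_of (u \<cdot> w0, d \<star> w1))"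
  proof (rule Sw_cong[OF ky])
    fix w0 w1 assume w: "w0 \<in> carrier T" "w1 \<in> carrier B"
    let ?F = "\<lambda>v0 v1 c. ydh d c (w0 \<cdot> v0) (w1 \<star> v1)"
    have b3: "balanced3 (carrier R) T ra B (blact B) (bract B) B (blact B) CB ?F"
      unfolding balanced3_def
    proof (intro conjI ballI)
      fix c assume "c \<in> carrier B"
      then show "balTB CB (\<lambda>x y. ?F x y c)"
        using balanced_comp[OF bal_prod_right[OF w] bal_ydh[OF d(1)]] by simp
    next
      fix x assume x: "x \<in> carrier T"
      show "balBB CB (?F x)"
        using balanced_comp[OF bal_mult_left[OF w(2)] bal_ydh2[OF d(1), of "w0 \<cdot> x"]] x w by simp
    qed
    have "Sw (rho u) (\<lambda>u0 u1. Sw (rho u0) (\<lambda>v0 v1. ?F v0 v1 u1))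
        \<simeq>[CB] Sw (rho u) (\<lambda>u0 u1. Sw (ds u1) (\<lambda>d1 d2. ?F u0 d1 d2))"
      by (rule rho_coassoc[OF d(3) b3])
    also have "\<dots> \<simeq>[CB] Sw (rho u) (\<lambda>u0 u1. yd d (w0 \<cdot> u0) w1 \<one>\<^bsub>B\<^esub> u1)"
    proof (rule Sw_cong[OF ku])
      fix u0 u1 assume u: "u0 \<in> carrier T" "u1 \<in> carrier B"
      have "Sw (ds u1) (\<lambda>d1 d2. ?F u0 d1 d2)
          = Sw (Sw (ds u1) (\<lambda>x y. Sw (hs y) (\<lambda>m p. frag_of (x \<star> m, p)))) (yd d (w0 \<cdot> u0) w1)"
        unfolding ydh_def Sw_Sw Sw_of
        by (intro Sw_cong_eq[OF ds_keys[OF u(2)]] Sw_cong_eq[OF hs_keys]) (use w d in \<open>auto simp: yd_assoc\<close>)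
      also have "\<dots> \<simeq>[CB] Sw (frag_of (\<one>\<^bsub>B\<^esub>, u1)) (yd d (w0 \<cdot> u0) w1)"
        by (intro Sw_balanced[OF bal_yd ds_hs]) (use u w d in auto)
      finally show "Sw (ds u1) (\<lambda>d1 d2. ?F u0 d1 d2) \<simeq>[CB] yd d (w0 \<cdot> u0) w1 \<one>\<^bsub>B\<^esub> u1" by simp
    qed
    \<comment> \<open>Now u_1 acts on w_0 u_0; \<open>act1_rho\<close> with y = w_0 returns u
      w_0.\<close>
    also have "\<dots> \<simeq>[CB] frag_of (u \<cdot> w0, d \<star> w1)"
      unfolding yd_def using act1_rho[OF tr_CB d(3) w(1), of "d \<star> w1 \<star> \<one>\<^bsub>B\<^esub>"] w d by simp
    finally show "Sw (rho u) (\<lambda>u0 u1. Sw (rho u0) (\<lambda>v0 v1. ?F v0 v1 u1)) \<simeq>[CB] frag_of (u \<cdot> w0, d \<star> w1)" .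
  qed
  finally show ?thesis .
qed

text \<open>\<open>rho_ydh\<close> is read backwards, with y = t b^- and u = b^+. This introduces
  the coaction of b^+ in order to produce can(b^- \<otimes> b^+), which then collapses to 1
  \<otimes> b.\<close>

lemma act_coact_half:
  assumes d: "d \<in> carrier B" "b \<in> carrier B" "t \<in> carrier T"
  shows "Sw (cs b) (\<lambda>cm cp. Sw (rho (t \<cdot> cm)) (\<lambda>w0 w1. frag_of (cp \<cdot> w0, d \<star> w1)))
     \<simeq>[CB] Sw (rho t) (ydh d b)"
proof -
  have "Sw (cs b) (\<lambda>cm cp. Sw (rho (t \<cdot> cm)) (\<lambda>w0 w1. frag_of (cp \<cdot> w0, d \<star> w1)))
     \<simeq>[CB] Sw (cs b) (\<lambda>cm cp. Sw (rho cp) (\<lambda>u0 u1. Sw (rho (t \<cdot> cm \<cdot> u0)) (ydh d u1)))"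
    by (rule Sw_cong[OF cs_keys[OF d(2)]], rule eqm_sym, rule rho_ydh) (use d in auto)
  also have "\<dots> = Sw (CAN (cs b)) (\<lambda>x b. Sw (rho (t \<cdot> x)) (ydh d b))"
    unfolding CAN_def Sw_Sw Sw_of
    by (intro Sw_cong_eq[OF cs_keys[OF d(2)]] Sw_cong_eq[OF rho_keys]) (use d in \<open>auto simp: T.m_assoc\<close>)
  also have "\<dots> \<simeq>[CB] Sw (rho t) (ydh d b)"
    using Sw_balanced[OF bal_rho_ydh CAN_cs, of d t b] d by simp
  finally show ?thesis .
qed

lemma bal_mult_TS: "a \<in> carrier T \<Longrightarrow> c \<in> carrier T \<Longrightarrow> balTS TS (\<lambda>x y. frag_of (a \<cdot> x, y \<cdot> c))"
  by (rule balancedI)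
    (simp_all add: T.l_distr T.r_distr tensor_add_left tensor_add_right T.m_assoc[symmetric],
     simp add: T.m_assoc[of _ _ c] tensor_mid[where ra = "monoid.mult T" and la = "monoid.mult T"])

text \<open>Allows \<open>cs c\<close> in \<open>cs_mult\<close> to be replaced by a congruent
  tensor; crossing S in the middle is centrality of b^- \<otimes> b^+.\<close>

lemma bal_cs_mult:
  assumes b: "b \<in> carrier B"
  shows "balTS TS (\<lambda>dm dp. Sw (cs b) (\<lambda>cm cp. frag_of (dm \<cdot> cm, cp \<cdot> dp)))"
proof (rule balancedI)
  fix x s y assume x: "x \<in> carrier T" "s \<in> S" "y \<in> carrier T"
  have "Sw (cs b) (\<lambda>cm cp. frag_of (x \<cdot> s \<cdot> cm, cp \<cdot> y))
     = Sw (Sw (cs b) (\<lambda>cm cp. frag_of (s \<cdot> cm, cp))) (\<lambda>cm cp. frag_of (x \<cdot> cm, cp \<cdot> y))"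
    unfolding Sw_Sw Sw_of by (rule Sw_cong_eq[OF cs_keys[OF b]]) (use x in \<open>simp add: T.m_assoc\<close>)
  also have "\<dots> \<simeq>[TS] Sw (Sw (cs b) (\<lambda>cm cp. frag_of (cm, cp \<cdot> s))) (\<lambda>cm cp. frag_of (x \<cdot> cm, cp \<cdot> y))"
    by (intro Sw_balanced[OF bal_mult_TS cs_central] x b)
  also have "\<dots> = Sw (cs b) (\<lambda>cm cp. frag_of (x \<cdot> cm, cp \<cdot> (s \<cdot> y)))"
    unfolding Sw_Sw Sw_of by (rule Sw_cong_eq[OF cs_keys[OF b]]) (use x in \<open>simp add: T.m_assoc\<close>)
  finally show "Sw (cs b) (\<lambda>cm cp. frag_of (x \<cdot> s \<cdot> cm, cp \<cdot> y))
     \<simeq>[TS] Sw (cs b) (\<lambda>cm cp. frag_of (x \<cdot> cm, cp \<cdot> (s \<cdot> y)))" .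
qed (unfold Sw_fadd[symmetric]; rule Sw_cong[OF cs_keys[OF b]];
    simp add: T.l_distr T.r_distr tensor_add_left tensor_add_right)+

lemma cs_mult_src:
  assumes b: "b \<in> carrier B" "r \<in> carrier R"
  shows "cs (b \<star> \<xi> r) \<simeq>[TS] Sw (cs b) (\<lambda>cm cp. frag_of (cm, cp \<cdot> e r))"
proof -
  have "cs (b \<star> \<xi> r) \<simeq>[TS] Sw (cs (\<xi> r)) (\<lambda>dm dp. Sw (cs b) (\<lambda>cm cp. frag_of (dm \<cdot> cm, cp \<cdot> dp)))"
    by (rule cs_mult) (use b in auto)
  also have "\<dots> \<simeq>[TS] Sw (frag_of (\<one>\<^bsub>T\<^esub>, e r)) (\<lambda>dm dp. Sw (cs b) (\<lambda>cm cp. frag_of (dm \<cdot> cm, cp \<cdot> dp)))"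
    by (intro Sw_balanced[OF bal_cs_mult cs_src] b)
  also have "\<dots> = Sw (cs b) (\<lambda>cm cp. frag_of (cm, cp \<cdot> e r))"
    unfolding Sw_of by (rule Sw_cong_eq[OF cs_keys[OF b(1)]]) (use b in simp)
  finally show ?thesis .
qed

lemma cs_mult_tgt:
  assumes b: "b \<in> carrier B" "r \<in> carrier R"
  shows "cs (b \<star> \<zeta> r) \<simeq>[TS] Sw (cs b) (\<lambda>cm cp. frag_of (e r \<cdot> cm, cp))"
proof -
  have "cs (b \<star> \<zeta> r) \<simeq>[TS] Sw (cs (\<zeta> r)) (\<lambda>dm dp. Sw (cs b) (\<lambda>cm cp. frag_of (dm \<cdot> cm, cp \<cdot> dp)))"
    by (rule cs_mult) (use b in auto)
  also have "\<dots> \<simeq>[TS] Sw (frag_of (e r, \<one>\<^bsub>T\<^esub>)) (\<lambda>dm dp. Sw (cs b) (\<lambda>cm cp. frag_of (dm \<cdot> cm, cp \<cdot> dp)))"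
    by (intro Sw_balanced[OF bal_cs_mult cs_tgt] b)
  also have "\<dots> = Sw (cs b) (\<lambda>cm cp. frag_of (e r \<cdot> cm, cp))"
    unfolding Sw_of by (rule Sw_cong_eq[OF cs_keys[OF b(1)]]) (use b in simp)
  finally show ?thesis .
qed

lemma bal_shift:
  assumes "balTS G f" and x: "x \<in> carrier T"
  shows "balTS G (\<lambda>y z. f (x \<cdot> y) z)"
proof -
  have "balTS TS (\<lambda>y z. frag_of (x \<cdot> y, z))"
    by (rule balancedI) (use x in \<open>simp_all add: T.r_distr tensor_add_left tensor_add_right
        T.m_assoc[symmetric] tensor_mid[where ra = "monoid.mult T" and la = "monoid.mult T"]\<close>)
  from balanced_comp[OF this assms(1)] show ?thesis by simp
qed

text \<open>Gives b_1^- \<otimes> b_1^+ \<otimes> b_2 a meaning: \<xi>(r) on b_1 moves to b_1^+ by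
  \<open>cs_mult_src\<close>, and from there to b_2.\<close>

lemma bal_cs:
  assumes f1: "\<And>c. c \<in> carrier B \<Longrightarrow> balTS G (\<lambda>x y. f x y c)"
    and f2: "\<And>x. x \<in> carrier T \<Longrightarrow> balTB G (f x)"
  shows "balBB G (\<lambda>b1 b2. Sw (cs b1) (\<lambda>cm cp. f cm cp b2))"
proof (rule balancedI)
  fix y y' z assume y: "y \<in> carrier B" "y' \<in> carrier B" "z \<in> carrier B"
  show "Sw (cs (y \<oplus>\<^bsub>B\<^esub> y')) (\<lambda>cm cp. f cm cp z) \<simeq>[G] Sw (cs y) (\<lambda>cm cp. f cm cp z) + Sw (cs y') (\<lambda>cm cp. f cm cp z)"
    unfolding Sw_add[symmetric] by (intro Sw_balanced[OF f1 cs_add] y)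
next
  fix y z z' assume y: "y \<in> carrier B" "z \<in> carrier B" "z' \<in> carrier B"
  show "Sw (cs y) (\<lambda>cm cp. f cm cp (z \<oplus>\<^bsub>B\<^esub> z')) \<simeq>[G] Sw (cs y) (\<lambda>cm cp. f cm cp z) + Sw (cs y) (\<lambda>cm cp. f cm cp z')"
    unfolding Sw_fadd[symmetric]
    by (rule Sw_cong[OF cs_keys[OF y(1)]], rule balancedD(2)[OF f2]) (use y in auto)
next
  fix y r z assume y: "y \<in> carrier B" "r \<in> carrier R" "z \<in> carrier B"
  have "Sw (cs (bract B y r)) (\<lambda>cm cp. f cm cp z) \<simeq>[G] Sw (Sw (cs y) (\<lambda>cm cp. frag_of (cm, cp \<cdot> e r))) (\<lambda>cm cp. f cm cp z)"
    unfolding bract_eq by (intro Sw_balanced[OF f1 cs_mult_src] y)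
  also have "\<dots> = Sw (cs y) (\<lambda>cm cp. f cm (ra cp r) z)"
    unfolding Sw_Sw Sw_of by (rule Sw_cong_eq[OF cs_keys[OF y(1)]]) (use y in \<open>simp add: ra_e\<close>)
  also have "\<dots> \<simeq>[G] Sw (cs y) (\<lambda>cm cp. f cm cp (blact B r z))"
    by (rule Sw_cong[OF cs_keys[OF y(1)]], rule balancedD(3)[OF f2]) (use y in auto)
  finally show "Sw (cs (bract B y r)) (\<lambda>cm cp. f cm cp z) \<simeq>[G] Sw (cs y) (\<lambda>cm cp. f cm cp (blact B r z))" .
qed

text \<open>The identity \<open>b\<^bsup>{-}\<^esup> \<otimes> \<rho>(b\<^bsup>{+}\<^esup>) = b\<^sub>1\<^bsup>{-}\<^esup> \<otimes> b\<^sub>1\<^bsup>{+}\<^esup> \<otimes> b\<^sub>2\<close>, evaluated under balanced functions \<open>f\<close>.\<close>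

lemma cs_colinear:
  assumes b: "b \<in> carrier B"
    and f1: "\<And>c. c \<in> carrier B \<Longrightarrow> balTS G (\<lambda>x y. f x y c)"
    and f2: "\<And>x. x \<in> carrier T \<Longrightarrow> balTB G (f x)"
  shows "Sw (cs b) (\<lambda>cm cp. Sw (rho cp) (f cm)) \<simeq>[G] Sw (ds b) (\<lambda>b1 b2. Sw (cs b1) (\<lambda>cm cp. f cm cp b2))"
proof -
  \<comment> \<open>\<open>N x c\<close> is x c_1^- \<otimes> c_1^+ \<otimes> c_2 under f. It is
    balanced in x \<otimes> c, so it takes the same value on both sides of can(b^- \<otimes> b^+) =
    1 \<otimes> b; on the left side, coassociativity and \<open>rho_cs\<close> contract it to b^-
    \<otimes> \<rho>(b^+).\<close>
  define g where "g x b1 b2 = Sw (cs b1) (\<lambda>cm cp. f (x \<cdot> cm) cp b2)" for x b1 b2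
  define N where "N x c = Sw (ds c) (g x)" for x c
  have fx: "balTS G (\<lambda>y z. f (x \<cdot> y) z c)" if "x \<in> carrier T" "c \<in> carrier B" for x c
    using bal_shift[OF f1[OF that(2)] that(1)] .
  have g2: "balBB G (g x)" if x: "x \<in> carrier T" for x
    unfolding g_def by (rule bal_cs) (use fx f2 x in auto)
  have g1: "balTB G (\<lambda>x y. g x y z)" if z: "z \<in> carrier B" for z
  proof (rule balancedI)
    fix x x' y assume x: "x \<in> carrier T" "x' \<in> carrier T" "y \<in> carrier B"
    show "g (x \<oplus>\<^bsub>T\<^esub> x') y z \<simeq>[G] g x y z + g x' y z"
      unfolding g_def Sw_fadd[symmetric]
      by (rule Sw_cong[OF cs_keys[OF x(3)]]) (use x z in \<open>simp add: T.l_distr balancedD(1)[OF f1]\<close>)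
  next
    fix x r y assume x: "x \<in> carrier T" "r \<in> carrier R" "y \<in> carrier B"
    have "g x (blact B r y) z \<simeq>[G] Sw (Sw (cs y) (\<lambda>cm cp. frag_of (e r \<cdot> cm, cp))) (\<lambda>cm cp. f (x \<cdot> cm) cp z)"
      unfolding g_def blact_eq by (intro Sw_balanced[OF fx cs_mult_tgt] x z)
    also have "\<dots> = g (ra x r) y z"
      unfolding g_def Sw_Sw Sw_of
      by (rule Sw_cong_eq[OF cs_keys[OF x(3)]]) (use x in \<open>simp add: ra_e T.m_assoc\<close>)
    finally show "g (ra x r) y z \<simeq>[G] g x (blact B r y) z" by (rule eqm_sym)
  qed (rule balancedD[OF g2]; use z in auto)
  have N: "balTB G N"
  proof (rule balancedI)
    fix x x' y assume x: "x \<in> carrier T" "x' \<in> carrier T" "y \<in> carrier B"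
    show "N (x \<oplus>\<^bsub>T\<^esub> x') y \<simeq>[G] N x y + N x' y"
      unfolding N_def Sw_fadd[symmetric]
      by (rule Sw_cong[OF ds_keys[OF x(3)]], rule balancedD(1)[OF g1]) (use x in auto)
  next
    fix x y y' assume x: "x \<in> carrier T" "y \<in> carrier B" "y' \<in> carrier B"
    show "N x (y \<oplus>\<^bsub>B\<^esub> y') \<simeq>[G] N x y + N x y'"
      unfolding N_def Sw_add[symmetric] by (intro Sw_balanced[OF g2 ds_add] x)
  next
    fix x r y assume x: "x \<in> carrier T" "r \<in> carrier R" "y \<in> carrier B"
    have "N x (blact B r y) \<simeq>[G] Sw (Sw (ds y) (\<lambda>b1 b2. frag_of (b1 \<star> \<zeta> r, b2))) (g x)"
      unfolding N_def blact_eq by (intro Sw_balanced[OF g2 ds_tgt] x)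
    also have "\<dots> = Sw (ds y) (\<lambda>b1 b2. g x (blact B r b1) b2)" by (simp add: Sw_Sw blact_eq)
    also have "\<dots> \<simeq>[G] N (ra x r) y"
      unfolding N_def
      by (rule Sw_cong[OF ds_keys[OF x(3)]], rule eqm_sym, rule balancedD(3)[OF g1]) (use x in auto)
    finally show "N (ra x r) y \<simeq>[G] N x (blact B r y)" by (rule eqm_sym)
  qed
  have "Sw (cs b) (\<lambda>cm cp. Sw (rho cp) (f cm)) \<simeq>[G] Sw (cs b) (\<lambda>cm cp. Sw (rho cp) (\<lambda>u0 u1. N (cm \<cdot> u0) u1))"
  proof (rule Sw_cong[OF cs_keys[OF b]])
    fix cm cp assume c: "cm \<in> carrier T" "cp \<in> carrier T"
    have b3: "balanced3 (carrier R) T ra B (blact B) (bract B) B (blact B) G (\<lambda>v0. g (cm \<cdot> v0))"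
      unfolding balanced3_def
    proof (intro conjI ballI)
      fix z assume "z \<in> carrier B"
      from balanced_comp[OF bal_mult_left_T[OF c(1)] g1[OF this]]
      show "balTB G (\<lambda>x y. g (cm \<cdot> x) y z)" by simp
    qed (use g2 c in auto)
    have "Sw (rho cp) (\<lambda>u0 u1. Sw (rho u0) (\<lambda>v0 v1. g (cm \<cdot> v0) v1 u1))
       \<simeq>[G] Sw (rho cp) (\<lambda>u0 u1. N (cm \<cdot> u0) u1)"
      unfolding N_def by (rule rho_coassoc[OF c(2) b3])
    moreover have "Sw (rho cp) (\<lambda>u0 u1. Sw (rho u0) (\<lambda>v0 v1. g (cm \<cdot> v0) v1 u1)) \<simeq>[G] Sw (rho cp) (f cm)"
    proof (rule Sw_cong[OF rho_keys[OF c(2)]])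
      fix u0 u1 assume u: "u0 \<in> carrier T" "u1 \<in> carrier B"
      have "Sw (rho u0) (\<lambda>v0 v1. g (cm \<cdot> v0) v1 u1)
          = Sw (Sw (rho u0) (\<lambda>v0 v1. Sw (cs v1) (\<lambda>dm dp. frag_of (v0 \<cdot> dm, dp)))) (\<lambda>y z. f (cm \<cdot> y) z u1)"
        unfolding g_def Sw_Sw Sw_of
        by (intro Sw_cong_eq[OF rho_keys[OF u(1)]] Sw_cong_eq[OF cs_keys]) (use c in \<open>auto simp: T.m_assoc\<close>)
      also have "\<dots> \<simeq>[G] f cm u0 u1"
        using Sw_balanced[OF fx[OF c(1) u(2)] rho_cs[OF u(1)]] c by simp
      finally show "Sw (rho u0) (\<lambda>v0 v1. g (cm \<cdot> v0) v1 u1) \<simeq>[G] f cm u0 u1" .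
    qed
    ultimately show "Sw (rho cp) (f cm) \<simeq>[G] Sw (rho cp) (\<lambda>u0 u1. N (cm \<cdot> u0) u1)"
      using eqm_sym eqm_trans by blast
  qed
  also have "\<dots> = Sw (CAN (cs b)) N" by (simp add: CAN_def Sw_Sw)
  also have "\<dots> \<simeq>[G] N \<one>\<^bsub>T\<^esub> b" using Sw_balanced[OF N CAN_cs[OF b]] by simp
  also have "\<dots> = Sw (ds b) (\<lambda>b1 b2. Sw (cs b1) (\<lambda>cm cp. f cm cp b2))"
    unfolding N_def g_def by (intro Sw_cong_eq[OF ds_keys[OF b]] Sw_cong_eq[OF cs_keys]) auto
  finally show ?thesis .
qed

text \<open>The coaction of b^+ t b^- is the product of \<rho>(b^+) and \<rho>(t b^-).
  \<open>cs_colinear\<close> replaces \<rho>(b^+) by b_1^+ \<otimes> b_2, and what remains for each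
  pair is \<open>act_coact_half\<close> with d = b_2. The variable z stands for an arbitrary
  representative of \<Delta>(b).\<close>

lemma act_coact:
  assumes b: "b \<in> carrier B" and t: "t \<in> carrier T"
    and z: "keys z \<subseteq> carrier B \<times> carrier B" "ds b \<simeq>[BB] z"
  shows "Sw (cs b) (\<lambda>cm cp. rho (cp \<cdot> t \<cdot> cm)) \<simeq>[CB] Sw z (\<lambda>b1 b2. Sw (rho t) (ydh b2 b1))"
proof -
  let ?f = "\<lambda>x y c. Sw (rho (t \<cdot> x)) (\<lambda>w0 w1. frag_of (y \<cdot> w0, c \<star> w1))"
  have pr: "balTB CB (\<lambda>w0 w1. frag_of (y \<cdot> w0, c \<star> w1))" if "y \<in> carrier T" "c \<in> carrier B" for y c
    by (rule balCB, rule bal_prod_right) (use that in auto)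
  have f2: "balTB CB (?f x)" if "x \<in> carrier T" for x
    using that t by (intro balCB bal_prod_left) auto
  have f1: "balTS CB (\<lambda>x y. ?f x y c)" if c: "c \<in> carrier B" for c
  proof (rule balancedI)
    fix x x' y assume x: "x \<in> carrier T" "x' \<in> carrier T" "y \<in> carrier T"
    show "?f (x \<oplus>\<^bsub>T\<^esub> x') y c \<simeq>[CB] ?f x y c + ?f x' y c"
      unfolding Sw_add[symmetric] T.r_distr[OF x(1,2) t]
      by (intro Sw_balanced[OF pr rho_add]) (use x t c in auto)
  next
    fix x y y' assume x: "x \<in> carrier T" "y \<in> carrier T" "y' \<in> carrier T"
    have k: "keys (rho (t \<cdot> x)) \<subseteq> carrier T \<times> carrier B" by (rule rho_keys) (use x t in auto)
    show "?f x (y \<oplus>\<^bsub>T\<^esub> y') c \<simeq>[CB] ?f x y c + ?f x y' c"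
      unfolding Sw_fadd[symmetric]
      by (rule Sw_cong[OF k], rule CB_mono) (use x c in \<open>simp add: T.l_distr tensor_add_left\<close>)
  next
    fix x s y assume x: "x \<in> carrier T" "s \<in> S" "y \<in> carrier T"
    have k: "keys (rho (t \<cdot> x)) \<subseteq> carrier T \<times> carrier B" by (rule rho_keys) (use x t in auto)
    have "t \<cdot> (x \<cdot> s) = t \<cdot> x \<cdot> s" using x t by (simp add: T.m_assoc)
    then have "?f (x \<cdot> s) y c \<simeq>[CB] Sw (Sw (rho (t \<cdot> x)) (\<lambda>w0 w1. frag_of (w0 \<cdot> s, w1))) (\<lambda>w0 w1. frag_of (y \<cdot> w0, c \<star> w1))"
      by (simp only:) (rule Sw_balanced[OF pr rho_S_right], use x t c in auto)
    also have "\<dots> = Sw (rho (t \<cdot> x)) (\<lambda>w0 w1. frag_of (y \<cdot> w0 \<cdot> s, c \<star> w1))"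
      unfolding Sw_Sw Sw_of by (rule Sw_cong_eq[OF k]) (use x in \<open>simp add: T.m_assoc\<close>)
    \<comment> \<open>The commutator relations of \<open>CB\<close> move s to the front, where it
      joins y.\<close>
    also have "\<dots> \<simeq>[CB] Sw (rho (t \<cdot> x)) (\<lambda>w0 w1. frag_of (s \<cdot> (y \<cdot> w0), c \<star> w1))"
      by (rule Sw_cong[OF k], rule eqm_sym, rule tr_comm[OF tr_CB]) (use x c in auto)
    also have "\<dots> = ?f x (s \<cdot> y) c"
      by (rule Sw_cong_eq[OF k]) (use x in \<open>simp add: T.m_assoc\<close>)
    finally show "?f (x \<cdot> s) y c \<simeq>[CB] ?f x (s \<cdot> y) c" .
  qed
  have "Sw (cs b) (\<lambda>cm cp. rho (cp \<cdot> t \<cdot> cm)) \<simeq>[CB] Sw (cs b) (\<lambda>cm cp. Sw (rho cp) (?f cm))"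
  proof (rule Sw_cong[OF cs_keys[OF b]])
    fix cm cp assume c: "cm \<in> carrier T" "cp \<in> carrier T"
    have "rho (cp \<cdot> (t \<cdot> cm)) \<simeq>[CB] Sw (rho cp) (?f cm)"
      by (rule CB_mono, rule rho_mult) (use c t in auto)
    then show "rho (cp \<cdot> t \<cdot> cm) \<simeq>[CB] Sw (rho cp) (?f cm)" using c t by (simp add: T.m_assoc)
  qed
  also have "\<dots> \<simeq>[CB] Sw (ds b) (\<lambda>b1 b2. Sw (cs b1) (\<lambda>cm cp. ?f cm cp b2))"
    by (rule cs_colinear[OF b f1 f2])
  also have "\<dots> \<simeq>[CB] Sw z (\<lambda>b1 b2. Sw (cs b1) (\<lambda>cm cp. ?f cm cp b2))"
    by (rule Sw_balanced[OF bal_cs[OF f1 f2] z(2)])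
  also have "\<dots> \<simeq>[CB] Sw z (\<lambda>b1 b2. Sw (rho t) (ydh b2 b1))"
    by (intro Sw_cong[OF z(1)] act_coact_half t)
  finally show ?thesis .
qed

end

section \<open>Quotient modules\<close>

locale quotient = module K M + submodule N K M
  for K :: "('k, 'p) ring_scheme" and M :: "('k, 'm, 's) module_scheme" and N :: "'m set"
begin

abbreviation "Q \<equiv> quot_module M N"
abbreviation "q x \<equiv> N +>\<^bsub>M\<^esub> x"

sublocale N: abelian_subgroup N M
  by (rule abelian_subgroupI3)
    (use subgroup_axioms abelian_group_axioms in \<open>auto intro: additive_subgroup.intro\<close>)

lemma carrier_Q: "carrier Q = q ` carrier M"
  by (auto simp: quot_module_def A_RCOSETS_def')

lemma q_closed [simp]: "x \<in> carrier M \<Longrightarrow> q x \<in> carrier Q"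
  by (simp add: carrier_Q)

lemma q_add: "x \<in> carrier M \<Longrightarrow> y \<in> carrier M \<Longrightarrow> q x \<oplus>\<^bsub>Q\<^esub> q y = q (x \<oplus>\<^bsub>M\<^esub> y)"
  by (simp add: quot_module_def N.a_rcos_sum)

lemma q_zero: "\<zero>\<^bsub>Q\<^esub> = q \<zero>\<^bsub>M\<^esub>"
  using N.a_subset by (simp add: quot_module_def)

lemma q_eq_iff: "x \<in> carrier M \<Longrightarrow> y \<in> carrier M \<Longrightarrow> q x = q y \<longleftrightarrow> x \<ominus>\<^bsub>M\<^esub> y \<in> N"
  using N.a_rcos_module[of y x] a_repr_independence[of x N y, OF _ _ subgroup_axioms] N.a_rcos_self[of x]
  by (auto simp: a_minus_def)

text \<open>The definition takes a union over the coset; since \<open>N\<close> is a submodule, all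
  members of the union are the same coset.\<close>

lemma q_smult:
  assumes "k \<in> carrier K" "x \<in> carrier M"
  shows "k \<odot>\<^bsub>Q\<^esub> q x = q (k \<odot>\<^bsub>M\<^esub> x)"
proof -
  have "q (k \<odot>\<^bsub>M\<^esub> y) = q (k \<odot>\<^bsub>M\<^esub> x)" if y: "y \<in> q x" for y
  proof -
    have yM: "y \<in> carrier M" using y assms N.a_rcosets_carrier[of "q x"] q_closed carrier_Q
      by (auto simp: A_RCOSETS_def')
    have "k \<odot>\<^bsub>M\<^esub> (y \<oplus>\<^bsub>M\<^esub> \<ominus>\<^bsub>M\<^esub> x) \<in> N"
      using y yM assms N.a_rcos_module[of x y] by auto
    moreover have "k \<odot>\<^bsub>M\<^esub> (y \<oplus>\<^bsub>M\<^esub> \<ominus>\<^bsub>M\<^esub> x) = k \<odot>\<^bsub>M\<^esub> y \<ominus>\<^bsub>M\<^esub> k \<odot>\<^bsub>M\<^esub> x"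
      using yM assms by (simp add: smult_r_distr smult_r_minus a_minus_def)
    ultimately show ?thesis using q_eq_iff[of "k \<odot>\<^bsub>M\<^esub> y" "k \<odot>\<^bsub>M\<^esub> x"] yM assms by simp
  qed
  then have "(\<Union>y\<in>q x. q (k \<odot>\<^bsub>M\<^esub> y)) = (\<Union>y\<in>q x. q (k \<odot>\<^bsub>M\<^esub> x))" by (rule SUP_cong[OF refl])
  also have "\<dots> = q (k \<odot>\<^bsub>M\<^esub> x)" using N.a_rcos_self[OF assms(2)] by blast
  finally show ?thesis by (simp add: quot_module_def)
qed

lemma module_Q: "module K Q"
proof (rule moduleI)
  show "abelian_group Q"
  proof (rule abelian_groupI)
    fix X assume "X \<in> carrier Q"
    then obtain x where x: "x \<in> carrier M" "X = q x" by (auto simp: carrier_Q)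
    show "\<exists>y\<in>carrier Q. y \<oplus>\<^bsub>Q\<^esub> X = \<zero>\<^bsub>Q\<^esub>"
      by (rule bexI[of _ "q (\<ominus>\<^bsub>M\<^esub> x)"]) (use x in \<open>simp_all add: q_add q_zero l_neg\<close>)
  qed (auto simp: carrier_Q q_add q_zero a_ac)
qed (use R.is_cring in \<open>auto simp: carrier_Q q_add q_smult smult_l_distr smult_r_distr smult_assoc1\<close>)

end

section \<open>The quotient T/[S,T] and its canonical projection\<close>

context galois
begin

sublocale KR: module K R
  using right_mod_X by (simp add: right_mod_def assoc_algebra_def)

sublocale KT: module K T
  using algebra_T by (simp add: assoc_algebra_def)

lemma smult_mult_left: "k \<in> carrier K \<Longrightarrow> x \<in> carrier T \<Longrightarrow> y \<in> carrier T \<Longrightarrow>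
    k \<odot>\<^bsub>T\<^esub> (x \<cdot> y) = (k \<odot>\<^bsub>T\<^esub> x) \<cdot> y"
  using assoc_algebra.smult_mult_left[OF algebra_T] .

lemma smult_mult_right: "k \<in> carrier K \<Longrightarrow> x \<in> carrier T \<Longrightarrow> y \<in> carrier T \<Longrightarrow>
    k \<odot>\<^bsub>T\<^esub> (x \<cdot> y) = x \<cdot> (k \<odot>\<^bsub>T\<^esub> y)"
  using assoc_algebra.smult_mult_right[OF algebra_T] .

abbreviation "C \<equiv> commutators K S T"
abbreviation "gens \<equiv> {s \<cdot> t \<ominus>\<^bsub>T\<^esub> t \<cdot> s | s t. s \<in> S \<and> t \<in> carrier T}"

lemma submodule_C: "submodule C K T"
proof -
  have sub: "submodule (\<Inter>\<N>) K T" if "\<N> \<noteq> {}" "\<forall>N\<in>\<N>. submodule N K T" for \<N>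
  proof (rule KT.submoduleI)
    show "\<Inter>\<N> \<subseteq> carrier T" using that KT.submoduleE(1) by blast
    show "\<zero>\<^bsub>T\<^esub> \<in> \<Inter>\<N>"
      using that subgroup.one_closed[OF submodule.axioms(1)] by fastforce
  next
    fix a assume "a \<in> \<Inter>\<N>"
    then show "\<ominus>\<^bsub>T\<^esub> a \<in> \<Inter>\<N>" using that(2) KT.submoduleE(3) by (meson InterE InterI)
  next
    fix a b assume "a \<in> \<Inter>\<N>" "b \<in> \<Inter>\<N>"
    then show "a \<oplus>\<^bsub>T\<^esub> b \<in> \<Inter>\<N>" using that(2) KT.submoduleE(5) by (meson InterE InterI)
  next
    fix k x assume "k \<in> carrier K" "x \<in> \<Inter>\<N>"
    then show "k \<odot>\<^bsub>T\<^esub> x \<in> \<Inter>\<N>" using that(2) KT.submoduleE(4) by (meson InterE InterI)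
  qed
  show ?thesis unfolding commutators_def gen_submodule_def
    by (rule sub) (use KT.carrier_is_submodule in auto)
qed

sublocale q: quotient K T C
  by (rule quotient.intro[OF KT.module_axioms submodule_C])

abbreviation "Q \<equiv> comm_quot K S T"
abbreviation "p \<equiv> comm_proj K S T"

lemma Q_eq: "Q = q.Q" and p_eq: "p t = q.q t"
  by (simp_all add: comm_quot_def comm_proj_def)

lemma carrier_Q: "carrier Q = p ` carrier T"
  unfolding Q_eq q.carrier_Q by (auto simp: p_eq)

lemma p_closed [simp]: "x \<in> carrier T \<Longrightarrow> p x \<in> carrier Q"
  and p_add: "x \<in> carrier T \<Longrightarrow> y \<in> carrier T \<Longrightarrow> p x \<oplus>\<^bsub>Q\<^esub> p y = p (x \<oplus>\<^bsub>T\<^esub> y)"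
  and p_smult: "k \<in> carrier K \<Longrightarrow> x \<in> carrier T \<Longrightarrow> k \<odot>\<^bsub>Q\<^esub> p x = p (k \<odot>\<^bsub>T\<^esub> x)"
  unfolding Q_eq p_eq by (simp_all add: q.q_add q.q_smult)

sublocale KQ: module K Q
  unfolding Q_eq by (rule q.module_Q)

lemma tr_CT: "tr CT frag_of"
  unfolding tr_def
proof (intro conjI ballI)
  fix x y assume "x \<in> carrier T" "y \<in> carrier T"
  then have "frag_of (x \<oplus>\<^bsub>T\<^esub> y) \<simeq>[add_rels T] frag_of x + frag_of y" by (rule add_rels_base)
  then show "frag_of (x \<oplus>\<^bsub>T\<^esub> y) \<simeq>[CT] frag_of x + frag_of y" by (rule eqm_mono) (simp add: CT_def)
qed (rule eqm_base, auto simp: CT_def)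

lemma tr_extend:
  assumes f: "tr G f" and "z \<simeq>[CT] w"
  shows "frag_extend f z \<simeq>[G] frag_extend f w"
proof (rule eqm_extend[OF _ assms(2)])
  fix n assume "n \<in> CT"
  then show "frag_extend f n \<simeq>[G] 0"
    unfolding CT_def add_rels_def
  proof (elim UnE CollectE exE conjE)
    fix s t assume "n = frag_of (s \<cdot> t) - frag_of (t \<cdot> s)" "s \<in> S" "t \<in> carrier T"
    then show ?thesis using tr_comm[OF f, of s t] by (simp add: frag_extend_diff eqm_def)
  qed (simp_all only: frag_extend_diff frag_extend_of eqm_iff_diff_add tr_add[OF f])
qed

lemma tr_zero: "tr G f \<Longrightarrow> f \<zero>\<^bsub>T\<^esub> \<simeq>[G] 0"
  using tr_add[of G f "\<zero>\<^bsub>T\<^esub>" "\<zero>\<^bsub>T\<^esub>"] by (intro eqm_zero_of_double) simp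

lemma tr_minus:
  assumes "tr G f" "x \<in> carrier T" "y \<in> carrier T"
  shows "f (x \<ominus>\<^bsub>T\<^esub> y) \<simeq>[G] f x - f y"
proof -
  have "f x = f ((x \<ominus>\<^bsub>T\<^esub> y) \<oplus>\<^bsub>T\<^esub> y)" using assms by (simp add: a_minus_def X.a_assoc X.l_neg)
  also have "\<dots> \<simeq>[G] f (x \<ominus>\<^bsub>T\<^esub> y) + f y" by (rule tr_add[OF assms(1)]) (use assms in auto)
  finally have "f x \<simeq>[G] f (x \<ominus>\<^bsub>T\<^esub> y) + f y" .
  from eqm_sym[OF this] show ?thesis by (simp add: eqm_def algebra_simps)
qed

text \<open>[S,T] is generated as a K-submodule, whereas \<open>CT\<close> generates an additive
  subgroup. The gap closes because k(st - ts) = s(kt) - (kt)s, so the elements vanishing modulo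
  \<open>CT\<close> are closed under scalars.\<close>

lemma C_null: "x \<in> C \<Longrightarrow> frag_of x \<simeq>[CT] 0"
proof -
  let ?N = "{x \<in> carrier T. frag_of x \<simeq>[CT] 0}"
  have "submodule ?N K T"
  proof (rule KT.submoduleI)
    show "\<zero>\<^bsub>T\<^esub> \<in> ?N" using tr_zero[OF tr_CT] by simp
  next
    fix a assume a: "a \<in> ?N"
    have "frag_of (\<zero>\<^bsub>T\<^esub> \<ominus>\<^bsub>T\<^esub> a) \<simeq>[CT] frag_of \<zero>\<^bsub>T\<^esub> - frag_of a" by (rule tr_minus[OF tr_CT]) (use a in auto)
    also have "\<dots> \<simeq>[CT] 0 - 0" by (rule eqm_diff) (use a tr_zero[OF tr_CT] in auto)
    finally show "\<ominus>\<^bsub>T\<^esub> a \<in> ?N" using a by (simp add: a_minus_def)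
  next
    fix a b assume a: "a \<in> ?N" "b \<in> ?N"
    have "frag_of (a \<oplus>\<^bsub>T\<^esub> b) \<simeq>[CT] frag_of a + frag_of b" by (rule tr_add[OF tr_CT]) (use a in auto)
    also have "\<dots> \<simeq>[CT] 0 + 0" by (rule eqm_add) (use a in auto)
    finally show "a \<oplus>\<^bsub>T\<^esub> b \<in> ?N" using a by simp
  next
    fix k x assume k: "k \<in> carrier K" "x \<in> ?N"
    have "tr CT (\<lambda>x. frag_of (k \<odot>\<^bsub>T\<^esub> x))"
      unfolding tr_def using k
      by (auto simp: KT.smult_r_distr smult_mult_right smult_mult_left tr_add[OF tr_CT])
        (metis S_closed smult_mult_left smult_mult_right KT.smult_closed tr_comm[OF tr_CT])
    from tr_extend[OF this, of "frag_of x" 0] k show "k \<odot>\<^bsub>T\<^esub> x \<in> ?N" by simp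
  qed auto
  moreover have "gens \<subseteq> ?N"
  proof (clarify, intro conjI)
    fix s t assume s: "s \<in> S" "t \<in> carrier T"
    have "frag_of (s \<cdot> t \<ominus>\<^bsub>T\<^esub> t \<cdot> s) \<simeq>[CT] frag_of (s \<cdot> t) - frag_of (t \<cdot> s)"
      by (rule tr_minus[OF tr_CT]) (use s in auto)
    also have "\<dots> \<simeq>[CT] 0" using tr_comm[OF tr_CT s] by (simp add: eqm_def)
    finally show "frag_of (s \<cdot> t \<ominus>\<^bsub>T\<^esub> t \<cdot> s) \<simeq>[CT] 0" .
    show "s \<cdot> t \<ominus>\<^bsub>T\<^esub> t \<cdot> s \<in> carrier T" using s by auto
  qed
  ultimately show "x \<in> C \<Longrightarrow> frag_of x \<simeq>[CT] 0"
    unfolding commutators_def gen_submodule_def by blast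
qed

lemma tr_p: "tr (add_rels Q) (\<lambda>t. frag_of (p t))"
  unfolding tr_def
proof (intro conjI ballI)
  fix x y assume "x \<in> carrier T" "y \<in> carrier T"
  then show "frag_of (p (x \<oplus>\<^bsub>T\<^esub> y)) \<simeq>[add_rels Q] frag_of (p x) + frag_of (p y)"
    using add_rels_base[of "p x" Q "p y"] by (simp add: p_add)
next
  fix s x assume s: "s \<in> S" "x \<in> carrier T"
  have "s \<cdot> x \<ominus>\<^bsub>T\<^esub> x \<cdot> s \<in> C"
    unfolding commutators_def gen_submodule_def using s by blast
  then have "p (s \<cdot> x) = p (x \<cdot> s)" unfolding p_eq using s by (simp add: q.q_eq_iff)
  then show "frag_of (p (s \<cdot> x)) \<simeq>[add_rels Q] frag_of (p (x \<cdot> s))" by simp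
qed

lemma p_eq_iff:
  assumes "x \<in> carrier T" "y \<in> carrier T"
  shows "p x = p y \<longleftrightarrow> frag_of x \<simeq>[CT] frag_of y"
proof
  assume "p x = p y"
  then have "x \<ominus>\<^bsub>T\<^esub> y \<in> C" unfolding p_eq using assms by (simp add: q.q_eq_iff)
  from eqm_trans[OF eqm_sym[OF tr_minus[OF tr_CT assms]] C_null[OF this]]
  show "frag_of x \<simeq>[CT] frag_of y" by (simp add: eqm_def)
next
  assume "frag_of x \<simeq>[CT] frag_of y"
  from tr_extend[OF tr_p this] show "p x = p y"
    by (intro frag_eqm_imp_eq[OF KQ.abelian_group_axioms]) (use assms in auto)
qed

lemma tr_cong: "tr G f \<Longrightarrow> x \<in> carrier T \<Longrightarrow> y \<in> carrier T \<Longrightarrow> p x = p y \<Longrightarrow> f x \<simeq>[G] f y"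
  using tr_extend[of G f "frag_of x" "frag_of y"] p_eq_iff by simp

section \<open>The module, comodule and action structures on the quotient\<close>

text \<open>A section of p as a map of sets. The structure maps on the quotient are defined through
  it and then shown, by functions satisfying \<open>tr\<close>, not to depend on it.\<close>

definition "rp X = (SOME t. t \<in> carrier T \<and> p t = X)"

lemma rp: "X \<in> carrier Q \<Longrightarrow> rp X \<in> carrier T" "X \<in> carrier Q \<Longrightarrow> p (rp X) = X"
proof -
  assume "X \<in> carrier Q"
  then have "\<exists>t. t \<in> carrier T \<and> p t = X" by (auto simp: carrier_Q)
  from someI_ex[OF this] show "rp X \<in> carrier T" "p (rp X) = X" by (simp_all add: rp_def)
qed

definition "ra' X r = p (ra (rp X) r)"

text \<open>Right multiplication by \<open>e r\<close> preserves [S,T] because \<open>e r\<close>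
  commutes with S.\<close>

lemma ra'_p: "t \<in> carrier T \<Longrightarrow> r \<in> carrier R \<Longrightarrow> ra' (p t) r = p (ra t r)"
proof -
  assume t: "t \<in> carrier T" "r \<in> carrier R"
  have "tr (add_rels Q) (\<lambda>t. frag_of (p (t \<cdot> e r)))"
    unfolding tr_def
  proof (intro conjI ballI)
    fix x y assume "x \<in> carrier T" "y \<in> carrier T"
    then show "frag_of (p ((x \<oplus>\<^bsub>T\<^esub> y) \<cdot> e r)) \<simeq>[add_rels Q] frag_of (p (x \<cdot> e r)) + frag_of (p (y \<cdot> e r))"
      using tr_add[OF tr_p] t by (simp add: T.l_distr)
  next
    fix s x assume s: "s \<in> S" "x \<in> carrier T"
    have "frag_of (p (s \<cdot> (x \<cdot> e r))) \<simeq>[add_rels Q] frag_of (p (x \<cdot> e r \<cdot> s))"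
      by (rule tr_comm[OF tr_p]) (use s t in auto)
    then show "frag_of (p (s \<cdot> x \<cdot> e r)) \<simeq>[add_rels Q] frag_of (p (x \<cdot> s \<cdot> e r))"
      using s t by (simp add: T.m_assoc e_S_comm)
  qed
  from tr_cong[OF this, of "rp (p t)" t] have "p (rp (p t) \<cdot> e r) = p (t \<cdot> e r)"
    using t by (intro frag_eqm_imp_eq[OF KQ.abelian_group_axioms]) (auto simp: rp)
  then show ?thesis using t by (simp add: ra'_def ra_e rp)
qed

abbreviation "QB \<equiv> tensor_rels (carrier R) Q ra' B (blact B)"

lemma right_mod_Q: "right_mod K R Q ra'"
proof -
  have "assoc_algebra K R" using right_mod_X by (simp add: right_mod_def)
  then show ?thesis
    by (intro right_mod.intro KQ.module_axioms right_mod_axioms.intro)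
      (auto simp: carrier_Q ra'_p p_add ra_add_left ra_add_right ra_assoc p_smult
        right_mod.ra_smult[OF right_mod_X])
qed

sublocale QBt: tensor_data "carrier R" Q ra' B "blact B"
  by unfold_locales (auto simp: blact_eq right_mod.ra_closed[OF right_mod_Q])

abbreviation "balQB \<equiv> balanced (carrier R) Q ra' B (blact B)"

lemma QB_mid: "x \<in> carrier Q \<Longrightarrow> r \<in> carrier R \<Longrightarrow> b \<in> carrier B \<Longrightarrow>
    frag_of (ra' x r, b) \<simeq>[QB] frag_of (x, b \<star> \<zeta> r)"
  using tensor_mid[of x Q r "carrier R" b B ra' "blact B"] by (simp add: blact_eq)

definition "push z = Sw z (\<lambda>t b. frag_of (p t, b))"

lemma push_Sw: "push (Sw z f) = Sw z (\<lambda>x y. push (f x y))"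
  by (simp add: push_def Sw_Sw)

lemma push_of [simp]: "push (frag_of (t, b)) = frag_of (p t, b)"
  by (simp add: push_def)

lemma bal_push: "balTB QB (\<lambda>t b. frag_of (p t, b))"
  by (rule balancedI) (simp_all add: p_add[symmetric] tensor_add_left tensor_add_right ra'_p[symmetric] QB_mid blact_eq)

lemma push_cong: "z \<simeq>[CB] w \<Longrightarrow> push z \<simeq>[QB] push w"
  unfolding push_def Sw_def
proof (erule eqm_extend[rotated])
  fix n assume "n \<in> CB"
  then show "frag_extend (\<lambda>(t, b). frag_of (p t, b)) n \<simeq>[QB] 0"
    unfolding CB_def
  proof (elim UnE CollectE exE conjE)
    assume "n \<in> TB"
    then have "n \<simeq>[TB] 0" by (intro eqm_base) simp
    from Sw_balanced[OF bal_push this] show ?thesis by (simp add: Sw_def)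
  next
    fix s t b assume n: "n = frag_of (s \<cdot> t, b) - frag_of (t \<cdot> s, b)" "s \<in> S" "t \<in> carrier T"
    have "p (s \<cdot> t) = p (t \<cdot> s)"
      using n tr_comm[OF tr_CT] by (subst p_eq_iff) auto
    then show ?thesis using n by (simp add: frag_extend_diff)
  qed
qed

text \<open>\<rho> is S-linear on both sides, and modulo \<open>CB\<close> an element of S may
  change sides in the T-leg; hence the coaction descends.\<close>

lemma tr_rho: "tr CB rho"
  unfolding tr_def
proof (intro conjI ballI)
  fix s x assume s: "s \<in> S" "x \<in> carrier T"
  have "rho (s \<cdot> x) \<simeq>[CB] Sw (rho x) (\<lambda>y0 y1. frag_of (s \<cdot> y0, y1))" by (intro CB_mono rho_S_left s)
  also have "\<dots> \<simeq>[CB] Sw (rho x) (\<lambda>y0 y1. frag_of (y0 \<cdot> s, y1))"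
    by (rule Sw_cong[OF rho_keys[OF s(2)]], rule tr_comm[OF tr_CB]) (use s in auto)
  also have "\<dots> \<simeq>[CB] rho (x \<cdot> s)" by (rule eqm_sym) (intro CB_mono rho_S_right s)
  finally show "rho (s \<cdot> x) \<simeq>[CB] rho (x \<cdot> s)" .
qed (intro CB_mono rho_add)

definition "rhoQ X = push (rho (rp X))"
definition "\<rho>' X = QBt.ts [(p t0, t1). (t0, t1) \<leftarrow> rl (rp X)]"

lemma rhoQ_p: "t \<in> carrier T \<Longrightarrow> rhoQ (p t) \<simeq>[QB] push (rho t)"
  unfolding rhoQ_def by (rule push_cong, rule tr_cong[OF tr_rho]) (auto simp: rp)

lemma keys_push: "keys z \<subseteq> carrier T \<times> carrier B \<Longrightarrow> keys (push z) \<subseteq> carrier Q \<times> carrier B"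
  unfolding push_def by (rule keys_Sw_frag) auto

lemma rhoQ_keys: "X \<in> carrier Q \<Longrightarrow> keys (rhoQ X) \<subseteq> carrier Q \<times> carrier B"
  unfolding rhoQ_def by (intro keys_push rho_keys rp)

lemma rlQ_lists: "us \<in> lists (carrier T \<times> carrier B) \<Longrightarrow> [(p t0, t1). (t0, t1) \<leftarrow> us] \<in> lists (carrier Q \<times> carrier B)"
  by (rule map_lists) auto

text \<open>From here on a representative of the coaction on the quotient is any list congruent to
  \<open>rhoQ X\<close>, which brings the axioms back to the calculus of congruences.\<close>

lemma \<rho>'_treps:
  assumes "X \<in> carrier Q"
  shows "us \<in> trepsB R B Q ra' (\<rho>' X) \<longleftrightarrow> us \<in> lists (carrier Q \<times> carrier B) \<and> fl us \<simeq>[QB] rhoQ X"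
  using QBt.tsum_eq_iff[OF _ rlQ_lists[OF rl_lists[OF rp(1)[OF assms]]], of us]
  by (auto simp: treps_def \<rho>'_def rhoQ_def push_def fl_map rho_def)

lemma \<rho>'_eqI: "X \<in> carrier Q \<Longrightarrow> us \<in> lists (carrier Q \<times> carrier B) \<Longrightarrow> rhoQ X \<simeq>[QB] fl us \<Longrightarrow> \<rho>' X = QBt.ts us"
  using \<rho>'_treps[of X us] eqm_sym by (auto simp: treps_def)

lemma \<rho>'_p:
  assumes "t \<in> carrier T" "us \<in> trepsB R B T ra (\<rho> t)"
  shows "\<rho>' (p t) = QBt.ts [(p t0, t1). (t0, t1) \<leftarrow> us]"
proof (rule \<rho>'_eqI[OF p_closed[OF assms(1)] rlQ_lists[OF treps_lists[OF assms(2)]]])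
  have "rhoQ (p t) \<simeq>[QB] push (rho t)" by (rule rhoQ_p[OF assms(1)])
  also have "\<dots> \<simeq>[QB] push (fl us)" by (rule push_cong[OF CB_mono[OF eqm_sym[OF rho_rep[OF assms]]]])
  finally show "rhoQ (p t) \<simeq>[QB] fl [(p t0, t1). (t0, t1) \<leftarrow> us]" by (simp add: push_def fl_map)
qed

definition "ac us t = lsum T [cp \<cdot> t \<cdot> cm. (cm, cp) \<leftarrow> us]"
definition "act b X = p (ac (cl b) (rp X))"

lemma ac_closed:
  assumes "us \<in> lists (carrier T \<times> carrier T)" "t \<in> carrier T"
  shows "ac us t \<in> carrier T"
proof -
  have "[cp \<cdot> t \<cdot> cm. (cm, cp) \<leftarrow> us] \<in> lists (carrier T)" by (rule map_lists[OF assms(1)]) (use assms in auto)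
  then show ?thesis unfolding ac_def by (intro lsum_closed X.abelian_group_axioms) auto
qed

text \<open>\<open>ac us t\<close> is an element of T that depends on \<open>us\<close>; under a
  function satisfying \<open>tr\<close> it becomes \<open>act1\<close>, which does not mention
  \<open>us\<close>. Additivity distributes f over the sum, and \<open>bal_tr\<close> exchanges the
  representatives.\<close>

lemma tr_ac:
  assumes f: "tr G f" and b: "b \<in> carrier B" and us: "us \<in> trepsS S T (can_transl R B S T ra \<rho> b)" and t: "t \<in> carrier T"
  shows "f (ac us t) \<simeq>[G] act1 b f t"
proof -
  have l: "[cp \<cdot> t \<cdot> cm. (cm, cp) \<leftarrow> us] \<in> lists (carrier T)"
    by (rule map_lists[OF treps_lists[OF us]]) (use t in auto)
  have "frag_of (ac us t) \<simeq>[CT] fl [cp \<cdot> t \<cdot> cm. (cm, cp) \<leftarrow> us]"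
    unfolding ac_def by (rule eqm_mono[OF frag_lsum[OF X.abelian_group_axioms l]]) (simp add: CT_def)
  from tr_extend[OF f this] have "f (ac us t) \<simeq>[G] Sw (fl us) (\<lambda>cm cp. f (cp \<cdot> t \<cdot> cm))"
    by (simp add: fl_map extend_Sw)
  also have "\<dots> \<simeq>[G] act1 b f t"
    unfolding act1_def by (rule Sw_balanced[OF bal_tr[OF f t] cs_rep[OF b us]])
  finally show ?thesis .
qed

lemma act_p:
  assumes "b \<in> carrier B" "us \<in> trepsS S T (can_transl R B S T ra \<rho> b)" "t \<in> carrier T"
  shows "act b (p t) = p (ac us t)"
proof -
  have r: "rp (p t) \<in> carrier T" "p (rp (p t)) = p t" using rp assms by auto
  have c: "ac (cl b) (rp (p t)) \<in> carrier T" "ac us t \<in> carrier T"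
    by (rule ac_closed[OF treps_lists[OF cl[OF assms(1)]] r(1)], rule ac_closed[OF treps_lists[OF assms(2)] assms(3)])
  have "frag_of (ac (cl b) (rp (p t))) \<simeq>[CT] act1 b frag_of (rp (p t))"
    by (rule tr_ac[OF tr_CT assms(1) cl[OF assms(1)] r(1)])
  also have "\<dots> \<simeq>[CT] act1 b frag_of t" by (rule tr_cong[OF tr_act1[OF tr_CT assms(1)] r(1) assms(3) r(2)])
  also have "\<dots> \<simeq>[CT] frag_of (ac us t)" by (rule eqm_sym[OF tr_ac[OF tr_CT assms]])
  finally show ?thesis unfolding act_def using p_eq_iff[OF c] by simp
qed

lemma act_eqI:
  assumes "b \<in> carrier B" "t \<in> carrier T" "u \<in> carrier T" "act1 b frag_of t \<simeq>[CT] frag_of u"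
  shows "act b (p t) = p u"
proof -
  have "frag_of (ac (cl b) t) \<simeq>[CT] frag_of u"
    using eqm_trans[OF tr_ac[OF tr_CT assms(1) cl[OF assms(1)] assms(2)] assms(4)] .
  then show ?thesis
    using act_p[OF assms(1) cl[OF assms(1)] assms(2)]
      p_eq_iff[OF ac_closed[OF treps_lists[OF cl[OF assms(1)]] assms(2)] assms(3)] by simp
qed

definition "acb b t = ac (cl b) t"

lemma acb_closed [simp]: "b \<in> carrier B \<Longrightarrow> t \<in> carrier T \<Longrightarrow> acb b t \<in> carrier T"
  unfolding acb_def by (rule ac_closed[OF treps_lists[OF cl]])

lemma act_acb: "b \<in> carrier B \<Longrightarrow> t \<in> carrier T \<Longrightarrow> act b (p t) = p (acb b t)"
  unfolding acb_def using act_p cl by blast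

lemma tr_acb: "tr G f \<Longrightarrow> b \<in> carrier B \<Longrightarrow> t \<in> carrier T \<Longrightarrow> f (acb b t) \<simeq>[G] act1 b f t"
  unfolding acb_def using tr_ac cl by blast

end

lemma balanced3_frag:
  "balanced3 A M ra N la ra' P la' (tensor3_rels A M ra N la ra' P la') (\<lambda>x y z. frag_of (x, y, z))"
  unfolding balanced3_def
  by (intro conjI ballI balancedI;
      (rule eqm_base_add | rule eqm_base); unfold tensor3_rels_def; blast)

section \<open>The comodule structure on T/[S,T]\<close>

context galois
begin

lemma QB_midI: "u = ra' x r \<Longrightarrow> c = b \<star> \<zeta> r \<Longrightarrow> x \<in> carrier Q \<Longrightarrow> r \<in> carrier R \<Longrightarrow> b \<in> carrier B \<Longrightarrow>
    frag_of (u, b) \<simeq>[QB] frag_of (x, c)"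
  using QB_mid by simp

lemma rhoQ_add:
  assumes "X \<in> carrier Q" "Y \<in> carrier Q"
  shows "rhoQ (X \<oplus>\<^bsub>Q\<^esub> Y) \<simeq>[QB] rhoQ X + rhoQ Y"
proof -
  note r = rp[OF assms(1)] rp[OF assms(2)]
  have "rhoQ (X \<oplus>\<^bsub>Q\<^esub> Y) = rhoQ (p (rp X \<oplus>\<^bsub>T\<^esub> rp Y))" using r by (simp add: p_add[symmetric])
  also have "\<dots> \<simeq>[QB] push (rho (rp X \<oplus>\<^bsub>T\<^esub> rp Y))" by (rule rhoQ_p) (use r in auto)
  also have "\<dots> \<simeq>[QB] push (rho (rp X) + rho (rp Y))" by (intro push_cong CB_mono rho_add r)
  finally show ?thesis by (simp add: rhoQ_def push_def Sw_add)
qed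

lemma rhoQ_ra:
  assumes "X \<in> carrier Q" "r \<in> carrier R"
  shows "rhoQ (ra' X r) \<simeq>[QB] Sw (rhoQ X) (\<lambda>x0 x1. frag_of (x0, x1 \<star> \<xi> r))"
proof -
  note x = rp[OF assms(1)]
  have "rhoQ (ra' X r) \<simeq>[QB] push (rho (ra (rp X) r))"
    unfolding ra'_def[of X] by (rule rhoQ_p) (use x assms in auto)
  also have "\<dots> \<simeq>[QB] push (Sw (rho (rp X)) (\<lambda>x0 x1. frag_of (x0, x1 \<star> \<xi> r)))"
    by (intro push_cong CB_mono rho_ra x assms)
  finally show ?thesis by (simp add: rhoQ_def push_def Sw_Sw)
qed

lemma right_comodule_Q: "right_comodule K R B Q ra' \<rho>'"
proof (intro right_comodule.intro right_comodule_axioms.intro bialg right_mod_Q)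
  show "\<rho>' \<in> hom (add_monoid Q) QBt.TP"
  proof (rule homI)
    fix X assume "X \<in> carrier (add_monoid Q)"
    then show "\<rho>' X \<in> carrier QBt.TP"
      unfolding \<rho>'_def by (intro QBt.tsum_closed rlQ_lists rl_lists) (simp add: rp)
  next
    fix X Y assume "X \<in> carrier (add_monoid Q)" "Y \<in> carrier (add_monoid Q)"
    then have X: "X \<in> carrier Q" "Y \<in> carrier Q" by auto
    let ?l = "\<lambda>X. [(p t0, t1). (t0, t1) \<leftarrow> rl (rp X)]"
    have l: "?l X \<in> lists (carrier Q \<times> carrier B)" "?l Y \<in> lists (carrier Q \<times> carrier B)"
      by (rule rlQ_lists[OF rl_lists[OF rp(1)]], rule X)+
    have "\<rho>' (X \<oplus>\<^bsub>Q\<^esub> Y) = QBt.ts (?l X @ ?l Y)"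
    proof (rule \<rho>'_eqI)
      show "rhoQ (X \<oplus>\<^bsub>Q\<^esub> Y) \<simeq>[QB] fl (?l X @ ?l Y)"
        using rhoQ_add[OF X] by (simp add: fl_append fl_map rhoQ_def push_def rho_def)
    qed (use X l in simp_all)
    then show "\<rho>' (X \<otimes>\<^bsub>add_monoid Q\<^esub> Y) = \<rho>' X \<otimes>\<^bsub>QBt.TP\<^esub> \<rho>' Y"
      unfolding \<rho>'_def[of X] \<rho>'_def[of Y] QBt.tsum_append[OF l] by simp
  qed
next
  fix r X us assume a: "r \<in> carrier R" "X \<in> carrier Q" "us \<in> trepsB R B Q ra' (\<rho>' X)"
  have us: "us \<in> lists (carrier Q \<times> carrier B)" "fl us \<simeq>[QB] rhoQ X" using \<rho>'_treps[OF a(2)] a(3) by auto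
  show "\<rho>' (ra' X r) = QBt.ts [(x0, bract B x1 r). (x0, x1) \<leftarrow> us]"
  proof (rule \<rho>'_eqI)
    show "ra' X r \<in> carrier Q" by (rule QBt.ra_clo[OF a(2,1)])
    show "[(x0, bract B x1 r). (x0, x1) \<leftarrow> us] \<in> lists (carrier Q \<times> carrier B)"
      by (rule map_lists[OF us(1)]) (use a in \<open>auto simp: bract_eq\<close>)
    have bal: "balQB QB (\<lambda>x0 x1. frag_of (x0, x1 \<star> \<xi> r))"
      by (rule balancedI, simp_all add: a B.l_distr tensor_add_left tensor_add_right, rule QB_midI)
        (use a in \<open>auto simp: blact_eq B.m_assoc src_tgt_comm\<close>)
    have "rhoQ (ra' X r) \<simeq>[QB] Sw (rhoQ X) (\<lambda>x0 x1. frag_of (x0, x1 \<star> \<xi> r))" by (rule rhoQ_ra[OF a(2,1)])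
    also have "\<dots> \<simeq>[QB] Sw (fl us) (\<lambda>x0 x1. frag_of (x0, x1 \<star> \<xi> r))" by (rule Sw_balanced[OF bal eqm_sym[OF us(2)]])
    finally show "rhoQ (ra' X r) \<simeq>[QB] fl [(x0, bract B x1 r). (x0, x1) \<leftarrow> us]" by (simp add: fl_map bract_eq)
  qed
next
  fix X us rs ds'
  assume X: "X \<in> carrier Q" and us': "us \<in> trepsB R B Q ra' (\<rho>' X)"
    and rs: "rs \<in> (\<Pi> y\<in>carrier Q. trepsB R B Q ra' (\<rho>' y))"
    and ds': "ds' \<in> (\<Pi> d\<in>carrier B. trepsB R B B (bract B) (comult B d))"
  define T3 where "T3 = tensor3_rels (carrier R) Q ra' B (blact B) (bract B) B (blact B)"
  have us: "us \<in> lists (carrier Q \<times> carrier B)" "fl us \<simeq>[QB] rhoQ X" using \<rho>'_treps[OF X] us' by auto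
  have rs: "rs y \<in> lists (carrier Q \<times> carrier B)" "fl (rs y) \<simeq>[QB] rhoQ y" if "y \<in> carrier Q" for y
    using \<rho>'_treps[OF that] rs that by auto
  have ds': "ds' d \<in> lists (carrier B \<times> carrier B)" "ds d \<simeq>[BB] fl (ds' d)" if "d \<in> carrier B" for d
    using ds' that ds_rep[OF that] treps_lists eqm_sym by blast+
  have b3: "balanced3 (carrier R) Q ra' B (blact B) (bract B) B (blact B) T3 (\<lambda>x y z. frag_of (x, y, z))"
    unfolding T3_def by (rule balanced3_frag)
  have b1: "balQB T3 (\<lambda>x y. frag_of (x, y, z))" if "z \<in> carrier B" for z
    using b3 that by (simp add: balanced3_def)
  have b2: "balBB T3 (\<lambda>y z. frag_of (x, y, z))" if "x \<in> carrier Q" for x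
    using b3 that by (simp add: balanced3_def)
  \<comment> \<open>\<open>L\<close> and \<open>D\<close> show that both iterated coactions depend
    only on the tensor \<open>rhoQ X\<close>. The given list can thus be exchanged for the image
    under p of the coaction on \<open>rp X\<close>, where coassociativity in T applies.\<close>
  have L: "balQB T3 (\<lambda>x0 x1. Sw (rhoQ x0) (\<lambda>y0 y1. frag_of (y0, y1, x1)))"
  proof (rule balancedI)
    fix x x' y assume x: "x \<in> carrier Q" "x' \<in> carrier Q" "y \<in> carrier B"
    show "Sw (rhoQ (x \<oplus>\<^bsub>Q\<^esub> x')) (\<lambda>y0 y1. frag_of (y0, y1, y))
        \<simeq>[T3] Sw (rhoQ x) (\<lambda>y0 y1. frag_of (y0, y1, y)) + Sw (rhoQ x') (\<lambda>y0 y1. frag_of (y0, y1, y))"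
      unfolding Sw_add[symmetric] by (intro Sw_balanced[OF b1 rhoQ_add] x)
  next
    fix x y y' assume x: "x \<in> carrier Q" "y \<in> carrier B" "y' \<in> carrier B"
    show "Sw (rhoQ x) (\<lambda>y0 y1. frag_of (y0, y1, y \<oplus>\<^bsub>B\<^esub> y'))
        \<simeq>[T3] Sw (rhoQ x) (\<lambda>y0 y1. frag_of (y0, y1, y)) + Sw (rhoQ x) (\<lambda>y0 y1. frag_of (y0, y1, y'))"
      unfolding Sw_fadd[symmetric]
      by (rule Sw_cong[OF rhoQ_keys[OF x(1)]], rule balancedD(2)[OF b2]) (use x in auto)
  next
    fix x r y assume x: "x \<in> carrier Q" "r \<in> carrier R" "y \<in> carrier B"
    have "Sw (rhoQ (ra' x r)) (\<lambda>y0 y1. frag_of (y0, y1, y))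
       \<simeq>[T3] Sw (Sw (rhoQ x) (\<lambda>x0 x1. frag_of (x0, x1 \<star> \<xi> r))) (\<lambda>y0 y1. frag_of (y0, y1, y))"
      by (intro Sw_balanced[OF b1 rhoQ_ra] x)
    also have "\<dots> = Sw (rhoQ x) (\<lambda>x0 x1. frag_of (x0, bract B x1 r, y))" by (simp add: Sw_Sw bract_eq)
    also have "\<dots> \<simeq>[T3] Sw (rhoQ x) (\<lambda>y0 y1. frag_of (y0, y1, blact B r y))"
      by (rule Sw_cong[OF rhoQ_keys[OF x(1)]], rule balancedD(3)[OF b2]) (use x in auto)
    finally show "Sw (rhoQ (ra' x r)) (\<lambda>y0 y1. frag_of (y0, y1, y))
       \<simeq>[T3] Sw (rhoQ x) (\<lambda>y0 y1. frag_of (y0, y1, blact B r y))" .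
  qed
  have D: "balQB T3 (\<lambda>x0 x1. Sw (ds x1) (\<lambda>d1 d2. frag_of (x0, d1, d2)))"
  proof (rule balancedI)
    fix x x' y assume x: "x \<in> carrier Q" "x' \<in> carrier Q" "y \<in> carrier B"
    show "Sw (ds y) (\<lambda>d1 d2. frag_of (x \<oplus>\<^bsub>Q\<^esub> x', d1, d2))
        \<simeq>[T3] Sw (ds y) (\<lambda>d1 d2. frag_of (x, d1, d2)) + Sw (ds y) (\<lambda>d1 d2. frag_of (x', d1, d2))"
      unfolding Sw_fadd[symmetric]
      by (rule Sw_cong[OF ds_keys[OF x(3)]], rule balancedD(1)[OF b1]) (use x in auto)
  next
    fix x y y' assume x: "x \<in> carrier Q" "y \<in> carrier B" "y' \<in> carrier B"
    show "Sw (ds (y \<oplus>\<^bsub>B\<^esub> y')) (\<lambda>d1 d2. frag_of (x, d1, d2))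
        \<simeq>[T3] Sw (ds y) (\<lambda>d1 d2. frag_of (x, d1, d2)) + Sw (ds y') (\<lambda>d1 d2. frag_of (x, d1, d2))"
      unfolding Sw_add[symmetric] by (intro Sw_balanced[OF b2 ds_add] x)
  next
    fix x r y assume x: "x \<in> carrier Q" "r \<in> carrier R" "y \<in> carrier B"
    have "Sw (ds (blact B r y)) (\<lambda>d1 d2. frag_of (x, d1, d2))
       \<simeq>[T3] Sw (Sw (ds y) (\<lambda>d1 d2. frag_of (d1 \<star> \<zeta> r, d2))) (\<lambda>d1 d2. frag_of (x, d1, d2))"
      unfolding blact_eq by (intro Sw_balanced[OF b2 ds_tgt] x)
    also have "\<dots> = Sw (ds y) (\<lambda>d1 d2. frag_of (x, blact B r d1, d2))" by (simp add: Sw_Sw blact_eq)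
    also have "\<dots> \<simeq>[T3] Sw (ds y) (\<lambda>d1 d2. frag_of (ra' x r, d1, d2))"
      by (rule Sw_cong[OF ds_keys[OF x(3)]], rule eqm_sym, rule balancedD(3)[OF b1]) (use x in auto)
    finally show "Sw (ds y) (\<lambda>d1 d2. frag_of (ra' x r, d1, d2))
       \<simeq>[T3] Sw (ds (blact B r y)) (\<lambda>d1 d2. frag_of (x, d1, d2))" by (rule eqm_sym)
  qed
  have b3T: "balanced3 (carrier R) T ra B (blact B) (bract B) B (blact B) T3 (\<lambda>x y z. frag_of (p x, y, z))"
    unfolding balanced3_def
  proof (intro conjI ballI)
    fix z assume "z \<in> carrier B"
    from balanced_comp[OF bal_push b1[OF this]] show "balTB T3 (\<lambda>x y. frag_of (p x, y, z))" by simp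
  qed (use b2 in simp)
  note kx = rho_keys[OF rp(1)[OF X]]
  have "fl [(y0, y1, x1). (x0, x1) \<leftarrow> us, (y0, y1) \<leftarrow> rs x0]
      = Sw (fl us) (\<lambda>x0 x1. Sw (fl (rs x0)) (\<lambda>y0 y1. frag_of (y0, y1, x1)))"
    by (simp add: fl_concat fl_map)
  also have "\<dots> \<simeq>[T3] Sw (fl us) (\<lambda>x0 x1. Sw (rhoQ x0) (\<lambda>y0 y1. frag_of (y0, y1, x1)))"
    by (intro Sw_cong[OF keys_fl[OF us(1)]] Sw_balanced[OF b1 rs(2)])
  also have "\<dots> \<simeq>[T3] Sw (rhoQ X) (\<lambda>x0 x1. Sw (rhoQ x0) (\<lambda>y0 y1. frag_of (y0, y1, x1)))"
    by (rule Sw_balanced[OF L us(2)])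
  also have "\<dots> = Sw (rho (rp X)) (\<lambda>x0 x1. Sw (rhoQ (p x0)) (\<lambda>y0 y1. frag_of (y0, y1, x1)))"
    by (simp add: rhoQ_def[of X] push_def Sw_Sw)
  also have "\<dots> \<simeq>[T3] Sw (rho (rp X)) (\<lambda>x0 x1. Sw (push (rho x0)) (\<lambda>y0 y1. frag_of (y0, y1, x1)))"
    by (intro Sw_cong[OF kx] Sw_balanced[OF b1 rhoQ_p])
  also have "\<dots> = Sw (rho (rp X)) (\<lambda>x0 x1. Sw (rho x0) (\<lambda>y0 y1. frag_of (p y0, y1, x1)))"
    by (simp add: push_def Sw_Sw)
  also have "\<dots> \<simeq>[T3] Sw (rho (rp X)) (\<lambda>x0 x1. Sw (ds x1) (\<lambda>d1 d2. frag_of (p x0, d1, d2)))"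
    by (rule rho_coassoc[OF rp(1)[OF X] b3T])
  also have "\<dots> = Sw (rhoQ X) (\<lambda>x0 x1. Sw (ds x1) (\<lambda>d1 d2. frag_of (x0, d1, d2)))"
    by (simp add: rhoQ_def push_def Sw_Sw)
  also have "\<dots> \<simeq>[T3] Sw (fl us) (\<lambda>x0 x1. Sw (ds x1) (\<lambda>d1 d2. frag_of (x0, d1, d2)))"
    by (rule Sw_balanced[OF D eqm_sym[OF us(2)]])
  also have "\<dots> \<simeq>[T3] Sw (fl us) (\<lambda>x0 x1. Sw (fl (ds' x1)) (\<lambda>d1 d2. frag_of (x0, d1, d2)))"
    by (intro Sw_cong[OF keys_fl[OF us(1)]] Sw_balanced[OF b2 ds'(2)])
  also have "\<dots> = fl [(x0, d1, d2). (x0, x1) \<leftarrow> us, (d1, d2) \<leftarrow> ds' x1]"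
    by (simp add: fl_concat fl_map_Pair)
  finally have e: "fl [(y0, y1, x1). (x0, x1) \<leftarrow> us, (y0, y1) \<leftarrow> rs x0]
      \<simeq>[T3] fl [(x0, d1, d2). (x0, x1) \<leftarrow> us, (d1, d2) \<leftarrow> ds' x1]" .
  show "tsum3 (carrier R) Q ra' B (blact B) (bract B) B (blact B) [(y0, y1, x1). (x0, x1) \<leftarrow> us, (y0, y1) \<leftarrow> rs x0]
      = tsum3 (carrier R) Q ra' B (blact B) (bract B) B (blact B) [(x0, d1, d2). (x0, x1) \<leftarrow> us, (d1, d2) \<leftarrow> ds' x1]"
    by (rule iffD2[OF tsum3_eq_iff[OF QBt.tensor_data_axioms BBt.tensor_data_axioms] e[unfolded T3_def]];
        rule concat_map_lists[OF us(1)]; rule map_lists, (rule rs(1) | rule ds'(1)), assumption, simp)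
next
  fix X us assume X: "X \<in> carrier Q" "us \<in> trepsB R B Q ra' (\<rho>' X)"
  have us: "us \<in> lists (carrier Q \<times> carrier B)" "fl us \<simeq>[QB] rhoQ X" using \<rho>'_treps[OF X(1)] X(2) by auto
  let ?l = "[ra' x0 (\<epsilon> x1). (x0, x1) \<leftarrow> us]"
  have l: "?l \<in> lists (carrier Q)" by (rule map_lists[OF us(1)]) (simp add: QBt.ra_clo)
  have bal: "balQB (add_rels Q) (\<lambda>x0 x1. frag_of (ra' x0 (\<epsilon> x1)))"
    by (rule balancedI) (simp_all add: right_mod.ra_add_left[OF right_mod_Q] right_mod.ra_add_right[OF right_mod_Q]
        right_mod.ra_assoc[OF right_mod_Q] QBt.ra_clo add_rels_base blact_eq counit_tgt)
  have "frag_of (lsum Q ?l) \<simeq>[add_rels Q] Sw (fl us) (\<lambda>x0 x1. frag_of (ra' x0 (\<epsilon> x1)))"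
    using frag_lsum[OF KQ.abelian_group_axioms l] by (simp add: fl_map)
  also have "\<dots> \<simeq>[add_rels Q] Sw (rhoQ X) (\<lambda>x0 x1. frag_of (ra' x0 (\<epsilon> x1)))" by (rule Sw_balanced[OF bal us(2)])
  \<comment> \<open>p is R-linear, so the counit sum is the image of the counit sum in T, which
    equals \<open>rp X\<close>.\<close>
  also have "\<dots> = frag_extend (\<lambda>t. frag_of (p t)) (Sw (rho (rp X)) (\<lambda>x0 x1. frag_of (ra x0 (\<epsilon> x1))))"
    unfolding rhoQ_def push_def Sw_Sw Sw_of extend_Sw frag_extend_of
    by (rule Sw_cong_eq[OF rho_keys[OF rp(1)[OF X(1)]]]) (simp add: ra'_p)
  also have "\<dots> \<simeq>[add_rels Q] frag_extend (\<lambda>t. frag_of (p t)) (frag_of (rp X))"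
    by (rule tr_extend[OF tr_p], rule eqm_mono[OF rho_counit[OF rp(1)[OF X(1)]]]) (simp add: CT_def)
  finally have "frag_of (lsum Q ?l) \<simeq>[add_rels Q] frag_of X" using rp X by simp
  then show "lsum Q ?l = X"
    by (rule frag_eqm_imp_eq[OF KQ.abelian_group_axioms _ X(1), rotated])
      (intro lsum_closed KQ.abelian_group_axioms, use l in auto)
qed

end

section \<open>The B-action on T/[S,T], compatibility and stability\<close>

context galois
begin

lemma act_closed [simp]: "b \<in> carrier B \<Longrightarrow> X \<in> carrier Q \<Longrightarrow> act b X \<in> carrier Q"
  by (auto simp: carrier_Q act_acb)

lemma act_tgt: "X \<in> carrier Q \<Longrightarrow> r \<in> carrier R \<Longrightarrow> act (\<zeta> r) X = ra' X r"
  unfolding carrier_Q by (elim imageE; simp add: ra'_p ra_e; intro act_eqI act1_tgt tr_CT; simp)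

lemma act_src: "t \<in> carrier T \<Longrightarrow> r \<in> carrier R \<Longrightarrow> act (\<xi> r) (p t) = p (e r \<cdot> t)"
  by (intro act_eqI act1_src tr_CT) auto

lemma act_mult:
  assumes "b \<in> carrier B" "c \<in> carrier B" "X \<in> carrier Q"
  shows "act (b \<star> c) X = act b (act c X)"
proof -
  note r = rp[OF assms(3)]
  have "act1 (b \<star> c) frag_of (rp X) \<simeq>[CT] act1 c (act1 b frag_of) (rp X)"
    by (rule act1_mult[OF tr_CT]) (use r assms in auto)
  also have "\<dots> \<simeq>[CT] act1 b frag_of (acb c (rp X))"
    by (rule eqm_sym, rule tr_acb[OF tr_act1[OF tr_CT]]) (use r assms in auto)
  also have "\<dots> \<simeq>[CT] frag_of (acb b (acb c (rp X)))"
    by (rule eqm_sym, rule tr_acb[OF tr_CT]) (use r assms in auto)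
  finally have "act (b \<star> c) (p (rp X)) = p (acb b (acb c (rp X)))"
    by (intro act_eqI) (use r assms in auto)
  then show ?thesis using r assms act_acb[of c "rp X"] act_acb[of b "acb c (rp X)"] by simp
qed

lemma act_add_right:
  assumes "b \<in> carrier B" "X \<in> carrier Q" "Y \<in> carrier Q"
  shows "act b (X \<oplus>\<^bsub>Q\<^esub> Y) = act b X \<oplus>\<^bsub>Q\<^esub> act b Y"
proof -
  obtain x y where x: "X = p x" "x \<in> carrier T" and y: "Y = p y" "y \<in> carrier T"
    using assms by (auto simp: carrier_Q)
  have "act1 b frag_of (x \<oplus>\<^bsub>T\<^esub> y) \<simeq>[CT] act1 b frag_of x + act1 b frag_of y"
    by (rule tr_add[OF tr_act1[OF tr_CT]]) (use x y assms in auto)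
  also have "\<dots> \<simeq>[CT] frag_of (acb b x) + frag_of (acb b y)"
    by (intro eqm_add eqm_sym[OF tr_acb[OF tr_CT]] x y assms)
  also have "\<dots> \<simeq>[CT] frag_of (acb b x \<oplus>\<^bsub>T\<^esub> acb b y)"
    by (rule eqm_sym, rule tr_add[OF tr_CT]) (use x y assms in auto)
  finally have "act b (p (x \<oplus>\<^bsub>T\<^esub> y)) = p (acb b x \<oplus>\<^bsub>T\<^esub> acb b y)"
    by (intro act_eqI) (use x y assms in auto)
  then show ?thesis using x y assms by (simp add: p_add act_acb)
qed

lemma act_add_left:
  assumes "b \<in> carrier B" "c \<in> carrier B" "X \<in> carrier Q"
  shows "act (b \<oplus>\<^bsub>B\<^esub> c) X = act b X \<oplus>\<^bsub>Q\<^esub> act c X"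
proof -
  obtain x where x: "X = p x" "x \<in> carrier T" using assms by (auto simp: carrier_Q)
  have "act1 (b \<oplus>\<^bsub>B\<^esub> c) frag_of x \<simeq>[CT] act1 b frag_of x + act1 c frag_of x"
    by (rule act1_add[OF tr_CT]) (use x assms in auto)
  also have "\<dots> \<simeq>[CT] frag_of (acb b x) + frag_of (acb c x)"
    by (intro eqm_add eqm_sym[OF tr_acb[OF tr_CT]] x assms)
  also have "\<dots> \<simeq>[CT] frag_of (acb b x \<oplus>\<^bsub>T\<^esub> acb c x)"
    by (rule eqm_sym, rule tr_add[OF tr_CT]) (use x assms in auto)
  finally have "act (b \<oplus>\<^bsub>B\<^esub> c) (p x) = p (acb b x \<oplus>\<^bsub>T\<^esub> acb c x)"
    by (intro act_eqI) (use x assms in auto)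
  then show ?thesis using x assms by (simp add: p_add act_acb)
qed

lemma algebra_B: "assoc_algebra K B"
  using bialg by (simp add: right_bialgebroid_def)

sublocale KB: module K B
  using algebra_B by (simp add: assoc_algebra_def)

text \<open>Scalars come from R: k b = \<xi>(k 1) b, and \<xi>(r) acts as left multiplication by
  \<open>e r\<close>, where e(k 1) = k 1 in T. This reduces K-linearity of the action to its
  multiplicativity.\<close>

lemma act_smult:
  assumes "k \<in> carrier K" "b \<in> carrier B" "X \<in> carrier Q"
  shows "act (k \<odot>\<^bsub>B\<^esub> b) X = k \<odot>\<^bsub>Q\<^esub> act b X"
proof -
  obtain x where x: "act b X = p x" "x \<in> carrier T" using act_closed[OF assms(2,3)] by (auto simp: carrier_Q)
  have kR: "k \<odot>\<^bsub>R\<^esub> \<one>\<^bsub>R\<^esub> \<in> carrier R" using assms by simp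
  have "\<xi> (k \<odot>\<^bsub>R\<^esub> \<one>\<^bsub>R\<^esub>) = k \<odot>\<^bsub>B\<^esub> \<xi> \<one>\<^bsub>R\<^esub>"
    using right_bialgebroid.src_hom[OF bialg] assms(1) by (simp add: algebra_hom_def)
  then have "k \<odot>\<^bsub>B\<^esub> b = \<xi> (k \<odot>\<^bsub>R\<^esub> \<one>\<^bsub>R\<^esub>) \<star> b"
    using assoc_algebra.smult_mult_left[OF algebra_B assms(1), of "\<one>\<^bsub>B\<^esub>" b] assms(2) by simp
  then have "act (k \<odot>\<^bsub>B\<^esub> b) X = act (\<xi> (k \<odot>\<^bsub>R\<^esub> \<one>\<^bsub>R\<^esub>)) (p x)"
    using act_mult[of "\<xi> (k \<odot>\<^bsub>R\<^esub> \<one>\<^bsub>R\<^esub>)" b X] x assms kR by simp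
  also have "\<dots> = p (e (k \<odot>\<^bsub>R\<^esub> \<one>\<^bsub>R\<^esub>) \<cdot> x)" by (rule act_src[OF x(2) kR])
  also have "e (k \<odot>\<^bsub>R\<^esub> \<one>\<^bsub>R\<^esub>) = k \<odot>\<^bsub>T\<^esub> \<one>\<^bsub>T\<^esub>"
    using right_mod.ra_smult[OF right_mod_X assms(1)] by (simp add: e_def)
  also have "k \<odot>\<^bsub>T\<^esub> \<one>\<^bsub>T\<^esub> \<cdot> x = k \<odot>\<^bsub>T\<^esub> x"
    using smult_mult_left[OF assms(1) T.one_closed x(2)] x by simp
  finally show ?thesis using x assms by (simp add: p_smult)
qed

lemma left_mod_Q: "left_mod K B Q act"
proof (intro left_mod.intro left_mod_axioms.intro algebra_B KQ.module_axioms)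
  show "act \<one>\<^bsub>B\<^esub> X = X" if "X \<in> carrier Q" for X
    using that unfolding carrier_Q by (elim imageE; simp; intro act_eqI act1_one tr_CT; simp)
qed (simp_all add: act_mult act_add_left act_add_right act_smult)

lemma bal_act_op:
  assumes x: "x0 \<in> carrier Q" "c \<in> carrier B"
  shows "balop QB (\<lambda>m h. frag_of (act h x0, c \<star> m))"
  by (rule balancedI, simp_all add: x B.r_distr act_add_left tensor_add_left tensor_add_right, rule eqm_sym, rule QB_midI)
    (use x in \<open>auto simp: act_mult act_tgt B.m_assoc\<close>)

text \<open>The counterpart of \<open>bal_ydh\<close> on the quotient. It is required because the
  compatibility axiom ranges over all representatives of the coaction of X.\<close>

lemma bal_act_hs:
  assumes d: "d \<in> carrier B" "b \<in> carrier B"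
  shows "balQB QB (\<lambda>x0 x1. Sw (hs b) (\<lambda>m h. frag_of (act h x0, d \<star> x1 \<star> m)))"
proof (rule balancedI)
  fix x r y assume x: "x \<in> carrier Q" "r \<in> carrier R" "y \<in> carrier B"
  have "Sw (hs b) (\<lambda>m h. frag_of (act h (ra' x r), d \<star> y \<star> m))
      = Sw (Sw (hs b) (\<lambda>m h. frag_of (m, h \<star> \<zeta> r))) (\<lambda>m h. frag_of (act h x, d \<star> y \<star> m))"
    unfolding Sw_Sw Sw_of
    by (rule Sw_cong_eq[OF hs_keys[OF d(2)]]) (use x in \<open>simp add: act_mult act_tgt\<close>)
  also have "\<dots> \<simeq>[QB] Sw (Sw (hs b) (\<lambda>m h. frag_of (\<zeta> r \<star> m, h))) (\<lambda>m h. frag_of (act h x, d \<star> y \<star> m))"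
    by (rule Sw_balanced[OF bal_act_op hs_tgt_comm]) (use x d in auto)
  also have "\<dots> = Sw (hs b) (\<lambda>m h. frag_of (act h x, d \<star> blact B r y \<star> m))"
    unfolding Sw_Sw Sw_of
    by (rule Sw_cong_eq[OF hs_keys[OF d(2)]]) (use x d in \<open>simp add: blact_eq B.m_assoc\<close>)
  finally show "Sw (hs b) (\<lambda>m h. frag_of (act h (ra' x r), d \<star> y \<star> m))
      \<simeq>[QB] Sw (hs b) (\<lambda>m h. frag_of (act h x, d \<star> blact B r y \<star> m))" .
qed (unfold Sw_fadd[symmetric]; rule Sw_cong[OF hs_keys[OF d(2)]];
    simp add: d act_add_right B.r_distr B.l_distr tensor_add_left tensor_add_right)+

text \<open>Passes from functions on T to the action itself: \<open>acb h y0\<close> represents the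
  result of the action, and t \<mapsto> t \<otimes> b is a function to which \<open>tr_acb\<close>
  applies.\<close>

lemma push_yd:
  assumes "d \<in> carrier B" "y0 \<in> carrier T" "y1 \<in> carrier B" "m \<in> carrier B" "h \<in> carrier B"
  shows "push (yd d y0 y1 m h) \<simeq>[QB] frag_of (act h (p y0), d \<star> y1 \<star> m)"
proof -
  have "frag_of (acb h y0, d \<star> y1 \<star> m) \<simeq>[CB] yd d y0 y1 m h"
    unfolding yd_def by (rule tr_acb[OF tr_CB]) (use assms in auto)
  from eqm_sym[OF push_cong[OF this]] show ?thesis using assms by (simp add: act_acb)
qed

lemma act_coact_Q:
  assumes b: "b \<in> carrier B" and X: "X \<in> carrier Q"
    and us: "us \<in> trepsB R B B (bract B) (comult B b)" and vs: "vs \<in> trepsB R B Q ra' (\<rho>' X)"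
    and hs': "hs' \<in> (\<Pi> d\<in>carrier B. treps_op R B (hopf_transl R B d))"
  shows "\<rho>' (act b X) = QBt.ts
    [(act bp x0, b2 \<star> x1 \<star> bm). (b1, b2) \<leftarrow> us, (x0, x1) \<leftarrow> vs, (bm, bp) \<leftarrow> hs' b1]"
proof (rule \<rho>'_eqI)
  note t = rp[OF X] and lus = treps_lists[OF us]
  have lvs: "vs \<in> lists (carrier Q \<times> carrier B)" "fl vs \<simeq>[QB] rhoQ X" using \<rho>'_treps[OF X] vs by auto
  have lhs: "hs' d \<in> lists (carrier B \<times> carrier B)" "hs d \<simeq>[Bop] fl (hs' d)" if "d \<in> carrier B" for d
    using hs' that hs_rep[OF that] treps_lists eqm_sym by blast+
  note kus = keys_fl[OF lus]
  have aX: "act b X = p (acb b (rp X))" using act_acb[OF b t(1)] t by simp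
  have "rhoQ (act b X) \<simeq>[QB] push (rho (acb b (rp X)))"
    unfolding aX by (rule rhoQ_p) (use b t in auto)
  \<comment> \<open>Taking \<rho> as the function in \<open>tr_acb\<close> expands the coaction of
    the chosen representative into a sum over b^- \<otimes> b^+.\<close>
  also have "\<dots> \<simeq>[QB] push (act1 b rho (rp X))" by (intro push_cong tr_acb[OF tr_rho] b t)
  also have "\<dots> \<simeq>[QB] push (Sw (fl us) (\<lambda>b1 b2. Sw (rho (rp X)) (ydh b2 b1)))"
    unfolding act1_def by (intro push_cong act_coact b t kus eqm_sym[OF ds_rep[OF b us]])
  also have "\<dots> = Sw (fl us) (\<lambda>b1 b2. Sw (rho (rp X)) (\<lambda>t0 t1. Sw (hs b1) (\<lambda>m h. push (yd b2 t0 t1 m h))))"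
    by (simp add: push_Sw ydh_def)
  also have "\<dots> \<simeq>[QB] Sw (fl us) (\<lambda>b1 b2. Sw (rho (rp X)) (\<lambda>t0 t1. Sw (hs b1) (\<lambda>m h. frag_of (act h (p t0), b2 \<star> t1 \<star> m))))"
    by (intro Sw_cong[OF kus] Sw_cong[OF rho_keys[OF t(1)]] Sw_cong[OF hs_keys] push_yd)
  also have "\<dots> = Sw (fl us) (\<lambda>b1 b2. Sw (rhoQ X) (\<lambda>x0 x1. Sw (hs b1) (\<lambda>m h. frag_of (act h x0, b2 \<star> x1 \<star> m))))"
    by (simp add: rhoQ_def push_def Sw_Sw)
  also have "\<dots> \<simeq>[QB] Sw (fl us) (\<lambda>b1 b2. Sw (fl vs) (\<lambda>x0 x1. Sw (hs b1) (\<lambda>m h. frag_of (act h x0, b2 \<star> x1 \<star> m))))"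
    by (intro Sw_cong[OF kus] Sw_balanced[OF bal_act_hs eqm_sym[OF lvs(2)]])
  also have "\<dots> \<simeq>[QB] Sw (fl us) (\<lambda>b1 b2. Sw (fl vs) (\<lambda>x0 x1. Sw (fl (hs' b1)) (\<lambda>m h. frag_of (act h x0, b2 \<star> x1 \<star> m))))"
    by (intro Sw_cong[OF kus] Sw_cong[OF keys_fl[OF lvs(1)]] Sw_balanced[OF bal_act_op lhs(2)]) auto
  finally show "rhoQ (act b X) \<simeq>[QB]
      fl [(act bp x0, b2 \<star> x1 \<star> bm). (b1, b2) \<leftarrow> us, (x0, x1) \<leftarrow> vs, (bm, bp) \<leftarrow> hs' b1]"
    by (simp add: fl_concat fl_map)
  show "[(act bp x0, b2 \<star> x1 \<star> bm). (b1, b2) \<leftarrow> us, (x0, x1) \<leftarrow> vs, (bm, bp) \<leftarrow> hs' b1] \<in> lists (carrier Q \<times> carrier B)"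
    by (rule concat_map_lists[OF lus], rule concat_map_lists[OF lvs(1)], rule map_lists[OF lhs(1)]) auto
qed (use b X in simp)

lemma comod_lact_Q:
  assumes X: "X \<in> carrier Q" and r: "r \<in> carrier R"
  shows "comod_lact R B Q ra' \<rho>' r X = act (\<xi> r) X"
proof -
  \<comment> \<open>The quotient is itself a comodule, so its left R-action is given by the same
    counit formula. As p is right R-linear and a comodule map, this formula is the image of the one
    for T, where r acts as left multiplication by \<open>e r\<close>.\<close>
  interpret Qc: comod K R B Q ra' \<rho>'
    by (intro comod.intro comod_axioms.intro bialg_axioms right_comodule_Q)
  note t = rp[OF X]
  have e1: "Qc.rho X \<simeq>[QB] rhoQ X" using Qc.rl[OF X] \<rho>'_treps[OF X] by (simp add: Qc.rho_def)
  have "frag_of (Qc.la r X) \<simeq>[add_rels Q] Sw (Qc.rho X) (\<lambda>x0 x1. frag_of (ra' x0 (\<epsilon> (\<xi> r \<star> x1))))"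
    by (rule Qc.frag_la[OF X r])
  also have "\<dots> \<simeq>[add_rels Q] Sw (rhoQ X) (\<lambda>x0 x1. frag_of (ra' x0 (\<epsilon> (\<xi> r \<star> x1))))"
    by (rule Sw_balanced[OF Qc.balanced_la[OF r] e1])
  also have "\<dots> = frag_extend (\<lambda>t. frag_of (p t)) (Sw (rho (rp X)) (\<lambda>x0 x1. frag_of (ra x0 (\<epsilon> (\<xi> r \<star> x1)))))"
    unfolding rhoQ_def push_def Sw_Sw Sw_of extend_Sw frag_extend_of
    by (rule Sw_cong_eq[OF rho_keys[OF t(1)]]) (use r in \<open>simp add: ra'_p\<close>)
  also have "\<dots> \<simeq>[add_rels Q] frag_extend (\<lambda>t. frag_of (p t)) (frag_of (la r (rp X)))"
    by (rule tr_extend[OF tr_p], rule eqm_mono[OF eqm_sym[OF frag_la[OF t(1) r]]]) (simp add: CT_def)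
  finally have "Qc.la r X = p (la r (rp X))"
    by (intro frag_eqm_imp_eq[OF KQ.abelian_group_axioms]) (use t r X in auto)
  then show ?thesis using act_src[OF t(1) r] t r by (simp add: la_e)
qed

lemma stable_Q:
  assumes X: "X \<in> carrier Q" and vs: "vs \<in> trepsB R B Q ra' (\<rho>' X)"
  shows "lsum Q [act x1 x0. (x0, x1) \<leftarrow> vs] = X"
proof -
  note t = rp[OF X]
  have lvs: "vs \<in> lists (carrier Q \<times> carrier B)" "fl vs \<simeq>[QB] rhoQ X" using \<rho>'_treps[OF X] vs by auto
  have l: "[act x1 x0. (x0, x1) \<leftarrow> vs] \<in> lists (carrier Q)" by (rule map_lists[OF lvs(1)]) simp
  have bal: "balQB (add_rels Q) (\<lambda>x0 x1. frag_of (act x1 x0))"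
    by (rule balancedI) (simp_all add: act_add_left act_add_right add_rels_base blact_eq act_mult act_tgt)
  have "frag_of (lsum Q [act x1 x0. (x0, x1) \<leftarrow> vs]) \<simeq>[add_rels Q] Sw (fl vs) (\<lambda>x0 x1. frag_of (act x1 x0))"
    using frag_lsum[OF KQ.abelian_group_axioms l] by (simp add: fl_map)
  also have "\<dots> \<simeq>[add_rels Q] Sw (rhoQ X) (\<lambda>x0 x1. frag_of (act x1 x0))" by (rule Sw_balanced[OF bal lvs(2)])
  also have "\<dots> = frag_extend (\<lambda>t. frag_of (p t)) (Sw (rho (rp X)) (\<lambda>x0 x1. frag_of (acb x1 x0)))"
    unfolding rhoQ_def push_def Sw_Sw Sw_of extend_Sw frag_extend_of
    by (rule Sw_cong_eq[OF rho_keys[OF t(1)]]) (simp add: act_acb)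
  also have "\<dots> \<simeq>[add_rels Q] frag_extend (\<lambda>t. frag_of (p t)) (frag_of (rp X))"
  proof (rule tr_extend[OF tr_p])
    \<comment> \<open>The factor 1 brings the sum into the form of \<open>act1_rho\<close> with y =
      1.\<close>
    have "Sw (rho (rp X)) (\<lambda>x0 x1. frag_of (acb x1 x0))
       \<simeq>[CT] Sw (rho (rp X)) (\<lambda>t0 t1. act1 t1 frag_of (\<one>\<^bsub>T\<^esub> \<cdot> t0))"
      by (rule Sw_cong[OF rho_keys[OF t(1)]]) (simp add: tr_acb[OF tr_CT])
    also have "\<dots> \<simeq>[CT] frag_of (rp X \<cdot> \<one>\<^bsub>T\<^esub>)" by (rule act1_rho[OF tr_CT t(1)]) simp
    finally show "Sw (rho (rp X)) (\<lambda>x0 x1. frag_of (acb x1 x0)) \<simeq>[CT] frag_of (rp X)" using t by simp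
  qed
  finally have "frag_of (lsum Q [act x1 x0. (x0, x1) \<leftarrow> vs]) \<simeq>[add_rels Q] frag_of X" using t by simp
  then show ?thesis
    by (rule frag_eqm_imp_eq[OF KQ.abelian_group_axioms _ X, rotated])
      (intro lsum_closed KQ.abelian_group_axioms, use l in auto)
qed

lemma stable_anti_YD_module_Q: "stable_anti_YD_module K R B Q ra' \<rho>' act"
  by (intro stable_anti_YD_module.intro stable_anti_YD_module_axioms.intro anti_YD_module.intro
      anti_YD_module_axioms.intro hopf right_comodule_Q left_mod_Q comod_lact_Q act_coact_Q stable_Q)
    (simp_all add: act_tgt)

end

section \<open>The cyclic tensor product\<close>

text \<open>The cyclic tensor product is an iterated quotient: the free group modulo the tensor
  relations, then modulo the cyclic ones. Here it becomes a single quotient of the free group by the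
  union \<open>CY\<close> of both sets of relations, so that the calculus of congruences applies to
  it as well.\<close>

lemma (in tensor_data) cyc_tensor_quotient:
  fixes lM :: "'a \<Rightarrow> 'm \<Rightarrow> 'm" and rN :: "'n \<Rightarrow> 'a \<Rightarrow> 'n"
  assumes lM: "\<And>a x. a \<in> A \<Longrightarrow> x \<in> carrier M \<Longrightarrow> lM a x \<in> carrier M"
    and rN: "\<And>a y. a \<in> A \<Longrightarrow> y \<in> carrier N \<Longrightarrow> rN y a \<in> carrier N"
  defines "CY \<equiv> rels \<union> {frag_of (lM a x, y) - frag_of (x, rN y a) | a x y. a \<in> A \<and> x \<in> carrier M \<and> y \<in> carrier N}"
  obtains \<gamma> where "\<gamma> \<in> hom F (cyc_tensor A M lM ra N la rN)"
    "\<gamma> ` carrier F = carrier (cyc_tensor A M lM ra N la rN)"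
    "\<And>z w. keys z \<subseteq> carrier M \<times> carrier N \<Longrightarrow> keys w \<subseteq> carrier M \<times> carrier N \<Longrightarrow> \<gamma> z = \<gamma> w \<longleftrightarrow> z \<simeq>[CY] w"
    "\<And>x y. \<gamma> (frag_of (x, y)) = cyc_pure A M lM ra N la rN x y"
proof -
  define \<kappa> where "\<kappa> z = tensor_null A M ra N la #>\<^bsub>F\<^esub> z" for z
  define J where "J = cyc_null A M lM ra N la rN"
  define \<gamma> where "\<gamma> z = J #>\<^bsub>TP\<^esub> \<kappa> z" for z
  interpret TP: comm_group TP by (rule comm_group_tensor)
  have khom: "\<kappa> \<in> hom F TP"
    unfolding \<kappa>_def[abs_def] tensor_def by (rule normal.r_coset_hom_Mod[OF null_normal])
  interpret k: group_hom F TP \<kappa>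
    by (intro group_hom.intro group_hom_axioms.intro group_free_Abelian_group TP.group_axioms khom)
  have kdiff: "\<kappa> (z - w) = \<kappa> z \<otimes>\<^bsub>TP\<^esub> inv\<^bsub>TP\<^esub> \<kappa> w"
    if "keys z \<subseteq> carrier M \<times> carrier N" "keys w \<subseteq> carrier M \<times> carrier N" for z w
    using k.hom_mult[of z "- w"] k.hom_inv[of w] that by simp
  have keq: "\<kappa> z = \<kappa> w \<longleftrightarrow> z \<simeq>[rels] w"
    if "keys z \<subseteq> carrier M \<times> carrier N" "keys w \<subseteq> carrier M \<times> carrier N" for z w
    unfolding \<kappa>_def by (rule coset_eq_iff[OF that])
  have ksurj: "\<exists>z. keys z \<subseteq> carrier M \<times> carrier N \<and> \<kappa> z = g" if g: "g \<in> carrier TP" for g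
  proof -
    obtain z where "z \<in> carrier F" "g = tensor_null A M ra N la #>\<^bsub>F\<^esub> z"
      using g by (auto simp: tensor_def carrier_FactGroup)
    then show ?thesis by (intro exI[of _ z]) (simp add: \<kappa>_def)
  qed
  have kts: "ts [u] = \<kappa> (frag_of u)" for u by (simp add: tsum_def \<kappa>_def)
  define J0 where "J0 = {\<kappa> (frag_of (lM a x, y) - frag_of (x, rN y a)) | a x y. a \<in> A \<and> x \<in> carrier M \<and> y \<in> carrier N}"
  have J: "J = generate TP J0"
  proof -
    have *: "\<kappa> (frag_of (lM a x, y) - frag_of (x, rN y a)) = ts [(lM a x, y)] \<otimes>\<^bsub>TP\<^esub> inv\<^bsub>TP\<^esub> ts [(x, rN y a)]"
      if "a \<in> A" "x \<in> carrier M" "y \<in> carrier N" for a x y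
      unfolding kts by (rule kdiff) (use that lM rN in auto)
    have "J0 = {ts [(lM a x, y)] \<otimes>\<^bsub>TP\<^esub> inv\<^bsub>TP\<^esub> ts [(x, rN y a)] | a x y. a \<in> A \<and> x \<in> carrier M \<and> y \<in> carrier N}"
      unfolding J0_def by (intro Collect_cong ex_cong1) (use * in auto)
    then show ?thesis by (simp add: J_def cyc_null_def)
  qed
  have kJ0: "keys (frag_of (lM a x, y) - frag_of (x, rN y a)) \<subseteq> carrier M \<times> carrier N"
    if "a \<in> A" "x \<in> carrier M" "y \<in> carrier N" for a x y
    by (rule order_trans[OF keys_diff]) (use that lM rN in auto)
  have J0: "J0 \<subseteq> carrier TP"
    unfolding J0_def using k.hom_closed kJ0 by auto
  have Jsub: "subgroup J TP" unfolding J by (rule TP.generate_is_subgroup[OF J0])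
  have Jnorm: "J \<lhd> TP" by (rule TP.subgroup_imp_normal[OF Jsub])
  have incl: "rels \<subseteq> CY" by (simp add: CY_def)
  \<comment> \<open>The statement ranges over all preimages z of g, because the induction runs over
    elements of the tensor product and a preimage of a product is only congruent to the sum of
    chosen preimages.\<close>
  have J1: "g \<in> J \<Longrightarrow> \<forall>z. keys z \<subseteq> carrier M \<times> carrier N \<longrightarrow> \<kappa> z = g \<longrightarrow> z \<simeq>[CY] 0" for g
    unfolding J
  proof (induction rule: generate.induct)
    case one
    show ?case
    proof (intro allI impI)
      fix z assume "keys z \<subseteq> carrier M \<times> carrier N" "\<kappa> z = \<one>\<^bsub>TP\<^esub>"
      then have "z \<simeq>[rels] 0" using keq[of z 0] k.hom_one by simp
      then show "z \<simeq>[CY] 0" by (rule eqm_mono[OF _ incl])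
    qed
  next
    case (incl h)
    then obtain a x y where h: "h = \<kappa> (frag_of (lM a x, y) - frag_of (x, rN y a))" "a \<in> A" "x \<in> carrier M" "y \<in> carrier N"
      unfolding J0_def by blast
    show ?case
    proof (intro allI impI)
      fix z assume "keys z \<subseteq> carrier M \<times> carrier N" "\<kappa> z = h"
      then have "z \<simeq>[rels] frag_of (lM a x, y) - frag_of (x, rN y a)" using keq kJ0 h by simp
      then have "z \<simeq>[CY] frag_of (lM a x, y) - frag_of (x, rN y a)" by (rule eqm_mono[OF _ \<open>rels \<subseteq> CY\<close>])
      also have "\<dots> \<simeq>[CY] 0" by (rule eqm_base) (use h in \<open>auto simp: CY_def\<close>)
      finally show "z \<simeq>[CY] 0" .
    qed
  next
    case (inv h)
    then obtain a x y where h: "h = \<kappa> (frag_of (lM a x, y) - frag_of (x, rN y a))" "a \<in> A" "x \<in> carrier M" "y \<in> carrier N"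
      unfolding J0_def by blast
    let ?n = "frag_of (lM a x, y) - frag_of (x, rN y a)"
    show ?case
    proof (intro allI impI)
      fix z assume z: "keys z \<subseteq> carrier M \<times> carrier N" "\<kappa> z = inv\<^bsub>TP\<^esub> h"
      have "\<kappa> (- ?n) = inv\<^bsub>TP\<^esub> h" using k.hom_inv[of ?n] kJ0 h by simp
      moreover have "keys (- ?n) \<subseteq> carrier M \<times> carrier N" using kJ0[OF h(2-4)] unfolding keys_minus .
      ultimately have "z \<simeq>[rels] - ?n" using z keq[of z "- ?n"] by blast
      then have "z \<simeq>[CY] - ?n" by (rule eqm_mono[OF _ \<open>rels \<subseteq> CY\<close>])
      moreover have "?n \<in> addspan CY" by (rule addspan_base) (use h in \<open>auto simp: CY_def\<close>)
      then have "- ?n \<simeq>[CY] 0" unfolding eqm_zero_iff by (rule addspan_uminus)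
      ultimately show "z \<simeq>[CY] 0" by (rule eqm_trans)
    qed
  next
    case (eng h1 h2)
    have "h1 \<in> carrier TP" "h2 \<in> carrier TP"
      using eng(1,2) TP.generate_incl[OF J0] by auto
    then obtain z1 z2 where z: "keys z1 \<subseteq> carrier M \<times> carrier N" "\<kappa> z1 = h1" "keys z2 \<subseteq> carrier M \<times> carrier N" "\<kappa> z2 = h2"
      using ksurj by metis
    show ?case
    proof (intro allI impI)
      fix z assume kz: "keys z \<subseteq> carrier M \<times> carrier N" "\<kappa> z = h1 \<otimes>\<^bsub>TP\<^esub> h2"
      have k12: "keys (z1 + z2) \<subseteq> carrier M \<times> carrier N" using keys_add[of z1 z2] z by blast
      have "\<kappa> z = \<kappa> (z1 + z2)" using kz z k.hom_mult[of z1 z2] by simp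
      then have "z \<simeq>[rels] z1 + z2" using keq[OF kz(1) k12] by simp
      then have "z \<simeq>[CY] z1 + z2" by (rule eqm_mono[OF _ incl])
      also have "\<dots> \<simeq>[CY] 0 + 0" by (rule eqm_add) (use eng z in auto)
      finally show "z \<simeq>[CY] 0" by simp
    qed
  qed
  have J2: "z \<in> addspan CY \<Longrightarrow> keys z \<subseteq> carrier M \<times> carrier N \<and> \<kappa> z \<in> J" for z
  proof (induction rule: addspan.induct)
    case addspan_zero
    show ?case using k.hom_one subgroup.one_closed[OF Jsub] by simp
  next
    case (addspan_base x)
    then show ?case unfolding CY_def
    proof
      assume x: "x \<in> rels"
      then have kx: "keys x \<subseteq> carrier M \<times> carrier N" by (rule keys_rels)
      have "x \<simeq>[rels] 0" by (rule eqm_base) (use x in simp)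
      then have "\<kappa> x = \<one>\<^bsub>TP\<^esub>" using keq[OF kx, of 0] k.hom_one by simp
      with kx show ?thesis using subgroup.one_closed[OF Jsub] by simp
    next
      assume "x \<in> {frag_of (lM a x, y) - frag_of (x, rN y a) | a x y. a \<in> A \<and> x \<in> carrier M \<and> y \<in> carrier N}"
      then show ?thesis unfolding J using kJ0 by (auto simp: J0_def intro!: generate.incl)
    qed
  next
    case (addspan_diff x y)
    then have "keys (x - y) \<subseteq> carrier M \<times> carrier N" using keys_diff[of x y] by blast
    moreover have "\<kappa> (x - y) \<in> J"
      using addspan_diff kdiff subgroup.m_closed[OF Jsub] subgroup.m_inv_closed[OF Jsub] by simp
    ultimately show ?case by simp
  qed
  show thesis
  proof (rule that[of \<gamma>])
    have "(\<lambda>a. J #>\<^bsub>TP\<^esub> a) \<in> hom TP (TP Mod J)" by (rule normal.r_coset_hom_Mod[OF Jnorm])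
    from hom_compose[OF khom this] show "\<gamma> \<in> hom F (cyc_tensor A M lM ra N la rN)"
      by (simp add: cyc_tensor_def J_def \<gamma>_def[abs_def] comp_def)
    show "\<gamma> ` carrier F = carrier (cyc_tensor A M lM ra N la rN)"
      unfolding cyc_tensor_def carrier_FactGroup J_def[symmetric]
    proof (intro equalityI subsetI; elim imageE)
      fix g z assume "g = \<gamma> z" "z \<in> carrier F"
      then show "g \<in> (\<lambda>x. J #>\<^bsub>TP\<^esub> x) ` carrier TP" unfolding \<gamma>_def using k.hom_closed by blast
    next
      fix g x assume x: "g = J #>\<^bsub>TP\<^esub> x" "x \<in> carrier TP"
      then obtain z where "keys z \<subseteq> carrier M \<times> carrier N" "\<kappa> z = x" using ksurj by blast
      with x show "g \<in> \<gamma> ` carrier F" unfolding \<gamma>_def by auto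
    qed
    show "\<gamma> (frag_of (x, y)) = cyc_pure A M lM ra N la rN x y" for x y
      by (simp add: \<gamma>_def cyc_pure_def J_def kts)
    fix z w :: "'m \<times> 'n \<Rightarrow>\<^sub>0 int"
    assume k: "keys z \<subseteq> carrier M \<times> carrier N" "keys w \<subseteq> carrier M \<times> carrier N"
    then have c: "\<kappa> z \<in> carrier TP" "\<kappa> w \<in> carrier TP" using k.hom_closed by auto
    have kd: "keys (z - w) \<subseteq> carrier M \<times> carrier N" using keys_diff[of z w] k by blast
    have "\<gamma> z = \<gamma> w \<longleftrightarrow> \<kappa> z \<in> J #>\<^bsub>TP\<^esub> \<kappa> w"
      unfolding \<gamma>_def
      using TP.rcos_self[OF c(1) Jsub] TP.repr_independence[OF _ c(2) Jsub] by metis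
    also have "\<dots> \<longleftrightarrow> \<kappa> (z - w) \<in> J"
      unfolding kdiff[OF k] by (rule subgroup.rcos_module[OF Jsub TP.group_axioms c(2,1)])
    also have "\<dots> \<longleftrightarrow> z \<simeq>[CY] w"
      using J1 J2 kd by (auto simp: eqm_def eqm_zero_iff)
    finally show "\<gamma> z = \<gamma> w \<longleftrightarrow> z \<simeq>[CY] w" .
  qed
qed

section \<open>T/[S,T] as a cyclic tensor product\<close>

context galois
begin

lemma one_S: "\<one>\<^bsub>T\<^esub> \<in> S"
  using rho_one by (simp add: mem_S_iff)

lemma add_S: "s \<in> S \<Longrightarrow> s' \<in> S \<Longrightarrow> s \<oplus>\<^bsub>T\<^esub> s' \<in> S"
proof -
  assume s: "s \<in> S" "s' \<in> S"
  have "rho (s \<oplus>\<^bsub>T\<^esub> s') \<simeq>[TB] rho s + rho s'" by (rule rho_add) (use s in auto)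
  also have "\<dots> \<simeq>[TB] frag_of (s, \<one>\<^bsub>B\<^esub>) + frag_of (s', \<one>\<^bsub>B\<^esub>)" by (intro eqm_add rho_S s)
  also have "\<dots> \<simeq>[TB] frag_of (s \<oplus>\<^bsub>T\<^esub> s', \<one>\<^bsub>B\<^esub>)" by (rule eqm_sym, rule tensor_add_left) (use s in auto)
  finally show ?thesis using s by (simp add: mem_S_iff)
qed

text \<open>\<rho>(1) + \<rho>(-1) = 0 determines \<rho>(-1). Other negatives follow by
  multiplication with -1.\<close>

lemma minus_one_S: "\<ominus>\<^bsub>T\<^esub> \<one>\<^bsub>T\<^esub> \<in> S"
proof -
  let ?m = "\<ominus>\<^bsub>T\<^esub> \<one>\<^bsub>T\<^esub>"
  have z: "frag_of (\<zero>\<^bsub>T\<^esub>, \<one>\<^bsub>B\<^esub>) \<simeq>[TB] 0"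
    using tensor_add_left[of "\<zero>\<^bsub>T\<^esub>" T "\<zero>\<^bsub>T\<^esub>" "\<one>\<^bsub>B\<^esub>" B "carrier R" ra "blact B"]
    by (intro eqm_zero_of_double) simp
  have r0: "rho \<zero>\<^bsub>T\<^esub> \<simeq>[TB] 0"
    using rho_add[of "\<zero>\<^bsub>T\<^esub>" "\<zero>\<^bsub>T\<^esub>"] by (intro eqm_zero_of_double) simp
  have a: "rho \<one>\<^bsub>T\<^esub> + rho ?m \<simeq>[TB] 0"
    using eqm_trans[OF eqm_sym[OF rho_add[of "\<one>\<^bsub>T\<^esub>" ?m]]] r0 by (simp add: X.r_neg)
  have "frag_of (\<one>\<^bsub>T\<^esub> \<oplus>\<^bsub>T\<^esub> ?m, \<one>\<^bsub>B\<^esub>) \<simeq>[TB] frag_of (\<one>\<^bsub>T\<^esub>, \<one>\<^bsub>B\<^esub>) + frag_of (?m, \<one>\<^bsub>B\<^esub>)"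
    by (rule tensor_add_left) auto
  then have b: "0 \<simeq>[TB] frag_of (\<one>\<^bsub>T\<^esub>, \<one>\<^bsub>B\<^esub>) + frag_of (?m, \<one>\<^bsub>B\<^esub>)"
    using eqm_trans[OF eqm_sym[OF z]] by (simp add: X.r_neg)
  have "rho \<one>\<^bsub>T\<^esub> + rho ?m - rho \<one>\<^bsub>T\<^esub>
      \<simeq>[TB] frag_of (\<one>\<^bsub>T\<^esub>, \<one>\<^bsub>B\<^esub>) + frag_of (?m, \<one>\<^bsub>B\<^esub>) - frag_of (\<one>\<^bsub>T\<^esub>, \<one>\<^bsub>B\<^esub>)"
    by (rule eqm_diff[OF eqm_trans[OF a b] rho_one])
  then show ?thesis by (simp add: mem_S_iff)
qed

lemma mult_S: "s \<in> S \<Longrightarrow> s' \<in> S \<Longrightarrow> s \<cdot> s' \<in> S"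
proof -
  assume s: "s \<in> S" "s' \<in> S"
  have "rho (s \<cdot> s') \<simeq>[TB] Sw (rho s') (\<lambda>y0 y1. frag_of (s \<cdot> y0, y1))" by (rule rho_S_left) (use s in auto)
  also have "\<dots> \<simeq>[TB] frag_of (s \<cdot> s', \<one>\<^bsub>B\<^esub>)"
    using Sw_balanced[OF bal_mult_left_T[OF S_closed[OF s(1)]] rho_S[OF s(2)]] by simp
  finally show ?thesis using s by (simp add: mem_S_iff)
qed

lemma uminus_S: "s \<in> S \<Longrightarrow> \<ominus>\<^bsub>T\<^esub> s \<in> S"
  using mult_S[OF minus_one_S, of s] by (simp add: T.l_minus)

lemma zero_S: "\<zero>\<^bsub>T\<^esub> \<in> S"
  using add_S[OF one_S minus_one_S] by (simp add: X.r_neg)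

abbreviation "T\<^sub>S \<equiv> T\<lparr>carrier := S\<rparr>"

lemma abelian_group_S: "abelian_group T\<^sub>S"
proof (rule abelian_groupI)
  fix x assume "x \<in> carrier T\<^sub>S"
  then show "\<exists>y\<in>carrier T\<^sub>S. y \<oplus>\<^bsub>T\<^sub>S\<^esub> x = \<zero>\<^bsub>T\<^sub>S\<^esub>"
    by (intro bexI[of _ "\<ominus>\<^bsub>T\<^esub> x"]) (simp_all add: uminus_S X.l_neg)
qed (simp_all add: add_S zero_S X.a_ac)

sublocale STt: tensor_data S "T\<^sub>S" "monoid.mult T" T "monoid.mult T"
  by (intro tensor_data.intro abelian_group_S X.abelian_group_axioms) (auto intro: mult_S)

text \<open>In S \<otimes> T over S every s \<otimes> t equals 1 \<otimes> st, and the cyclic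
  relation then says 1 \<otimes> st = 1 \<otimes> ts. So t \<mapsto> 1 \<otimes> t induces a map
  from T/[S,T], with inverse induced by the multiplication s \<otimes> t \<mapsto> st.\<close>

lemma iso_cyc:
  "\<exists>\<phi> \<in> iso (add_monoid Q) (cycS S T). \<forall>s\<in>S. \<forall>t\<in>carrier T. \<phi> (p (s \<cdot> t)) = cyc_pureS S T s t"
proof -
  define CY where "CY = STt.rels \<union> {frag_of (a \<cdot> x, y) - frag_of (x, y \<cdot> a) | a x y. a \<in> S \<and> x \<in> carrier T\<^sub>S \<and> y \<in> carrier T}"
  obtain \<gamma> where \<gamma>: "\<gamma> \<in> hom STt.F (cycS S T)" "\<gamma> ` carrier STt.F = carrier (cycS S T)"
    and \<gamma>_eq: "\<And>z w. keys z \<subseteq> carrier T\<^sub>S \<times> carrier T \<Longrightarrow> keys w \<subseteq> carrier T\<^sub>S \<times> carrier T \<Longrightarrow> \<gamma> z = \<gamma> w \<longleftrightarrow> z \<simeq>[CY] w"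
    and \<gamma>_pure: "\<And>x y. \<gamma> (frag_of (x, y)) = cyc_pureS S T x y"
    by (rule STt.cyc_tensor_quotient[where lM = "monoid.mult T" and rN = "monoid.mult T", folded CY_def])
      (simp_all add: mult_S)
  have rel: "z \<simeq>[STt.rels] w \<Longrightarrow> z \<simeq>[CY] w" for z w by (erule eqm_mono) (simp add: CY_def)
  have st: "frag_of (s, t) \<simeq>[CY] frag_of (\<one>\<^bsub>T\<^esub>, s \<cdot> t)" if "s \<in> S" "t \<in> carrier T" for s t
    using rel[OF tensor_mid[of "\<one>\<^bsub>T\<^esub>" "T\<^sub>S" s S t T "monoid.mult T" "monoid.mult T"]] that one_S by simp
  have trCY: "tr CY (\<lambda>x. frag_of (\<one>\<^bsub>T\<^esub>, x))"
    unfolding tr_def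
  proof (intro conjI ballI)
    fix x y assume "x \<in> carrier T" "y \<in> carrier T"
    then show "frag_of (\<one>\<^bsub>T\<^esub>, x \<oplus>\<^bsub>T\<^esub> y) \<simeq>[CY] frag_of (\<one>\<^bsub>T\<^esub>, x) + frag_of (\<one>\<^bsub>T\<^esub>, y)"
      by (intro rel tensor_add_right) (simp_all add: one_S)
  next
    fix s x assume s: "s \<in> S" "x \<in> carrier T"
    have "frag_of (s \<cdot> \<one>\<^bsub>T\<^esub>, x) - frag_of (\<one>\<^bsub>T\<^esub>, x \<cdot> s) \<in> CY"
      unfolding CY_def
      by (rule UnI2, rule CollectI, intro exI[of _ s] exI[of _ "\<one>\<^bsub>T\<^esub>"] exI[of _ x]) (use s one_S in simp)
    then have "frag_of (s, x) \<simeq>[CY] frag_of (\<one>\<^bsub>T\<^esub>, x \<cdot> s)" using s by (intro eqm_base) simp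
    with st[OF s] show "frag_of (\<one>\<^bsub>T\<^esub>, s \<cdot> x) \<simeq>[CY] frag_of (\<one>\<^bsub>T\<^esub>, x \<cdot> s)"
      using eqm_sym eqm_trans by blast
  qed
  \<comment> \<open>Injectivity: multiplication carries the relations of \<open>CY\<close> into
    those of \<open>CT\<close>; a cyclic relation for a, x, y becomes the commutator of a with
    xy.\<close>
  have CY_CT: "frag_of x \<simeq>[CT] frag_of y" if "frag_of (\<one>\<^bsub>T\<^esub>, x) \<simeq>[CY] frag_of (\<one>\<^bsub>T\<^esub>, y)" "x \<in> carrier T" "y \<in> carrier T" for x y
  proof -
    have bal: "balanced S T\<^sub>S (monoid.mult T) T (monoid.mult T) CT (\<lambda>s t. frag_of (s \<cdot> t))"
      by (rule balancedI) (simp_all add: T.l_distr T.r_distr T.m_assoc tr_add[OF tr_CT])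
    have "frag_extend (\<lambda>(s, t). frag_of (s \<cdot> t)) (frag_of (\<one>\<^bsub>T\<^esub>, x)) \<simeq>[CT] frag_extend (\<lambda>(s, t). frag_of (s \<cdot> t)) (frag_of (\<one>\<^bsub>T\<^esub>, y))"
    proof (rule eqm_extend[OF _ that(1)])
      fix n assume "n \<in> CY"
      then show "frag_extend (\<lambda>(s, t). frag_of (s \<cdot> t)) n \<simeq>[CT] 0"
        unfolding CY_def
      proof (elim UnE CollectE exE conjE)
        assume "n \<in> STt.rels"
        then have "n \<simeq>[STt.rels] 0" by (intro eqm_base) simp
        from Sw_balanced[OF bal this] show ?thesis by (simp add: Sw_def)
      next
        fix a x y assume n: "n = frag_of (a \<cdot> x, y) - frag_of (x, y \<cdot> a)" "a \<in> S" "x \<in> carrier T\<^sub>S" "y \<in> carrier T"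
        then show ?thesis
          using tr_comm[OF tr_CT, of a "x \<cdot> y"] by (simp add: frag_extend_diff T.m_assoc eqm_def)
      qed
    qed
    then show ?thesis using that by simp
  qed
  define \<phi> where "\<phi> X = \<gamma> (frag_of (\<one>\<^bsub>T\<^esub>, rp X))" for X
  have \<phi>_p: "\<phi> (p t) = \<gamma> (frag_of (\<one>\<^bsub>T\<^esub>, t))" if "t \<in> carrier T" for t
    unfolding \<phi>_def
    by (rule iffD2[OF \<gamma>_eq tr_cong[OF trCY]]) (use that one_S in \<open>auto simp: rp\<close>)
  \<comment> \<open>Pure tensors have the form 1 \<otimes> st, and additivity in the second factor
    merges a difference of such tensors into one.\<close>
  have \<gamma>_surj: "\<exists>t\<in>carrier T. z \<simeq>[CY] frag_of (\<one>\<^bsub>T\<^esub>, t)" if "keys z \<subseteq> S \<times> carrier T" for z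
    using that
  proof (induction z rule: frag_induction)
    case zero
    show ?case using eqm_sym[OF tr_zero[OF trCY]] by blast
  next
    case (one x)
    then obtain s t where x: "x = (s, t)" "s \<in> S" "t \<in> carrier T" by auto
    show ?case unfolding x(1) by (intro bexI[of _ "s \<cdot> t"] st) (use x in simp_all)
  next
    case (diff a b)
    then obtain t t' where t: "t \<in> carrier T" "t' \<in> carrier T" "a \<simeq>[CY] frag_of (\<one>\<^bsub>T\<^esub>, t)" "b \<simeq>[CY] frag_of (\<one>\<^bsub>T\<^esub>, t')"
      by blast
    have "a - b \<simeq>[CY] frag_of (\<one>\<^bsub>T\<^esub>, t \<ominus>\<^bsub>T\<^esub> t')"
      by (rule eqm_trans[OF eqm_diff[OF t(3,4)] eqm_sym[OF tr_minus[OF trCY t(1,2)]]])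
    then show ?case using t by (intro bexI[of _ "t \<ominus>\<^bsub>T\<^esub> t'"]) auto
  qed
  have "\<phi> \<in> iso (add_monoid Q) (cycS S T)"
    unfolding iso_def bij_betw_def
  proof (intro CollectI conjI homI inj_onI)
    fix X assume "X \<in> carrier (add_monoid Q)"
    then have "frag_of (\<one>\<^bsub>T\<^esub>, rp X) \<in> carrier STt.F" by (simp add: rp one_S)
    then show "\<phi> X \<in> carrier (cycS S T)" unfolding \<phi>_def using \<gamma>(2) by blast
  next
    fix X Y assume XY: "X \<in> carrier (add_monoid Q)" "Y \<in> carrier (add_monoid Q)"
    then have t: "rp X \<in> carrier T" "rp Y \<in> carrier T" "p (rp X) = X" "p (rp Y) = Y" by (simp_all add: rp)
    have k2: "keys (frag_of (\<one>\<^bsub>T\<^esub>, rp X) + frag_of (\<one>\<^bsub>T\<^esub>, rp Y)) \<subseteq> carrier T\<^sub>S \<times> carrier T"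
      by (rule order_trans[OF keys_add]) (use t one_S in simp)
    have "\<phi> (X \<oplus>\<^bsub>Q\<^esub> Y) = \<phi> (p (rp X \<oplus>\<^bsub>T\<^esub> rp Y))" using t by (simp add: p_add[symmetric])
    also have "\<dots> = \<gamma> (frag_of (\<one>\<^bsub>T\<^esub>, rp X \<oplus>\<^bsub>T\<^esub> rp Y))" by (rule \<phi>_p) (use t in simp)
    also have "\<dots> = \<gamma> (frag_of (\<one>\<^bsub>T\<^esub>, rp X) + frag_of (\<one>\<^bsub>T\<^esub>, rp Y))"
      by (rule iffD2[OF \<gamma>_eq[OF _ k2] tr_add[OF trCY t(1,2)]]) (use t one_S in simp)
    also have "\<dots> = \<phi> X \<otimes>\<^bsub>cycS S T\<^esub> \<phi> Y"
      unfolding \<phi>_def using hom_mult[OF \<gamma>(1), of "frag_of (\<one>\<^bsub>T\<^esub>, rp X)" "frag_of (\<one>\<^bsub>T\<^esub>, rp Y)"] t one_S by simp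
    finally show "\<phi> (X \<otimes>\<^bsub>add_monoid Q\<^esub> Y) = \<phi> X \<otimes>\<^bsub>cycS S T\<^esub> \<phi> Y" by simp
  next
    fix X Y assume XY: "X \<in> carrier (add_monoid Q)" "Y \<in> carrier (add_monoid Q)" "\<phi> X = \<phi> Y"
    then have t: "rp X \<in> carrier T" "rp Y \<in> carrier T" "p (rp X) = X" "p (rp Y) = Y" by (simp_all add: rp)
    have "frag_of (\<one>\<^bsub>T\<^esub>, rp X) \<simeq>[CY] frag_of (\<one>\<^bsub>T\<^esub>, rp Y)"
      by (rule iffD1[OF \<gamma>_eq XY(3)[unfolded \<phi>_def]]) (use t one_S in auto)
    from CY_CT[OF this t(1,2)] have "p (rp X) = p (rp Y)" using p_eq_iff t(1,2) by simp
    then show "X = Y" using t by simp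
  next
    show "\<phi> ` carrier (add_monoid Q) = carrier (cycS S T)"
    proof (intro equalityI subsetI)
      fix g assume "g \<in> \<phi> ` carrier (add_monoid Q)"
      then obtain X where X: "X \<in> carrier Q" "g = \<phi> X" by auto
      then have "frag_of (\<one>\<^bsub>T\<^esub>, rp X) \<in> carrier STt.F" by (simp add: rp one_S)
      then show "g \<in> carrier (cycS S T)" using X(2) \<gamma>(2) unfolding \<phi>_def by blast
    next
      fix g assume "g \<in> carrier (cycS S T)"
      then have "g \<in> \<gamma> ` carrier STt.F" using \<gamma>(2) by simp
      then obtain z where z: "keys z \<subseteq> S \<times> carrier T" "g = \<gamma> z" by auto
      from \<gamma>_surj[OF z(1)] obtain t where t: "t \<in> carrier T" "z \<simeq>[CY] frag_of (\<one>\<^bsub>T\<^esub>, t)" by blast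
      have "g = \<phi> (p t)"
        unfolding z(2) \<phi>_p[OF t(1)] by (rule iffD2[OF \<gamma>_eq t(2)]) (use z t one_S in auto)
      then show "g \<in> \<phi> ` carrier (add_monoid Q)" using t by simp
    qed
  qed
  moreover have "\<phi> (p (s \<cdot> t)) = cyc_pureS S T s t" if s: "s \<in> S" "t \<in> carrier T" for s t
  proof -
    have "\<phi> (p (s \<cdot> t)) = \<gamma> (frag_of (\<one>\<^bsub>T\<^esub>, s \<cdot> t))" by (rule \<phi>_p) (use s in simp)
    also have "\<dots> = \<gamma> (frag_of (s, t))"
      by (rule iffD2[OF \<gamma>_eq eqm_sym[OF st[OF s]]]) (use s one_S in auto)
    finally show ?thesis by (simp add: \<gamma>_pure)
  qed
  ultimately show ?thesis by blast
qed

end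

text \<open>As the projection is onto and every tensor has a representative, the three formulas
  determine \<open>ra'\<close>, \<open>\<rho>'\<close> and \<open>act\<close> on their carriers, so
  the existential statement does describe the induced structure.\<close>

theorem proposition2p23:
  fixes K :: "('k, 'p) ring_scheme"
    and R :: "('k, 'r, 'q) module_scheme"
    and B :: "('k, 'r, 'b) bialgebroid"
    and S :: "'t set"
    and T :: "('k, 't, 's) module_scheme"
    and ra :: "'t \<Rightarrow> 'r \<Rightarrow> 't"
    and \<rho> :: "'t \<Rightarrow> ('t \<times> 'b \<Rightarrow>\<^sub>0 int) set"
  assumes "right_xR_Hopf K R B"
    and "galois_extension K R B S T ra \<rho>"
  shows
    "(\<exists>\<phi> \<in> iso (add_monoid (comm_quot K S T)) (cycS S T).
        \<forall>s\<in>S. \<forall>t\<in>carrier T. \<phi> (comm_proj K S T (s \<otimes>\<^bsub>T\<^esub> t)) = cyc_pureS S T s t)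
     \<and> (\<exists>ra' \<rho>' act.
        stable_anti_YD_module K R B (comm_quot K S T) ra' \<rho>' act
      \<and> (\<forall>t\<in>carrier T. \<forall>r\<in>carrier R.
           ra' (comm_proj K S T t) r = comm_proj K S T (ra t r))
      \<and> (\<forall>t\<in>carrier T. \<forall>us \<in> trepsB R B T ra (\<rho> t).
           \<rho>' (comm_proj K S T t)
             = tsumB R B (comm_quot K S T) ra' [(comm_proj K S T t0, t1). (t0, t1) \<leftarrow> us])
      \<and> (\<forall>b\<in>carrier B. \<forall>t\<in>carrier T. \<forall>cs \<in> trepsS S T (can_transl R B S T ra \<rho> b).
           act b (comm_proj K S T t)
             = comm_proj K S T (lsum T [cp \<otimes>\<^bsub>T\<^esub> t \<otimes>\<^bsub>T\<^esub> cm. (cm, cp) \<leftarrow> cs])))"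
proof -
  have bi: "right_bialgebroid K R B" using assms(1) by (simp add: right_xR_Hopf_def)
  have co: "right_comodule K R B T ra \<rho>"
    using assms(2) by (simp add: galois_extension_def comodule_algebra_def)
  interpret galois K R B T ra \<rho> S
    by (intro galois.intro hopf.intro comod.intro bialg.intro hopf_axioms.intro comod_axioms.intro
        galois_axioms.intro bi co assms)
  have "\<exists>ra' \<rho>' act. stable_anti_YD_module K R B Q ra' \<rho>' act
      \<and> (\<forall>t\<in>carrier T. \<forall>r\<in>carrier R. ra' (p t) r = p (ra t r))
      \<and> (\<forall>t\<in>carrier T. \<forall>us \<in> trepsB R B T ra (\<rho> t).
           \<rho>' (p t) = tsumB R B Q ra' [(p t0, t1). (t0, t1) \<leftarrow> us])
      \<and> (\<forall>b\<in>carrier B. \<forall>t\<in>carrier T. \<forall>cs \<in> trepsS S T (can_transl R B S T ra \<rho> b).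
           act b (p t) = p (lsum T [cp \<otimes>\<^bsub>T\<^esub> t \<otimes>\<^bsub>T\<^esub> cm. (cm, cp) \<leftarrow> cs]))"
    by (intro exI[of _ ra'] exI[of _ \<rho>'] exI[of _ act] conjI ballI stable_anti_YD_module_Q)
      (simp_all add: ra'_p \<rho>'_p act_p ac_def)
  with iso_cyc show ?thesis by (rule conjI)
qed

end
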